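(* Let $\varphi$ be a toric plurisubharmonic function on the polydisk $D(0,r)=\{z\in\mathbb{C}^n:\ |z_i|<r\text{ for all }i\}$, $r>0$. Then $$\mathscr{I}_+(\varphi)=\mathscr{I}(\varphi).$$
   Context: A psh function $\varphi$ (not identically $-\infty$) on $D(0,r)$ is toric if it is invariant under $(z_1,\ldots,z_n)\mapsto(e^{i\theta_1}z_1,\ldots,e^{i\theta_n}z_n)$ for all real $\theta_j$. The multiplier ideal sheaf $\mathscr{I}(\varphi)$ consists of the germs $f\in\mathcal{O}_{x}$ of holomorphic functions such that $|f|^2e^{-2\varphi}$ is Lebesgue integrable near $x$, and $\mathscr{I}_+(\varphi)=\bigcup_{\epsilon>0}\mathscr{I}((1+\epsilon)\varphi)$. *)

theory Defs
  imports "HOL-Analysis.Analysis"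
begin

definition polydisk :: "real \<Rightarrow> (complex^'n) set" where
  "polydisk r = {z. \<forall>i. cmod (z $ i) < r}"

definition holomorphic_vec_on :: "(complex^'n \<Rightarrow> complex) \<Rightarrow> (complex^'n) set \<Rightarrow> bool" where
  "holomorphic_vec_on f U \<longleftrightarrow>
     open U \<and>
     (\<forall>z\<in>U. \<exists>f'. (f has_derivative f') (at z) \<and> Vector_Spaces.linear (*s) (*) f')"

definition germ :: "'a::topological_space \<Rightarrow> ('a \<Rightarrow> 'b) \<Rightarrow> ('a \<Rightarrow> 'b) set" where
  "germ x f = {g. \<forall>\<^sub>F z in nhds x. g z = f z}"

definition usc_on :: "'a::topological_space set \<Rightarrow> ('a \<Rightarrow> ereal) \<Rightarrow> bool" where
  "usc_on S u \<longleftrightarrow> (\<forall>c. openin (top_of_set S) {z \<in> S. u z < c})"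

text \<open>The extended Lebesgue integral, as positive part minus negative part. For the functions
  it is used on (upper semicontinuous and \<open>< \<infinity>\<close> on a compact set) the integral of the positive
  part is finite, so that the difference is meaningful and lies in \<open>[-\<infinity>, \<infinity>)\<close>.\<close>

definition ereal_integral :: "'a measure \<Rightarrow> ('a \<Rightarrow> ereal) \<Rightarrow> ereal" where
  "ereal_integral M u =
     enn2ereal (\<integral>\<^sup>+ t. e2ennreal (u t) \<partial>M) - enn2ereal (\<integral>\<^sup>+ t. e2ennreal (- u t) \<partial>M)"

text \<open>The functions live on \<open>\<Omega>\<close>; values outside \<open>\<Omega>\<close> are irrelevant. The function that is
  identically \<open>-\<infinity>\<close> is admitted here and excluded in the definition of toric functions below.\<close>

definition psh_on :: "(complex^'n) set \<Rightarrow> (complex^'n \<Rightarrow> ereal) \<Rightarrow> bool" where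
  "psh_on \<Omega> \<phi> \<longleftrightarrow>
     (\<forall>z\<in>\<Omega>. \<phi> z < \<infinity>) \<and> usc_on \<Omega> \<phi> \<and>
     (\<forall>a b. (\<forall>\<zeta>. cmod \<zeta> \<le> 1 \<longrightarrow> a + \<zeta> *s b \<in> \<Omega>) \<longrightarrow>
        \<phi> a \<le> ereal (1 / (2 * pi)) *
               ereal_integral (lebesgue_on {0..2 * pi}) (\<lambda>\<theta>. \<phi> (a + cis \<theta> *s b)))"

definition toric_psh_on_polydisk :: "real \<Rightarrow> (complex^'n \<Rightarrow> ereal) \<Rightarrow> bool" where
  "toric_psh_on_polydisk r \<phi> \<longleftrightarrow>
     psh_on (polydisk r) \<phi> \<and>
     (\<exists>z\<in>polydisk r. \<phi> z \<noteq> -\<infinity>) \<and>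
     (\<forall>\<theta> :: real^'n. \<forall>z\<in>polydisk r. \<phi> (\<chi> i. cis (\<theta> $ i) * z $ i) = \<phi> z)"

definition exp_ereal :: "ereal \<Rightarrow> ennreal" where
  "exp_ereal t = (if t = \<infinity> then \<infinity> else if t = -\<infinity> then 0 else ennreal (exp (real_of_ereal t)))"

text \<open>Where \<open>\<phi> = -\<infinity>\<close> the integrand is \<open>\<infinity>\<close>, or \<open>0\<close> if also \<open>f = 0\<close>; a plurisubharmonic function
  that is not identically \<open>-\<infinity>\<close> on a connected domain takes this value only on a null set.\<close>

definition weighted_L2_on :: "(complex^'n) set \<Rightarrow> (complex^'n \<Rightarrow> ereal) \<Rightarrow> (complex^'n \<Rightarrow> complex) \<Rightarrow> bool" where
  "weighted_L2_on U \<phi> f \<longleftrightarrow>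
     (\<lambda>z. ennreal ((cmod (f z))\<^sup>2) * exp_ereal (- 2 * \<phi> z)) \<in> borel_measurable (lebesgue_on U) \<and>
     (\<integral>\<^sup>+ z. ennreal ((cmod (f z))\<^sup>2) * exp_ereal (- 2 * \<phi> z) \<partial>lebesgue_on U) < \<infinity>"

definition multiplier_ideal ::
  "(complex^'n) set \<Rightarrow> (complex^'n \<Rightarrow> ereal) \<Rightarrow> complex^'n \<Rightarrow> (complex^'n \<Rightarrow> complex) set set" where
  "multiplier_ideal \<Omega> \<phi> x =
     {germ x f | f. \<exists>U. open U \<and> x \<in> U \<and> U \<subseteq> \<Omega> \<and> holomorphic_vec_on f U \<and> weighted_L2_on U \<phi> f}"

text \<open>A subsheaf of the sheaf of holomorphic functions on \<open>\<Omega>\<close> is represented by its etale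
  space, the set of pairs of a point of \<open>\<Omega>\<close> and a germ in the stalk at that point.\<close>

definition multiplier_ideal_sheaf ::
  "(complex^'n) set \<Rightarrow> (complex^'n \<Rightarrow> ereal) \<Rightarrow> ((complex^'n) \<times> (complex^'n \<Rightarrow> complex) set) set" where
  "multiplier_ideal_sheaf \<Omega> \<phi> = (SIGMA x:\<Omega>. multiplier_ideal \<Omega> \<phi> x)"

definition multiplier_ideal_sheaf_plus ::
  "(complex^'n) set \<Rightarrow> (complex^'n \<Rightarrow> ereal) \<Rightarrow> ((complex^'n) \<times> (complex^'n \<Rightarrow> complex) set) set" where
  "multiplier_ideal_sheaf_plus \<Omega> \<phi> =
     (\<Union>\<epsilon>\<in>{0<..}. multiplier_ideal_sheaf \<Omega> (\<lambda>z. ereal (1 + \<epsilon>) * \<phi> z))"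

end

theory Submission
  imports Defs "HOL-Complex_Analysis.Cauchy_Integral_Formula"
begin

text \<open>In logarithmic coordinates a toric plurisubharmonic function is convex. Near a point \<open>x\<close>, expand
  \<open>f\<close> in the variables \<open>z\<^sub>i\<close> with \<open>x\<^sub>i = 0\<close>. Torus invariance of the weight puts every term
  \<open>f\<^sub>a z\<^sup>a\<close> into \<open>L\<^sup>2(e\<^sup>-\<^sup>2\<^sup>\<phi>)\<close>, so if \<open>f\<^sub>a \<noteq> 0\<close> then \<open>\<bar>z\<^sup>a\<bar>\<^sup>2 e\<^sup>-\<^sup>2\<^sup>\<phi>\<close> is integrable. In
  logarithmic coordinates this is integrability of \<open>e\<^sup>-\<^sup>2\<^sup>h\<close> for a convex function \<open>h\<close>, which forces \<open>h\<close> to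
  grow linearly; linear growth leaves room to replace \<open>\<phi>\<close> by \<open>(1 + \<epsilon>) \<phi>\<close>. By Dickson's lemma finitely many
  of the monomials \<open>z\<^sup>a\<close> dominate \<open>f\<close>, so that one \<open>\<epsilon>\<close> works for all of them.\<close>

subsection \<open>Convexity in logarithmic coordinates\<close>

text \<open>The definition of plurisubharmonicity tests affine discs only, whereas a segment in
  logarithmic coordinates corresponds to an exponential disc. Since \<open>\<phi>\<close> is merely
  upper semicontinuous and may be -\<infinity>, convexity is obtained by a touching argument at a
  maximum point, without derivatives of \<open>\<phi>\<close>. A second obstacle: a Taylor
  coefficient is still a function of the coordinates that do not vanish at \<open>x\<close>, and it
  may be zero at \<open>x\<close> itself. The monomial is then known to be integrable only where
  these coordinates are close to those of some other point \<open>p\<close>. Convexity has to carry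
  the growth of \<open>\<phi>\<close> from there to all nearby values of these coordinates, which is
  what the margin \<open>3 * \<delta>\<close> is for. Growth is measured against slopes
  \<open>a i + 1\<close>, not \<open>a i\<close>: in logarithmic coordinates the area element of
  each complex variable contributes a factor \<open>|z_i|^2\<close>. The linear growth beyond this
  threshold is the slack that is spent on \<epsilon>.\<close>

lemma ereal_integral_le_integral:
  fixes q :: "real \<Rightarrow> real"
  assumes q: "continuous_on {0..2*pi} q" and le: "\<And>x. x \<in> {0..2*pi} \<Longrightarrow> u x \<le> ereal (q x)"
  shows "ereal_integral (lebesgue_on {0..2*pi}) u \<le> ereal (integral {0..2*pi} q)"
proof -
  let ?M = "lebesgue_on {0..2*pi}"
  have int: "integrable ?M q" using q by (rule continuous_imp_integrable_real)
  have P: "(\<integral>\<^sup>+x. ennreal (q x) \<partial>?M) < \<infinity>" and N: "(\<integral>\<^sup>+x. ennreal (- q x) \<partial>?M) < \<infinity>"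
    using int by (auto simp: real_integrable_def less_top)
  \<comment> \<open>\<open>nn_integral\<close> is monotone on arbitrary functions, so
    \<open>u\<close> may be any function here; the continuous majorant makes the difference on the
    right a real integral.\<close>
  have "ereal_integral ?M u \<le> ereal_integral ?M (\<lambda>x. ereal (q x))"
    unfolding ereal_integral_def
  proof (intro ereal_minus_mono)
    show "enn2ereal (\<integral>\<^sup>+x. e2ennreal (u x) \<partial>?M) \<le> enn2ereal (\<integral>\<^sup>+x. e2ennreal (ereal (q x)) \<partial>?M)"
      unfolding less_eq_ennreal.rep_eq[symmetric]
      by (intro nn_integral_mono e2ennreal_mono le) simp
    show "enn2ereal (\<integral>\<^sup>+x. e2ennreal (- ereal (q x)) \<partial>?M) \<le> enn2ereal (\<integral>\<^sup>+x. e2ennreal (- u x) \<partial>?M)"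
      unfolding less_eq_ennreal.rep_eq[symmetric]
    proof (intro nn_integral_mono e2ennreal_mono)
      fix x assume "x \<in> space ?M"
      then show "- ereal (q x) \<le> - u x" using le[of x] by (simp only: ereal_minus_le_minus) simp
    qed
  qed
  also have "\<dots> = ereal (integral\<^sup>L ?M q)"
    unfolding real_lebesgue_integral_def[OF int]
    using P N by (cases "(\<integral>\<^sup>+x. ennreal (q x) \<partial>?M)"; cases "(\<integral>\<^sup>+x. ennreal (- q x) \<partial>?M)")
       (auto simp: ereal_integral_def)
  also have "integral\<^sup>L ?M q = integral {0..2*pi} q"
    by (rule lebesgue_integral_eq_integral[OF int]) auto
  finally show ?thesis .
qed

text \<open>Without a maximum, the relatively open sets \<open>{z\<in>Z. u z < u m}\<close> with
  \<open>m \<in> Z\<close> would cover \<open>Z\<close>. In a finite subcover the \<open>m\<close>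
  with the largest value of \<open>u\<close> lies in none of the chosen sets. Only the order is
  used, so the value -\<infinity> does no harm.\<close>

lemma usc_attains_max:
  fixes u :: "'a::topological_space \<Rightarrow> ereal"
  assumes Z: "compact Z" "Z \<noteq> {}" and usc: "usc_on Z u"
  obtains m where "m \<in> Z" "\<And>z. z \<in> Z \<Longrightarrow> u z \<le> u m"
proof -
  have "\<exists>m\<in>Z. \<forall>z\<in>Z. u z \<le> u m"
  proof (rule ccontr)
    assume "\<not> ?thesis"
    then have ex: "\<forall>m\<in>Z. \<exists>z\<in>Z. u m < u z" by (auto simp: not_le)
    let ?C = "(\<lambda>m. {z\<in>Z. u z < u m}) ` Z"
    have "(\<forall>c\<in>?C. openin (top_of_set Z) c) \<and> Z \<subseteq> \<Union>?C"
      using usc ex by (auto simp: usc_on_def)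
    then obtain D where D: "D \<subseteq> ?C" "finite D" "Z \<subseteq> \<Union>D"
      using Z(1) compact_eq_openin_cover[of Z] by meson
    obtain M where M: "M \<subseteq> Z" "finite M" "D = (\<lambda>m. {z\<in>Z. u z < u m}) ` M"
      using D(1,2) by (meson finite_subset_image)
    have "M \<noteq> {}" using D(3) Z(2) M(3) by auto
    then have "Max (u ` M) \<in> u ` M" using M(2) by (intro Max_in) auto
    then obtain m where m: "m \<in> M" "u m = Max (u ` M)" by auto
    then obtain m' where "m' \<in> M" "u m < u m'" using D(3) M(1,3) by auto
    moreover have "u m' \<le> Max (u ` M)" using \<open>m' \<in> M\<close> M(2) by simp
    ultimately show False using m by auto
  qed
  then show ?thesis using that by blast
qed

text \<open>Mean value property at the centre: \<open>1 + c * u\<close> stays in the right half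
  plane on the closed unit disc, so \<open>Ln (1 + c * u)\<close> is holomorphic there with value 0
  at the origin, and its real part is the integrand.\<close>

lemma has_integral_ln_norm_circle:
  assumes "cmod c < 1"
  shows "((\<lambda>x. ln (cmod (1 + c * cis x))) has_integral 0) {0..2*pi}"
proof -
  have pos: "1 + c * u \<noteq> 0 \<and> 0 < Re (1 + c * u)" if "cmod u \<le> 1" for u
  proof -
    have "cmod (c * u) < 1" using assms that
      by (metis mult_left_le norm_ge_zero norm_mult order_le_less_trans)
    then have "\<bar>Re (c * u)\<bar> < 1" using abs_Re_le_cmod order_le_less_trans by blast
    then show ?thesis by (auto simp: complex_eq_iff)
  qed
  have "(\<lambda>u. Ln (1 + c * u)) holomorphic_on cball 0 1"
    by (intro holomorphic_intros) (use pos in \<open>force simp: complex_nonpos_Reals_iff\<close>)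
  from Cauchy_integral_circlepath_simple[OF this, of 0]
  have "((\<lambda>u. Ln (1 + c * u) / u) has_contour_integral 0) (circlepath 0 1)" by simp
  then have "((\<lambda>x. Ln (1 + c * cis x) / cis x * \<i> * cis x) has_integral 0) {0..2*pi}"
    unfolding circlepath_def by (subst (asm) has_contour_integral_part_circlepath_iff) auto
  then have "((\<lambda>x. Ln (1 + c * cis x) * \<i>) has_integral 0) {0..2*pi}"
    by (simp add: mult.assoc mult.commute[of \<i>])
  then have "((\<lambda>x. Im (Ln (1 + c * cis x) * \<i>)) has_integral Im 0) {0..2*pi}"
    by (rule has_integral_linear[OF _ bounded_linear_Im, unfolded o_def])
  then have "((\<lambda>x. Re (Ln (1 + c * cis x))) has_integral 0) {0..2*pi}" by simp
  then show ?thesis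
    by (rule has_integral_eq[rotated]) (use pos in \<open>simp add: Re_Ln\<close>)
qed

lemma ln_norm_approx:
  assumes "cmod w \<le> 1/2"
  shows "\<bar>ln (cmod (1 + w)) - Re w\<bar> \<le> 2 * (cmod w)\<^sup>2"
proof -
  have nz: "1 + w \<noteq> 0"
  proof
    assume "1 + w = 0"
    then have "w = -1" by (simp add: add_eq_0_iff)
    then show False using assms by simp
  qed
  have "\<bar>ln (cmod (1 + w)) - Re w\<bar> = \<bar>Re (Ln (1 + w) - w)\<bar>" using nz by (simp add: Re_Ln)
  also have "\<dots> \<le> cmod (Ln (1 + w) - w)" by (rule abs_Re_le_cmod)
  also have "\<dots> \<le> (cmod w)\<^sup>2 / (1 - cmod w)" by (rule Ln_approx_linear) (use assms in auto)
  also have "\<dots> \<le> (cmod w)\<^sup>2 / (1/2)" by (rule divide_left_mono) (use assms in auto)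
  finally show ?thesis by simp
qed

lemma has_integral_cos_squared: "((\<lambda>x. (cos x)\<^sup>2) has_integral pi) {0..2*pi}"
proof -
  have "((\<lambda>x. (cos x)\<^sup>2) has_integral ((2*pi + sin (2*pi) * cos (2*pi))/2 - (0 + sin 0 * cos 0)/2)) {0..2*pi}"
  proof (rule fundamental_theorem_of_calculus)
    fix x :: real
    have "((\<lambda>x. (x + sin x * cos x)/2) has_real_derivative (1 + (cos x * cos x - sin x * sin x))/2) (at x within {0..2*pi})"
      by (auto intro!: derivative_eq_intros)
    moreover have "(1 + (cos x * cos x - sin x * sin x))/2 = (cos x)\<^sup>2"
      using sin_cos_squared_add[of x] by (simp add: power2_eq_square)
    ultimately show "((\<lambda>x. (x + sin x * cos x)/2) has_vector_derivative (cos x)\<^sup>2) (at x within {0..2*pi})"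
      by (simp add: has_real_derivative_iff_has_vector_derivative)
  qed auto
  then show ?thesis by simp
qed

section \<open>Affine discs in logarithmic coordinates\<close>

definition cexp :: "real^'n \<Rightarrow> complex^'n" where
  "cexp t = (\<chi> i. of_real (exp (t $ i)))"

text \<open>Displacement of the logarithms of the moduli along the boundary of an affine disc; to
  first order in \<open>e\<close> it is \<open>e * cos x\<close> times \<open>v\<close>.\<close>

definition logdisc :: "real^'n \<Rightarrow> real \<Rightarrow> real \<Rightarrow> real^'n" where
  "logdisc v e x = (\<chi> i. ln (cmod (1 + of_real (e * v $ i) * cis x)))"

lemma toric_eq_cexp:
  assumes tor: "toric_psh_on_polydisk r \<phi>" and z: "z \<in> polydisk r" "\<And>i. z $ i \<noteq> 0"
  shows "\<phi> z = \<phi> (cexp (\<chi> i. ln (cmod (z $ i))))"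
proof -
  let ?w = "cexp (\<chi> i. ln (cmod (z $ i)))"
  have w: "?w $ i = of_real (cmod (z $ i))" for i using z(2) by (simp add: cexp_def)
  then have "?w \<in> polydisk r" using z(1) by (auto simp: polydisk_def)
  then have "\<phi> (\<chi> i. cis ((\<chi> i. Arg (z $ i)) $ i) * ?w $ i) = \<phi> ?w"
    using tor unfolding toric_psh_on_polydisk_def by blast
  moreover have "(\<chi> i. cis ((\<chi> i. Arg (z $ i)) $ i) * ?w $ i) = z"
  proof -
    have "cis (Arg (z $ i)) * of_real (cmod (z $ i)) = z $ i" for i
      using rcis_cmod_Arg[of "z $ i"] by (simp add: rcis_def mult.commute)
    then show ?thesis unfolding w by (simp add: vec_eq_iff)
  qed
  ultimately show ?thesis by simp
qed

lemma logdisc_bound: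
  assumes "0 \<le> e" "e * norm v \<le> 1/2"
  shows "norm (logdisc v e x - (e * cos x) *\<^sub>R v) \<le> 2 * (norm v)\<^sup>2 * e\<^sup>2"
proof -
  have comp: "\<bar>e * v $ i\<bar> \<le> 1/2" for i
  proof -
    have "\<bar>e * v $ i\<bar> \<le> e * norm v" using assms(1)
      by (simp add: abs_mult component_le_norm_cart mult_left_mono)
    then show ?thesis using assms(2) by simp
  qed
  have "norm (logdisc v e x - (e * cos x) *\<^sub>R v) \<le> (\<Sum>i\<in>UNIV. \<bar>(logdisc v e x - (e * cos x) *\<^sub>R v) $ i\<bar>)"
    by (rule norm_le_l1_cart)
  also have "\<dots> \<le> (\<Sum>i\<in>UNIV. 2 * (e * v $ i)\<^sup>2)"
  proof (rule sum_mono)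
    fix i
    show "\<bar>(logdisc v e x - (e * cos x) *\<^sub>R v) $ i\<bar> \<le> 2 * (e * v $ i)\<^sup>2"
      using ln_norm_approx[of "of_real (e * v $ i) * cis x"] comp[of i]
      by (simp add: logdisc_def norm_mult algebra_simps power_mult_distrib)
  qed
  also have "\<dots> = 2 * (norm v)\<^sup>2 * e\<^sup>2"
  proof -
    have "(norm v)\<^sup>2 = (\<Sum>i\<in>UNIV. (v $ i)\<^sup>2)"
      unfolding power2_norm_eq_inner inner_vec_def by (simp add: power2_eq_square)
    then show ?thesis by (simp add: power_mult_distrib sum_distrib_left sum_distrib_right mult_ac)
  qed
  finally show ?thesis .
qed

lemma has_integral_inner_logdisc:
  assumes "0 \<le> e" "e * norm v \<le> 1/2"
  shows "((\<lambda>x. l \<bullet> logdisc v e x) has_integral 0) {0..2*pi}"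
proof -
  have "((\<lambda>x. \<Sum>i\<in>UNIV. l $ i * ln (cmod (1 + of_real (e * v $ i) * cis x))) has_integral (\<Sum>i\<in>(UNIV::'a set). l $ i * 0)) {0..2*pi}"
  proof (intro has_integral_sum has_integral_mult_right has_integral_ln_norm_circle)
    fix i
    have "\<bar>e * v $ i\<bar> \<le> e * norm v" using assms(1)
      by (simp add: abs_mult component_le_norm_cart mult_left_mono)
    then show "cmod (of_real (e * v $ i)) < 1" unfolding norm_of_real using assms(2) by linarith
  qed auto
  then show ?thesis by (simp add: inner_vec_def logdisc_def)
qed

text \<open>Coordinate \<open>i\<close> of the disc is
  \<open>exp (t $ i) * (1 + e * v $ i * \<zeta>)\<close>. The bound \<open>1/2\<close> keeps the
  second factor away from 0, so every boundary point can be rotated to one with positive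
  coordinates; \<open>dom\<close> keeps the closed disc inside the polydisk.\<close>

lemma toric_submean:
  assumes tor: "toric_psh_on_polydisk r \<phi>" and e: "0 \<le> e" "e * norm v \<le> 1/2"
    and dom: "\<And>i. exp (t $ i) * (1 + e * norm v) < r"
  shows "\<phi> (cexp t) \<le> ereal (1 / (2 * pi)) *
    ereal_integral (lebesgue_on {0..2*pi}) (\<lambda>x. \<phi> (cexp (t + logdisc v e x)))"
proof -
  have comp: "\<bar>e * v $ i\<bar> \<le> e * norm v" for i using e(1)
    by (simp add: abs_mult component_le_norm_cart mult_left_mono)
  define b :: "complex^'a" where "b = (\<chi> i. of_real (exp (t $ i) * (e * v $ i)))"
  have nth: "(cexp t + \<zeta> *s b) $ i = of_real (exp (t $ i)) * (1 + of_real (e * v $ i) * \<zeta>)" for \<zeta> i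
    by (simp add: cexp_def b_def algebra_simps)
  have inD: "cexp t + \<zeta> *s b \<in> polydisk r" if "cmod \<zeta> \<le> 1" for \<zeta>
    unfolding polydisk_def
  proof (intro CollectI allI)
    fix i
    have "cmod (1 + of_real (e * v $ i) * \<zeta>) \<le> 1 + cmod (of_real (e * v $ i) * \<zeta>)"
      by (metis norm_one norm_triangle_ineq)
    also have "\<dots> \<le> 1 + e * norm v"
      using mult_mono[OF comp[of i] that] e by (simp add: norm_mult abs_mult)
    finally have "cmod ((cexp t + \<zeta> *s b) $ i) \<le> exp (t $ i) * (1 + e * norm v)"
      unfolding nth norm_mult by simp
    then show "cmod ((cexp t + \<zeta> *s b) $ i) < r" using dom[of i] by simp
  qed
  have eq: "\<phi> (cexp t + cis x *s b) = \<phi> (cexp (t + logdisc v e x))" for x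
  proof -
    have nz: "1 + of_real (e * v $ i) * cis x \<noteq> 0" for i
    proof
      assume "1 + of_real (e * v $ i) * cis x = 0"
      then have "of_real (e * v $ i) * cis x = -1" by (metis add.inverse_unique minus_minus)
      then have "\<bar>e * v $ i\<bar> = 1" by (metis norm_cis norm_minus_cancel norm_mult norm_of_real norm_one mult.right_neutral)
      then show False using comp[of i] e(2) by simp
    qed
    have "\<phi> (cexp t + cis x *s b) = \<phi> (cexp (\<chi> i. ln (cmod ((cexp t + cis x *s b) $ i))))"
    proof (rule toric_eq_cexp[OF tor])
      show "(cexp t + cis x *s b) $ i \<noteq> 0" for i unfolding nth using nz by simp
    qed (use inD[of "cis x"] in simp)
    also have "(\<chi> i. ln (cmod ((cexp t + cis x *s b) $ i))) = t + logdisc v e x"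
      unfolding nth norm_mult using nz by (simp add: vec_eq_iff logdisc_def ln_mult del: of_real_mult)
    finally show ?thesis .
  qed
  have "psh_on (polydisk r) \<phi>" using tor by (simp add: toric_psh_on_polydisk_def)
  then have "\<phi> (cexp t) \<le> ereal (1 / (2 * pi)) *
               ereal_integral (lebesgue_on {0..2 * pi}) (\<lambda>\<theta>. \<phi> (cexp t + cis \<theta> *s b))"
    using inD unfolding psh_on_def by blast
  then show ?thesis unfolding eq .
qed

text \<open>The affine disc \<open>\<zeta> \<mapsto> z\<^sub>i (1 + e v\<^sub>i \<zeta>)\<close> moves the logarithmic coordinates by \<open>logdisc v e\<close>, which has
  mean zero and stays within \<open>O(e\<^sup>2)\<close> of the line spanned by \<open>v\<close>. A touching function with negative
  second derivative along \<open>v\<close> therefore violates the mean value inequality for small \<open>e\<close>, however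
  large the penalty \<open>K\<close> in the orthogonal directions.\<close>

lemma toric_no_strict_touching:
  fixes v l :: "real^'n"
  assumes tor: "toric_psh_on_polydisk r \<phi>" and tr: "\<And>i. exp (t $ i) < r"
    and v: "v \<noteq> 0" and d: "d > 0" and \<eta>: "\<eta> > 0" and K: "K \<ge> 0" and m: "\<phi> (cexp t) = ereal m"
    and le: "\<And>u. norm u < \<eta> \<Longrightarrow> \<phi> (cexp (t + u)) \<le>
      ereal (m + l \<bullet> u - d * ((u \<bullet> v) / (v \<bullet> v))\<^sup>2 + K * (norm (u - ((u \<bullet> v) / (v \<bullet> v)) *\<^sub>R v))\<^sup>2)"
  shows False
proof -
  define \<sigma> where "\<sigma> u = (u \<bullet> v) / (v \<bullet> v)" for u
  define C where "C = 2 * (norm v)\<^sup>2"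
  define D where "D = 2 * norm v"
  have nv: "norm v > 0" using v by simp
  have vv: "v \<bullet> v = (norm v)\<^sup>2" by (simp add: power2_norm_eq_inner)
  have "\<forall>\<^sub>F e in at_right 0. e * norm v < 1/2"
    by (rule order_tendstoD(2)[where y=0]) (auto intro!: tendsto_eq_intros)
  moreover have "\<forall>\<^sub>F e in at_right 0. \<forall>i. exp (t $ i) * (1 + e * norm v) < r"
    by (rule eventually_all_finite, rule order_tendstoD(2)[where y="exp (t $ _)"])
       (auto intro!: tendsto_eq_intros tr)
  moreover have "\<forall>\<^sub>F e in at_right 0. e * norm v + C * e\<^sup>2 < \<eta>"
    by (rule order_tendstoD(2)[where y=0]) (auto intro!: tendsto_eq_intros \<eta>)
  moreover have "\<forall>\<^sub>F e in at_right 0. 2 * d * D * e + K * C\<^sup>2 * e\<^sup>2 < d / 2"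
    by (rule order_tendstoD(2)[where y=0]) (auto intro!: tendsto_eq_intros d)
  moreover have "\<forall>\<^sub>F e in at_right (0::real). e > 0"
    by (simp add: eventually_at_right_less)
  ultimately have "\<forall>\<^sub>F e in at_right 0. e > 0 \<and> e * norm v < 1/2 \<and> (\<forall>i. exp (t $ i) * (1 + e * norm v) < r)
     \<and> e * norm v + C * e\<^sup>2 < \<eta> \<and> 2 * d * D * e + K * C\<^sup>2 * e\<^sup>2 < d / 2"
    by eventually_elim auto
  then obtain e where e: "e > 0" "e * norm v < 1/2" "\<And>i. exp (t $ i) * (1 + e * norm v) < r"
     "e * norm v + C * e\<^sup>2 < \<eta>" "2 * d * D * e + K * C\<^sup>2 * e\<^sup>2 < d / 2"
    using eventually_happens'[OF trivial_limit_at_right_real] by blast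
  let ?L = "\<lambda>x. logdisc v e x"
  \<comment> \<open>The term with \<open>(cos x)\<^sup>2\<close> averages to
    \<open>- d * e\<^sup>2 / 2\<close>. The cubic term pays for the cross term between
    \<open>e * cos x\<close> and the component along \<open>v\<close> of the deviation of
    \<open>logdisc\<close> from the line; the quartic one is \<open>K\<close> times the squared
    orthogonal deviation. Both are negligible against \<open>e\<^sup>2\<close>.\<close>
  define q where "q x = m + l \<bullet> ?L x - d * e\<^sup>2 * (cos x)\<^sup>2 + (2 * d * D * e^3 + K * C\<^sup>2 * e^4)" for x
  have Lb: "norm (?L x - (e * cos x) *\<^sub>R v) \<le> C * e\<^sup>2" for x
    using logdisc_bound[of e v x] e by (simp add: C_def)
  have le_q: "\<phi> (cexp (t + ?L x)) \<le> ereal (q x)" for x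
  proof -
    define w where "w = ?L x - (e * cos x) *\<^sub>R v"
    have L: "?L x = (e * cos x) *\<^sub>R v + w" by (simp add: w_def)
    have nw: "norm w \<le> C * e\<^sup>2" using Lb by (simp add: w_def)
    have "norm (?L x) \<le> norm ((e * cos x) *\<^sub>R v) + norm w" unfolding L by (rule norm_triangle_ineq)
    also have "norm ((e * cos x) *\<^sub>R v) \<le> e * norm v"
      using e(1) abs_cos_le_one[of x] by (simp add: abs_mult mult_left_le_one_le mult_left_mono)
    finally have "norm (?L x) < \<eta>" using nw e(4) by linarith
    note le1 = le[OF this, folded \<sigma>_def]
    have \<sigma>w: "\<bar>\<sigma> w\<bar> \<le> D * e\<^sup>2"
    proof -
      have "\<bar>w \<bullet> v\<bar> \<le> norm w * norm v" by (rule Cauchy_Schwarz_ineq2)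
      also have "\<dots> \<le> C * e\<^sup>2 * norm v" using nw by (simp add: mult_right_mono)
      finally show ?thesis using nv by (simp add: \<sigma>_def vv C_def D_def divide_simps power2_eq_square mult_ac)
    qed
    have \<sigma>L: "\<sigma> (?L x) = e * cos x + \<sigma> w"
      using v by (simp add: L \<sigma>_def inner_add_left add_divide_distrib)
    have "(\<sigma> (?L x))\<^sup>2 \<ge> e\<^sup>2 * (cos x)\<^sup>2 - 2 * D * e^3"
    proof -
      have "\<bar>e * cos x * \<sigma> w\<bar> \<le> e * (D * e\<^sup>2)"
        unfolding abs_mult using e(1) abs_cos_le_one[of x] \<sigma>w
        by (intro mult_mono) (auto simp: mult_left_le)
      then have "e * cos x * \<sigma> w \<ge> - (D * e^3)" by (simp add: power3_eq_cube power2_eq_square mult_ac)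
      moreover have "(\<sigma> (?L x))\<^sup>2 = e\<^sup>2 * (cos x)\<^sup>2 + 2 * (e * cos x * \<sigma> w) + (\<sigma> w)\<^sup>2"
        unfolding \<sigma>L by (simp add: power2_sum power_mult_distrib algebra_simps)
      moreover have "(\<sigma> w)\<^sup>2 \<ge> 0" by simp
      ultimately show ?thesis by linarith
    qed
    then have 1: "d * (\<sigma> (?L x))\<^sup>2 \<ge> d * (e\<^sup>2 * (cos x)\<^sup>2 - 2 * D * e^3)"
      using d by (simp add: mult_left_mono)
    \<comment> \<open>Subtracting the projection onto \<open>v\<close> removes the linear part of
      \<open>logdisc\<close>; what is left is the orthogonal part of the deviation \<open>w\<close>,
      which is no longer than \<open>w\<close>.\<close>
    have "norm (?L x - \<sigma> (?L x) *\<^sub>R v) \<le> C * e\<^sup>2"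
    proof -
      have "?L x - \<sigma> (?L x) *\<^sub>R v = w - \<sigma> w *\<^sub>R v"
        unfolding \<sigma>L unfolding L by (simp add: algebra_simps)
      moreover have "(w - \<sigma> w *\<^sub>R v) \<bullet> (w - \<sigma> w *\<^sub>R v) = w \<bullet> w - (w \<bullet> v)\<^sup>2 / (v \<bullet> v)"
        using v by (simp add: \<sigma>_def inner_diff_left inner_diff_right inner_commute power2_eq_square)
      moreover have "(w \<bullet> v)\<^sup>2 / (v \<bullet> v) \<ge> 0" by simp
      ultimately have "norm (?L x - \<sigma> (?L x) *\<^sub>R v) \<le> norm w"
        unfolding norm_eq_sqrt_inner by simp
      then show ?thesis using nw by simp
    qed
    then have "(norm (?L x - \<sigma> (?L x) *\<^sub>R v))\<^sup>2 \<le> (C * e\<^sup>2)\<^sup>2" by (rule power_mono) simp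
    then have 2: "K * (norm (?L x - \<sigma> (?L x) *\<^sub>R v))\<^sup>2 \<le> K * (C\<^sup>2 * e^4)"
      using K by (intro mult_left_mono) (simp_all add: power_mult_distrib)
    have "m + l \<bullet> ?L x - d * (\<sigma> (?L x))\<^sup>2 + K * (norm (?L x - \<sigma> (?L x) *\<^sub>R v))\<^sup>2 \<le> q x"
      using 1 2 by (simp add: q_def algebra_simps)
    then show ?thesis by (intro order_trans[OF le1]) simp
  qed
  have contL: "continuous_on {0..2*pi} (\<lambda>x. l \<bullet> ?L x)"
  proof -
    have "cmod (of_real (e * v $ i) * cis x) < 1" for i x
    proof -
      have "\<bar>e * v $ i\<bar> \<le> e * norm v" using e(1)
        by (simp add: abs_mult component_le_norm_cart mult_left_mono)
      then show ?thesis using e(2) by (simp add: norm_mult abs_mult)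
    qed
    then have "1 + of_real (e * v $ i) * cis x \<noteq> 0" for i x
      by (metis add_eq_0_iff norm_minus_cancel norm_one less_irrefl)
    then show ?thesis
      unfolding inner_vec_def logdisc_def
      by (auto intro!: continuous_intros simp del: of_real_mult)
  qed
  have contq: "continuous_on {0..2*pi} q"
    unfolding q_def by (intro continuous_intros contL)
  have "((\<lambda>x. m + l \<bullet> ?L x - d * e\<^sup>2 * (cos x)\<^sup>2 + (2 * d * D * e^3 + K * C\<^sup>2 * e^4)) has_integral
      ((2*pi) * m + 0 - d * e\<^sup>2 * pi + (2*pi) * (2 * d * D * e^3 + K * C\<^sup>2 * e^4))) {0..2*pi}"
    using has_integral_const_real[of m 0 "2*pi"] has_integral_const_real[of "2 * d * D * e^3 + K * C\<^sup>2 * e^4" 0 "2*pi"]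
       has_integral_inner_logdisc[of e v l] e
    by (intro has_integral_add has_integral_diff has_integral_mult_right has_integral_cos_squared) auto
  then have intq: "integral {0..2*pi} q = 2*pi*m - d * e\<^sup>2 * pi + 2*pi * (2 * d * D * e^3 + K * C\<^sup>2 * e^4)"
    unfolding q_def[abs_def] by (simp add: integral_unique)
  have "ereal m \<le> ereal (1 / (2 * pi)) *
    ereal_integral (lebesgue_on {0..2*pi}) (\<lambda>x. \<phi> (cexp (t + ?L x)))"
    unfolding m[symmetric] by (rule toric_submean[OF tor]) (use e in auto)
  also have "\<dots> \<le> ereal (1 / (2*pi)) * ereal (integral {0..2*pi} q)"
    by (intro ereal_mult_left_mono ereal_integral_le_integral contq le_q) auto
  finally have "m \<le> 1 / (2*pi) * (2*pi*m - d * e\<^sup>2 * pi + 2*pi * (2 * d * D * e^3 + K * C\<^sup>2 * e^4))"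
    by (simp add: intq)
  also have "\<dots> = m - d / 2 * e\<^sup>2 + (2 * d * D * e^3 + K * C\<^sup>2 * e^4)"
    by (simp add: field_simps)
  finally have "d / 2 * e\<^sup>2 \<le> 2 * d * D * e^3 + K * C\<^sup>2 * e^4" by simp
  also have "\<dots> = (2 * d * D * e + K * C\<^sup>2 * e\<^sup>2) * e\<^sup>2"
    by (simp add: algebra_simps power3_eq_cube power4_eq_xxxx power2_eq_square)
  finally have "d / 2 \<le> 2 * d * D * e + K * C\<^sup>2 * e\<^sup>2" using e(1) by simp
  then show False using e(5) by simp
qed

lemma continuous_cexp: "continuous_on A cexp"
  unfolding cexp_def by (intro continuous_intros)

lemma open_polydisk: "open (polydisk r)"
proof -
  have "polydisk r = (\<Inter>i. {z::complex^'n. cmod (z $ i) < r})" by (auto simp: polydisk_def)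
  also have "open \<dots>" by (intro open_INT) (auto intro!: open_Collect_less continuous_intros)
  finally show ?thesis .
qed

lemma toric_usc:
  assumes tor: "toric_psh_on_polydisk r \<phi>"
  shows "open {z \<in> polydisk r. \<phi> z < c}" and "z \<in> polydisk r \<Longrightarrow> \<phi> z < \<infinity>"
  using tor openin_open_eq[OF open_polydisk[of r]]
  by (auto simp: toric_psh_on_polydisk_def psh_on_def usc_on_def)

text \<open>If \<open>\<phi>\<close> exceeded the chord somewhere, a concave parabola over the
  chord, lifted slightly and penalised by \<open>K\<close> times the squared distance from the line,
  would still lie below \<open>\<phi>\<close> at that point but above it on the boundary of a thin
  cylinder around the segment. At an interior maximum of the difference a shifted copy of this
  function touches \<open>\<phi>\<close> from above, which \<open>toric_no_strict_touching\<close>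
  excludes. Real upper bounds \<open>A\<close> and \<open>B\<close> allow the value -\<infinity> at
  the ends.\<close>

lemma toric_log_convex:
  fixes p q :: "real^'n"
  assumes tor: "toric_psh_on_polydisk r \<phi>"
    and p: "\<And>i. exp (p $ i) < r" and q: "\<And>i. exp (q $ i) < r"
    and A: "\<phi> (cexp p) \<le> ereal A" and B: "\<phi> (cexp q) \<le> ereal B" and s: "0 \<le> s" "s \<le> 1"
  shows "\<phi> (cexp ((1 - s) *\<^sub>R p + s *\<^sub>R q)) \<le> ereal ((1 - s) * A + s * B)"
proof (rule ccontr)
  define g where "g t = \<phi> (cexp t)" for t
  define \<Omega> :: "(real^'n) set" where "\<Omega> = {t. \<forall>i. exp (t $ i) < r}"
  have \<Omega>_iff: "t \<in> \<Omega> \<longleftrightarrow> cexp t \<in> polydisk r" for t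
    by (simp add: \<Omega>_def polydisk_def cexp_def)
  have opg: "open {t\<in>\<Omega>. g t < c}" for c
  proof -
    have "{t\<in>\<Omega>. g t < c} = cexp -` {z \<in> polydisk r. \<phi> z < c}" by (auto simp: \<Omega>_iff g_def)
    then show ?thesis using open_vimage[OF toric_usc(1)[OF tor] continuous_cexp] by simp
  qed
  have gfin: "g t < \<infinity>" if "t \<in> \<Omega>" for t using toric_usc(2)[OF tor] that by (simp add: \<Omega>_iff g_def)
  have usc: "usc_on Z (\<lambda>t. g t - ereal (Q t))" if Z: "Z \<subseteq> \<Omega>" and Q: "continuous_on UNIV Q" for Z Q
    unfolding usc_on_def
  proof (intro allI)
    fix c :: ereal
    show "openin (top_of_set Z) {t\<in>Z. g t - ereal (Q t) < c}"
    proof (cases c)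
      case (real c')
      \<comment> \<open>Subtracting a continuous function preserves upper semicontinuity: a real
        \<open>a\<close> between \<open>g t\<close> and \<open>c' + Q t\<close> separates the two
        conditions.\<close>
      have "{t\<in>Z. g t - ereal (Q t) < c} = Z \<inter> (\<Union>a. {t\<in>\<Omega>. g t < ereal a} \<inter> {t. a < c' + Q t})"
      proof (intro set_eqI iffI)
        fix t assume t: "t \<in> {t\<in>Z. g t - ereal (Q t) < c}"
        then have "g t < ereal (c' + Q t)" using real by (cases "g t") auto
        then obtain a where "g t < ereal a" "ereal a < ereal (c' + Q t)" using ereal_dense2 by blast
        then show "t \<in> Z \<inter> (\<Union>a. {t\<in>\<Omega>. g t < ereal a} \<inter> {t. a < c' + Q t})" using t Z by auto
      next
        fix t assume t: "t \<in> Z \<inter> (\<Union>a. {t\<in>\<Omega>. g t < ereal a} \<inter> {t. a < c' + Q t})"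
        then obtain a where "g t < ereal a" "a < c' + Q t" by auto
        then show "t \<in> {t\<in>Z. g t - ereal (Q t) < c}" using real t by (cases "g t") auto
      qed
      moreover have "open (\<Union>a. {t\<in>\<Omega>. g t < ereal a} \<inter> {t. a < c' + Q t})"
        by (intro open_UN ballI open_Int opg open_Collect_less continuous_intros Q)
      ultimately show ?thesis by (auto simp: openin_open)
    next
      case PInf
      have "g t - ereal (Q t) < c" if "t \<in> Z" for t using gfin[of t] that Z PInf by (cases "g t") auto
      then have "{t\<in>Z. g t - ereal (Q t) < c} = Z" by auto
      then show ?thesis by simp
    next
      case MInf
      then show ?thesis by simp
    qed
  qed
  assume "\<not> ?thesis"
  then have gt: "g ((1 - s) *\<^sub>R p + s *\<^sub>R q) > ereal ((1 - s) * A + s * B)" by (simp add: g_def not_le)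
  define v where "v = q - p"
  have ps: "(1 - s) *\<^sub>R p + s *\<^sub>R q = p + s *\<^sub>R v" by (simp add: v_def algebra_simps)
  have s01: "0 < s" "s < 1"
  proof -
    have "s \<noteq> 0" using gt A by (auto simp: g_def)
    moreover have "s \<noteq> 1" using gt B by (auto simp: g_def)
    ultimately show "0 < s" "s < 1" using s by auto
  qed
  have v0: "v \<noteq> 0"
  proof
    assume "v = 0"
    then have "q = p" by (simp add: v_def)
    then have "(1 - s) *\<^sub>R p + s *\<^sub>R q = p" by (simp add: algebra_simps)
    then have gp: "ereal ((1 - s) * A + s * B) < g p" using gt by simp
    then obtain x where x: "g p = ereal x" using A by (cases "g p") (auto simp: g_def)
    have "x \<le> A" "x \<le> B" using A B x \<open>q = p\<close> by (auto simp: g_def)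
    then have "(1 - s) * x + s * x \<le> (1 - s) * A + s * B"
      using s by (intro add_mono mult_left_mono) auto
    then show False using gp x by (simp add: algebra_simps)
  qed
  then have vv: "v \<bullet> v > 0" by simp
  have "ereal (A + (B - A) * s) < g (p + s *\<^sub>R v)" using gt unfolding ps by (simp add: algebra_simps)
  moreover have "p + s *\<^sub>R v \<in> \<Omega>" unfolding \<Omega>_def
  proof (intro CollectI allI)
    fix i
    have "(p + s *\<^sub>R v) $ i \<le> max (p $ i) (q $ i)"
      unfolding ps[symmetric] using s convex_bound_le[of "p $ i" "max (p $ i) (q $ i)" "q $ i" "1 - s" s] by simp
    then have "exp ((p + s *\<^sub>R v) $ i) \<le> exp (max (p $ i) (q $ i))" by simp
    also have "\<dots> < r" using p[of i] q[of i] by (simp add: max_def)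
    finally show "exp ((p + s *\<^sub>R v) $ i) < r" .
  qed
  ultimately obtain gm where gm: "g (p + s *\<^sub>R v) = ereal gm" "A + (B - A) * s < gm"
    using gfin[of "p + s *\<^sub>R v"] by (cases "g (p + s *\<^sub>R v)") auto
  \<comment> \<open>Half of the excess over the chord: one \<open>d\<close> is the lift in
    \<open>Q\<close>, the other leaves room for the bump
    \<open>d * (\<sigma> t * (1 - \<sigma> t))\<close>, which stays strictly below
    \<open>d\<close>.\<close>
  define d where "d = (gm - (A + (B - A) * s)) / 2"
  have d: "d > 0" using gm(2) by (simp add: d_def)
  define \<sigma> where "\<sigma> t = ((t - p) \<bullet> v) / (v \<bullet> v)" for t
  define w where "w t = (t - p) - \<sigma> t *\<^sub>R v" for t
  have t_eq: "t = p + \<sigma> t *\<^sub>R v + w t" for t by (simp add: w_def)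
  have cont\<sigma>: "continuous_on UNIV \<sigma>" unfolding \<sigma>_def[abs_def] using v0 by (intro continuous_intros) auto
  have contw: "continuous_on UNIV w" unfolding w_def[abs_def] by (intro continuous_intros cont\<sigma>)
  have \<eta>ex: "\<exists>\<eta>>0. \<forall>t. dist t x < \<eta> \<longrightarrow> t \<in> \<Omega> \<and> g t < ereal (c + d / 2)"
    if "x \<in> \<Omega>" "g x \<le> ereal c" for x c
  proof -
    have "g x < ereal (c + d / 2)" using that(2) d by (metis ereal_less(2) less_add_same_cancel1 half_gt_zero less_ereal.simps(1) order_le_less_trans)
    then have "x \<in> {t\<in>\<Omega>. g t < ereal (c + d / 2)}" using that by simp
    then show ?thesis using opg[of "ereal (c + d/2)"] unfolding open_dist by fastforce
  qed
  have p\<Omega>: "p \<in> \<Omega>" "q \<in> \<Omega>" using p q by (auto simp: \<Omega>_def)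
  obtain \<eta>1 where \<eta>1: "\<eta>1 > 0" "\<And>t. dist t p < \<eta>1 \<Longrightarrow> g t < ereal (A + d / 2)"
    using \<eta>ex[of p A] p\<Omega> A by (auto simp: g_def)
  obtain \<eta>2 where \<eta>2: "\<eta>2 > 0" "\<And>t. dist t q < \<eta>2 \<Longrightarrow> g t < ereal (B + d / 2)"
    using \<eta>ex[of q B] p\<Omega> B by (auto simp: g_def)
  have r0: "r > 0" using p exp_gt_zero order_less_trans by metis
  have "\<exists>\<eta>3>0. \<forall>i. max (p $ i) (q $ i) + \<eta>3 < ln r"
  proof -
    define M where "M = Max (range (\<lambda>i. max (p $ i) (q $ i)))"
    have "max (p $ i) (q $ i) \<le> M" for i unfolding M_def by (rule Max_ge) auto
    moreover have "M \<in> range (\<lambda>i. max (p $ i) (q $ i))" unfolding M_def by (rule Max_in) auto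
    then obtain i where "M = max (p $ i) (q $ i)" by auto
    then have "M < ln r" using p[of i] q[of i] r0
      by (metis exp_ln exp_less_cancel_iff max_less_iff_conj)
    ultimately have "max (p $ i) (q $ i) + (ln r - M) / 2 < ln r" for i
    proof -
      have half: "x + (y - m) / 2 < y" if "x \<le> m" "m < y" for x y m :: real using that by (simp add: field_simps)
      show ?thesis by (rule half) fact+
    qed
    then show ?thesis using \<open>M < ln r\<close> by (intro exI[of _ "(ln r - M)/2"]) auto
  qed
  then obtain \<eta>3 where \<eta>3: "\<eta>3 > 0" "\<And>i. max (p $ i) (q $ i) + \<eta>3 < ln r" by auto
  \<comment> \<open>The halving makes \<open>\<eta>\<close> strictly smaller than all three radii:
    the closed end caps of the cylinder \<open>Z\<close> lie in the neighbourhoods of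
    \<open>p\<close> and \<open>q\<close>, and \<open>Z\<close> lies in the domain.\<close>
  define \<eta> where "\<eta> = min (min \<eta>1 \<eta>2) \<eta>3 / 2"
  have \<eta>: "\<eta> > 0" "\<eta> < \<eta>1" "\<eta> < \<eta>2" "\<eta> < \<eta>3" using \<eta>1(1) \<eta>2(1) \<eta>3(1) by (auto simp: \<eta>_def)
  define Z where "Z = {t. 0 \<le> \<sigma> t \<and> \<sigma> t \<le> 1 \<and> norm (w t) \<le> \<eta>}"
  have Z\<Omega>: "Z \<subseteq> \<Omega>"
  proof
    fix t assume t: "t \<in> Z"
    show "t \<in> \<Omega>" unfolding \<Omega>_def
    proof (intro CollectI allI)
      fix i
      have "t $ i = (p + \<sigma> t *\<^sub>R v) $ i + w t $ i" by (metis t_eq vector_add_component)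
      moreover have "w t $ i \<le> \<eta>" using t component_le_norm_cart[of "w t" i] by (auto simp: Z_def)
      moreover have "(p + \<sigma> t *\<^sub>R v) $ i \<le> max (p $ i) (q $ i)"
      proof -
        have "(p + \<sigma> t *\<^sub>R v) $ i = (1 - \<sigma> t) * p $ i + \<sigma> t * q $ i" by (simp add: v_def algebra_simps)
        then show ?thesis
          using t convex_bound_le[of "p $ i" "max (p $ i) (q $ i)" "q $ i" "1 - \<sigma> t" "\<sigma> t"] by (simp add: Z_def)
      qed
      ultimately have "t $ i < ln r" using \<eta>3(2)[of i] \<eta>(4) by linarith
      then show "exp (t $ i) < r" using r0 by (metis exp_less_mono exp_ln)
    qed
  qed
  have compZ: "compact Z"
  proof -
    have "closed Z" unfolding Z_def
      by (intro closed_Collect_conj closed_Collect_le continuous_intros cont\<sigma> contw)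
    moreover have "norm t \<le> norm p + norm v + \<eta>" if "t \<in> Z" for t
    proof -
      have "norm (p + \<sigma> t *\<^sub>R v + w t) \<le> norm (p + \<sigma> t *\<^sub>R v) + norm (w t)" by (rule norm_triangle_ineq)
      also have "\<dots> \<le> norm p + norm (\<sigma> t *\<^sub>R v) + norm (w t)" by (intro add_right_mono norm_triangle_ineq)
      finally have "norm t \<le> norm p + norm (\<sigma> t *\<^sub>R v) + norm (w t)" unfolding t_eq[symmetric] .
      moreover have "norm (\<sigma> t *\<^sub>R v) \<le> norm v" using that by (simp add: Z_def mult_left_le_one_le)
      ultimately show ?thesis using that by (simp add: Z_def)
    qed
    ultimately show ?thesis by (auto simp: compact_eq_bounded_closed bounded_iff)
  qed
  have \<sigma>ps: "\<sigma> (p + s *\<^sub>R v) = s" "w (p + s *\<^sub>R v) = 0" using v0 by (auto simp: \<sigma>_def w_def)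
  then have psZ: "p + s *\<^sub>R v \<in> Z" using s \<eta>(1) by (simp add: Z_def)
  obtain Cb where Cb: "\<And>t. t \<in> Z \<Longrightarrow> g t \<le> ereal Cb"
  proof -
    have "usc_on Z (\<lambda>t. g t - ereal 0)" by (rule usc[OF Z\<Omega>]) (intro continuous_intros)
    then obtain m where m: "m \<in> Z" "\<And>t. t \<in> Z \<Longrightarrow> g t \<le> g m"
      using usc_attains_max[OF compZ, of g] psZ by auto
    show thesis
      by (rule that[of "real_of_ereal (g m)"], cases "g m") (use m gfin[of m] Z\<Omega> gm(1) psZ in fastforce)+
  qed
  \<comment> \<open>On the lateral face, where \<open>norm (w t) = \<eta>\<close>, this penalty
    compensates the chord and still lifts \<open>Q\<close> to the upper bound \<open>Cb\<close> of
    \<open>g\<close>.\<close>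
  define K where "K = (\<bar>Cb\<bar> + \<bar>A\<bar> + \<bar>B\<bar>) / \<eta>\<^sup>2"
  have K: "K \<ge> 0" by (simp add: K_def)
  have K\<eta>: "K * \<eta>\<^sup>2 = \<bar>Cb\<bar> + \<bar>A\<bar> + \<bar>B\<bar>" using \<eta>(1) by (simp add: K_def)
  define Q where "Q t = A + (B - A) * \<sigma> t + d * (\<sigma> t * (1 - \<sigma> t)) + d + K * (norm (w t))\<^sup>2" for t
  have contQ: "continuous_on UNIV Q" unfolding Q_def[abs_def] by (intro continuous_intros cont\<sigma> contw)
  obtain m where m: "m \<in> Z" "\<And>t. t \<in> Z \<Longrightarrow> g t - ereal (Q t) \<le> g m - ereal (Q m)"
    using usc_attains_max[OF compZ _ usc[OF Z\<Omega> contQ]] psZ by blast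
  have "Q (p + s *\<^sub>R v) < gm"
  proof -
    have "s * (1 - s) < 1" using s01 mult_strict_mono[of s 1 "1 - s" 1] by simp
    then have "d * (s * (1 - s)) < d" using d by simp
    moreover have "gm = A + (B - A) * s + 2 * d" by (simp add: d_def field_simps)
    ultimately show ?thesis unfolding Q_def \<sigma>ps by simp
  qed
  then have "0 < g (p + s *\<^sub>R v) - ereal (Q (p + s *\<^sub>R v))" by (simp add: gm)
  also have "\<dots> \<le> g m - ereal (Q m)" using m psZ by blast
  finally have pos: "0 < g m - ereal (Q m)" .
  then obtain mm where mm: "g m = ereal mm" "Q m < mm"
    using gfin[of m] Z\<Omega> m(1) by (cases "g m") auto
  have \<sigma>m: "0 \<le> \<sigma> m" "\<sigma> m \<le> 1" "norm (w m) \<le> \<eta>" using m(1) by (auto simp: Z_def)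
  have kpos: "0 \<le> d * (\<sigma> m * (1 - \<sigma> m))" "0 \<le> K * (norm (w m))\<^sup>2" using \<sigma>m K d by auto
  have m0: "\<sigma> m \<noteq> 0"
  proof
    assume z: "\<sigma> m = 0"
    then have "m = p + w m" using t_eq[of m] by simp
    then have "dist m p < \<eta>1" using \<sigma>m(3) \<eta>(2) by (metis add_diff_cancel_left' dist_norm order_le_less_trans)
    then have "mm < A + d/2" using \<eta>1(2)[of m] mm by simp
    moreover have "A + d \<le> Q m" unfolding Q_def z using kpos by simp
    ultimately show False using mm(2) d by linarith
  qed
  have m1: "\<sigma> m \<noteq> 1"
  proof
    assume z: "\<sigma> m = 1"
    then have "m = q + w m" using t_eq[of m] by (simp add: v_def)
    then have "dist m q < \<eta>2" using \<sigma>m(3) \<eta>(3) by (metis add_diff_cancel_left' dist_norm order_le_less_trans)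
    then have "mm < B + d/2" using \<eta>2(2)[of m] mm by simp
    moreover have "B + d \<le> Q m" unfolding Q_def z using kpos by simp
    ultimately show False using mm(2) d by linarith
  qed
  have m2: "norm (w m) \<noteq> \<eta>"
  proof
    assume z: "norm (w m) = \<eta>"
    have "(1 - \<sigma> m) * (-A) + \<sigma> m * (-B) \<le> \<bar>A\<bar> + \<bar>B\<bar>"
      using \<sigma>m convex_bound_le[of "-A" "\<bar>A\<bar> + \<bar>B\<bar>" "-B" "1 - \<sigma> m" "\<sigma> m"] by auto
    then have "A + (B - A) * \<sigma> m \<ge> - (\<bar>A\<bar> + \<bar>B\<bar>)" by (simp add: algebra_simps)
    then have "Q m \<ge> \<bar>Cb\<bar>" unfolding Q_def z K\<eta> using kpos d by linarith
    moreover have "mm \<le> Cb" using Cb[OF m(1)] mm by simp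
    ultimately show False using mm(2) by linarith
  qed
  have "open {t. 0 < \<sigma> t \<and> \<sigma> t < 1 \<and> norm (w t) < \<eta>}"
    by (intro open_Collect_conj open_Collect_less continuous_intros cont\<sigma> contw)
  moreover have "m \<in> {t. 0 < \<sigma> t \<and> \<sigma> t < 1 \<and> norm (w t) < \<eta>}" using \<sigma>m m0 m1 m2 by auto
  ultimately obtain e where e: "e > 0" "\<And>t. dist t m < e \<Longrightarrow> t \<in> Z"
    unfolding open_dist Z_def by (smt (verit) mem_Collect_eq)
  \<comment> \<open>The gradient of \<open>Q\<close> at \<open>m\<close>. As \<open>Q\<close> is a
    quadratic polynomial, \<open>Qexp\<close> is its exact expansion at \<open>m\<close>, with
    coefficient \<open>- d\<close> on the square of the coordinate along \<open>v\<close>.\<close>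
  define l where "l = (((B - A) + d * (1 - 2 * \<sigma> m)) / (v \<bullet> v)) *\<^sub>R v + (2 * K) *\<^sub>R w m"
  have wv: "w m \<bullet> v = 0" using v0 by (simp add: w_def \<sigma>_def inner_diff_left)
  have Qexp: "Q (m + u) = Q m + l \<bullet> u - d * ((u \<bullet> v) / (v \<bullet> v))\<^sup>2
      + K * (norm (u - ((u \<bullet> v) / (v \<bullet> v)) *\<^sub>R v))\<^sup>2" for u
  proof -
    define \<tau> where "\<tau> = (u \<bullet> v) / (v \<bullet> v)"
    define y where "y = u - \<tau> *\<^sub>R v"
    have \<sigma>u: "\<sigma> (m + u) = \<sigma> m + \<tau>"
      by (simp add: \<sigma>_def \<tau>_def inner_diff_left inner_add_left add_divide_distrib diff_divide_distrib)
    have wu: "w (m + u) = w m + y" unfolding w_def \<sigma>u y_def by (simp add: algebra_simps)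
    have nw: "(norm (w m + y))\<^sup>2 = (norm (w m))\<^sup>2 + 2 * (w m \<bullet> y) + (norm y)\<^sup>2"
      by (simp add: power2_norm_eq_inner inner_add_left inner_add_right inner_commute)
    have wy: "w m \<bullet> y = w m \<bullet> u" using wv by (simp add: y_def inner_diff_right)
    have "l \<bullet> u = ((B - A) + d * (1 - 2 * \<sigma> m)) * \<tau> + 2 * K * (w m \<bullet> y)"
      unfolding wy by (simp add: l_def \<tau>_def inner_add_left inner_commute[of v u])
    then show ?thesis unfolding \<tau>_def[symmetric] y_def[symmetric] Q_def \<sigma>u wu nw
      by (simp add: algebra_simps power2_eq_square)
  qed
  show False
  proof (rule toric_no_strict_touching[OF tor _ v0 d e(1) K, of m mm l])
    show "exp (m $ i) < r" for i using m(1) Z\<Omega> by (auto simp: \<Omega>_def)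
    show "\<phi> (cexp m) = ereal mm" using mm by (simp add: g_def)
    fix u :: "real^'n" assume "norm u < e"
    then have "m + u \<in> Z" using e(2) by (simp add: dist_norm)
    then have "g (m + u) - ereal (Q (m + u)) \<le> ereal (mm - Q m)" using m(2)[of "m + u"] mm by simp
    then have "g (m + u) \<le> ereal (mm + (Q (m + u) - Q m))" by (cases "g (m + u)") auto
    also have "mm + (Q (m + u) - Q m) = mm + l \<bullet> u - d * ((u \<bullet> v) / (v \<bullet> v))\<^sup>2
      + K * (norm (u - ((u \<bullet> v) / (v \<bullet> v)) *\<^sub>R v))\<^sup>2" unfolding Qexp by simp
    finally show "\<phi> (cexp (m + u)) \<le> ereal (mm + l \<bullet> u - d * ((u \<bullet> v) / (v \<bullet> v))\<^sup>2
      + K * (norm (u - ((u \<bullet> v) / (v \<bullet> v)) *\<^sub>R v))\<^sup>2)" by (simp add: g_def)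
  qed
qed

subsection \<open>Lebesgue measure under diagonal linear maps\<close>

text \<open>By Vitali's covering theorem an open set is, up to a null set, a countable disjoint
  union of balls. The preimage of a ball is a ball of the same radius, and its volume depends on the
  radius alone. Only an inequality results, as nothing is yet known about the preimage of the null
  remainder.\<close>

lemma emeasure_vimage_isometry_ge:
  fixes T :: "'a::euclidean_space \<Rightarrow> 'a"
  assumes lin: "linear T" and iso: "\<And>x. norm (T x) = norm x" and surj: "surj T" and S: "open S"
  shows "emeasure lborel S \<le> emeasure lborel (T -` S)"
proof -
  define K where "K = {(c::'a, r::real). 0 < r \<and> ball c r \<subseteq> S}"
  have "\<exists>i. i \<in> K \<and> x \<in> ball (fst i) (snd i) \<and> snd i < d" if "x \<in> S" "d > 0" for x d
  proof -
    obtain e where "e > 0" "ball x e \<subseteq> S" using S \<open>x \<in> S\<close> open_contains_ball by blast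
    then have "(x, min e (d/2)) \<in> K" using \<open>d > 0\<close> by (auto simp: K_def)
    then show ?thesis using \<open>d > 0\<close> \<open>e > 0\<close> by (intro exI[of _ "(x, min e (d/2))"]) auto
  qed
  then obtain C where C: "countable C" "C \<subseteq> K"
     "pairwise (\<lambda>i j. disjnt (ball (fst i) (snd i)) (ball (fst j) (snd j))) C"
     "negligible(S - (\<Union>i \<in> C. ball (fst i) (snd i)))"
    by (rule Vitali_covering_theorem_balls[where S=S and K=K and r=snd and a=fst])
  let ?U = "\<Union>i \<in> C. ball (fst i) (snd i)"
  have contT: "continuous_on UNIV T"
    by (rule linear_continuous_on[OF linear_conv_bounded_linear[THEN iffD1, OF lin]])
  have opU: "open ?U" by auto
  have ballT: "\<exists>c'. T -` ball c r = ball c' r" for c r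
  proof -
    obtain c' where c': "T c' = c" using surj by (metis surjD)
    have "dist (T c') (T y) = dist c' y" for y
      using iso[of "c' - y"] by (simp add: dist_norm linear_diff[OF lin])
    then show ?thesis using c' by (intro exI[of _ c']) (auto simp: ball_def)
  qed
  have dis: "disjoint_family_on (\<lambda>i. ball (fst i) (snd i)) C"
    using C(3) by (auto simp: disjoint_family_on_def pairwise_def disjnt_def)
  have "emeasure lborel S \<le> emeasure lborel (?U \<union> (S - ?U))"
    by (rule emeasure_mono) (use S opU in auto)
  also have "\<dots> \<le> emeasure lborel ?U + emeasure lborel (S - ?U)"
    by (rule emeasure_subadditive) (use S opU in auto)
  also have "emeasure lborel (S - ?U) = 0"
  proof -
    have "S - ?U \<in> sets borel" using S opU by auto
    then show ?thesis using C(4)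
      by (simp add: negligible_iff_null_sets null_sets_completion_iff null_setsD1)
  qed
  also have "emeasure lborel ?U = (\<integral>\<^sup>+i. emeasure lborel (ball (fst i) (snd i)) \<partial>count_space C)"
    by (rule emeasure_UN_countable) (use C dis in auto)
  also have "\<dots> = (\<integral>\<^sup>+i. emeasure lborel (T -` ball (fst i) (snd i)) \<partial>count_space C)"
  proof (rule nn_integral_cong)
    fix i assume "i \<in> space (count_space C)"
    then have "0 \<le> snd i" using C(2) by (auto simp: K_def)
    moreover obtain c' where "T -` ball (fst i) (snd i) = ball c' (snd i)" using ballT by blast
    ultimately show "emeasure lborel (ball (fst i) (snd i)) = emeasure lborel (T -` ball (fst i) (snd i))"
      by (simp add: emeasure_ball)
  qed
  also have "\<dots> = emeasure lborel (\<Union>i\<in>C. T -` ball (fst i) (snd i))"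
  proof (rule emeasure_UN_countable[symmetric])
    show "disjoint_family_on (\<lambda>i. T -` ball (fst i) (snd i)) C"
      using dis by (fastforce simp: disjoint_family_on_def)
    show "T -` ball (fst i) (snd i) \<in> sets lborel" for i
      using contT by (metis open_ball open_vimage borel_open sets_lborel)
  qed (use C in auto)
  also have "\<dots> \<le> emeasure lborel (T -` S)"
  proof (rule emeasure_mono)
    show "(\<Union>i\<in>C. T -` ball (fst i) (snd i)) \<subseteq> T -` S" using C(2) by (fastforce simp: K_def)
    show "T -` S \<in> sets lborel" using contT S by (metis open_vimage borel_open sets_lborel)
  qed
  finally show ?thesis by simp
qed

text \<open>Equality on open sets follows from the inequality for \<open>T\<close> and for its
  inverse, and open boxes determine the measure.\<close>

lemma lborel_distr_isometry:
  fixes T :: "'a::euclidean_space \<Rightarrow> 'a"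
  assumes lin: "linear T" and iso: "\<And>x. norm (T x) = norm x"
  shows "distr lborel borel T = lborel"
proof -
  have injT: "inj T" using iso lin by (metis linear_injective_0 norm_eq_zero)
  then have surjT: "surj T" using lin by (simp add: linear_inj_imp_surj)
  define T' where "T' = inv T"
  have TT': "T (T' x) = x" for x by (simp add: T'_def surj_f_inv_f surjT)
  have T'T: "T' (T x) = x" for x by (simp add: T'_def injT)
  have lin': "linear T'"
  proof (rule linearI)
    fix x y
    have "T (T' x + T' y) = x + y" by (simp add: linear_add[OF lin] TT')
    then show "T' (x + y) = T' x + T' y" by (metis T'T)
  next
    fix c x
    have "T (c *\<^sub>R T' x) = c *\<^sub>R x" by (simp add: linear_cmul[OF lin] TT')
    then show "T' (c *\<^sub>R x) = c *\<^sub>R T' x" by (metis T'T)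
  qed
  have iso': "norm (T' x) = norm x" for x by (metis iso TT')
  have surj': "surj T'" by (metis T'T surjI)
  have contT: "continuous_on UNIV T"
    by (rule linear_continuous_on[OF linear_conv_bounded_linear[THEN iffD1, OF lin]])
  have [measurable]: "T \<in> borel_measurable borel" using contT by (rule borel_measurable_continuous_onI)
  have eq: "emeasure lborel (T -` S) = emeasure lborel S" if S: "open S" for S
  proof (rule antisym)
    have "open (T -` S)" using S contT open_vimage by blast
    from emeasure_vimage_isometry_ge[OF lin' iso' surj' this]
    have "emeasure lborel (T -` S) \<le> emeasure lborel (T' -` T -` S)" .
    moreover have "T' -` T -` S = S" using TT' by auto
    ultimately show "emeasure lborel (T -` S) \<le> emeasure lborel S" by simp
  qed (rule emeasure_vimage_isometry_ge[OF lin iso surjT S])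
  show ?thesis
    by (rule lborel_eqI[symmetric]) (auto simp: emeasure_distr eq open_box)
qed

text \<open>Diagonal linear maps: entries of modulus 1 give the rotations of the torus, positive
  entries the translations in logarithmic coordinates.\<close>

definition dscale :: "('n \<Rightarrow> complex) \<Rightarrow> complex^'n \<Rightarrow> complex^'n" where
  "dscale c z = (\<chi> j. c j * z $ j)"

lemma dscale_nth [simp]: "dscale c z $ j = c j * z $ j"
  by (simp add: dscale_def)

lemma linear_dscale: "linear (dscale c)"
  by (rule linearI) (auto simp: vec_eq_iff algebra_simps)

lemma continuous_dscale: "continuous_on A (dscale c)"
  using linear_dscale linear_conv_bounded_linear linear_continuous_on by blast

lemma borel_measurable_dscale [measurable]: "dscale c \<in> borel_measurable borel"
  by (rule borel_measurable_continuous_onI[OF continuous_dscale])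

lemma nn_integral_dscale_unit:
  assumes c: "\<And>j. cmod (c j) = 1" and [measurable]: "f \<in> borel_measurable borel"
  shows "(\<integral>\<^sup>+z. f (dscale c z) \<partial>lborel) = (\<integral>\<^sup>+z. f z \<partial>lborel)"
proof -
  have "norm (dscale c z) = norm z" for z
    by (simp add: norm_vec_def norm_mult c)
  then have "distr lborel borel (dscale c) = lborel"
    by (intro lborel_distr_isometry linear_dscale)
  then have "(\<integral>\<^sup>+z. f z \<partial>lborel) = (\<integral>\<^sup>+z. f z \<partial>distr lborel borel (dscale c))" by simp
  also have "\<dots> = (\<integral>\<^sup>+z. f (dscale c z) \<partial>lborel)"
    by (rule nn_integral_distr) auto
  finally show ?thesis by simp
qed

lemma prod_Basis_complex_vec:
  fixes g :: "complex^'n \<Rightarrow> 'a::comm_monoid_mult"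
  shows "(\<Prod>b\<in>Basis. g b) = (\<Prod>j\<in>UNIV. g (axis j 1) * g (axis j \<i>))"
proof -
  have "(Basis :: (complex^'n) set) = (\<Union>j. {axis j 1, axis j \<i>})"
    by (auto simp: Basis_vec_def Basis_complex_def)
  also have "prod g \<dots> = (\<Prod>j\<in>UNIV. prod g {axis j 1, axis j \<i>})"
    by (rule prod.UNION_disjoint) (auto simp: axis_eq_axis)
  finally show ?thesis by (simp add: axis_eq_axis complex_eq_iff)
qed

lemma nn_integral_dscale_real:
  fixes c :: "'n::finite \<Rightarrow> real"
  assumes c: "\<And>j. c j > 0" and [measurable]: "f \<in> borel_measurable borel"
  shows "(\<integral>\<^sup>+z. f z \<partial>lborel) =
    ennreal (\<Prod>j\<in>UNIV. (c j)\<^sup>2) * (\<integral>\<^sup>+z. f (dscale (\<lambda>j. of_real (c j)) z) \<partial>lborel)"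
proof -
  \<comment> \<open>The change of variables takes one factor per real basis vector. Such a vector
    has exactly one nonzero component, whose index \<open>SOME\<close> recovers; each index occurs
    twice, for \<open>1\<close> and for \<open>\<i>\<close>, which produces the squares in the
    Jacobian.\<close>
  define c' :: "complex^'n \<Rightarrow> real" where "c' b = c (SOME j. b $ j \<noteq> 0)" for b
  have ax: "c' (axis j u) = c j" if "u \<noteq> 0" for j u
  proof -
    have "(SOME k. axis j u $ k \<noteq> 0) = j"
      by (rule some_equality) (use that in \<open>auto simp: axis_def split: if_splits\<close>)
    then show ?thesis by (simp add: c'_def)
  qed
  have pos: "c' b > 0" for b by (simp add: c'_def c)
  have T: "0 + (\<Sum>b\<in>Basis. (c' b * (z \<bullet> b)) *\<^sub>R b) = dscale (\<lambda>j. of_real (c j)) z" for z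
  proof -
    have "z = (\<Sum>b\<in>Basis. (z \<bullet> b) *\<^sub>R b)" by (simp add: euclidean_representation)
    then have "dscale (\<lambda>j. of_real (c j)) z = (\<Sum>b\<in>Basis. (z \<bullet> b) *\<^sub>R dscale (\<lambda>j. of_real (c j)) b)"
      using linear_dscale by (metis (no_types, lifting) linear_sum linear_cmul sum.cong)
    moreover have "dscale (\<lambda>j. of_real (c j)) b = c' b *\<^sub>R b" if b: "b \<in> Basis" for b
    proof -
      obtain j u where bju: "b = axis j u" "u \<in> Basis" using b by (auto simp: Basis_vec_def)
      then have "c' b = c j" using ax[of u j] nonzero_Basis[of u] by auto
      then show ?thesis
        by (simp add: vec_eq_iff bju(1) axis_def scaleR_conv_of_real[where 'a=complex])
    qed
    ultimately show ?thesis by (simp add: mult.commute)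
  qed
  have "(\<integral>\<^sup>+z. f z \<partial>lborel) = (\<integral>\<^sup>+z. f z \<partial>density (distr lborel borel
      (\<lambda>z. 0 + (\<Sum>b\<in>Basis. (c' b * (z \<bullet> b)) *\<^sub>R b))) (\<lambda>_. (\<Prod>b\<in>Basis. \<bar>c' b\<bar>)))"
    by (subst lborel_affine_euclidean[of c' 0]) (use pos in \<open>auto simp: less_imp_neq[symmetric]\<close>)
  also have "\<dots> = (\<integral>\<^sup>+z. f z \<partial>density (distr lborel borel
      (dscale (\<lambda>j. of_real (c j)))) (\<lambda>_. (\<Prod>b\<in>Basis. \<bar>c' b\<bar>)))" unfolding T ..
  also have "\<dots> = ennreal (\<Prod>b\<in>Basis. \<bar>c' b\<bar>) * (\<integral>\<^sup>+z. f (dscale (\<lambda>j. of_real (c j)) z) \<partial>lborel)"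
    by (simp add: nn_integral_density nn_integral_cmult nn_integral_distr)
  also have "(\<Prod>b\<in>Basis. \<bar>c' b\<bar>) = (\<Prod>j\<in>UNIV. (c j)\<^sup>2)"
    by (simp add: prod_Basis_complex_vec ax c abs_of_pos power2_eq_square)
  finally show ?thesis .
qed

text \<open>The one-dimensional integral to which integrability is finally reduced. The exponent
  exceeds -1, and the negative half is reflected onto the positive one.\<close>

lemma nn_integral_powr_finite:
  fixes d :: real assumes "d > 0"
  shows "(\<integral>\<^sup>+x. ennreal (\<bar>x\<bar> powr (d - 1)) * indicator {-1..1} x \<partial>lborel) < \<infinity>"
proof -
  have *: "(\<integral>\<^sup>+x. ennreal (x powr (d - 1)) * indicator {0..1} x \<partial>lborel) < \<infinity>"
  proof -
    have "((\<lambda>x. x powr (d - 1)) has_integral (1 powr (d - 1 + 1) / (d - 1 + 1))) {0..1}"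
      by (rule has_integral_powr_from_0) (use assms in auto)
    then have "(\<lambda>x. x powr (d-1)) integrable_on {0..1}" by blast
    then have "(\<lambda>x. x powr (d-1)) absolutely_integrable_on {0..1}"
      by (rule nonnegative_absolutely_integrable_1) auto
    then have "integrable lebesgue (\<lambda>x. indicator {0..1} x *\<^sub>R x powr (d-1))"
      by (simp add: set_integrable_def)
    then have "(\<integral>\<^sup>+x. ennreal (norm (indicator {0..1} x *\<^sub>R x powr (d-1))) \<partial>lebesgue) < \<infinity>"
      by (simp add: integrable_iff_bounded)
    then have "(\<integral>\<^sup>+x. ennreal (norm (indicator {0..1} x *\<^sub>R x powr (d-1))) \<partial>lborel) < \<infinity>"
      by (simp only: nn_integral_completion)
    moreover have "ennreal (norm (indicator {0..1} x *\<^sub>R x powr (d-1))) = ennreal (x powr (d - 1)) * indicator {0..1} x" for x :: real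
      by (simp split: split_indicator)
    ultimately show ?thesis by simp
  qed
  have "(\<integral>\<^sup>+x. ennreal (\<bar>x\<bar> powr (d - 1)) * indicator {-1..0} x \<partial>lborel)
      = (\<integral>\<^sup>+x. ennreal (x powr (d - 1)) * indicator {0..1} x \<partial>lborel)"
    by (subst nn_integral_real_affine[where c="-1" and t=0])
       (auto intro!: nn_integral_cong simp: indicator_def)
  moreover have "(\<integral>\<^sup>+x. ennreal (\<bar>x\<bar> powr (d - 1)) * indicator {-1..1} x \<partial>lborel)
     \<le> (\<integral>\<^sup>+x. ennreal (\<bar>x\<bar> powr (d - 1)) * indicator {-1..0} x + ennreal (x powr (d - 1)) * indicator {0..1} x \<partial>lborel)"
    by (rule nn_integral_mono) (auto simp: indicator_def)
  ultimately show ?thesis using *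
    by (subst (asm) nn_integral_add) (auto simp: order_le_less_trans)
qed

subsection \<open>Taylor coefficients in some of the variables\<close>

text \<open>Cauchy's inequality on circles of radius \<open>s < \<rho>\<close>, followed by the
  limit in \<open>s\<close>, since nothing is assumed on the boundary of the ball.\<close>

lemma norm_taylor_coeff_le:
  assumes h: "h holomorphic_on ball 0 \<rho>" and \<rho>: "\<rho> > 0" and M: "\<And>z. z \<in> ball 0 \<rho> \<Longrightarrow> cmod (h z) \<le> M"
  shows "cmod ((deriv ^^ k) h 0 / fact k) \<le> M / \<rho> ^ k"
proof -
  have "cmod ((deriv ^^ k) h 0 / fact k) \<le> M / s ^ k" if s: "0 < s" "s < \<rho>" for s
  proof -
    have sub: "cball 0 s \<subseteq> ball 0 \<rho>" using s by auto
    have "cmod ((deriv ^^ k) h 0) \<le> fact k * M / s ^ k"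
    proof (rule Cauchy_inequality)
      show "h holomorphic_on ball 0 s" using h s by (auto intro: holomorphic_on_subset)
      show "continuous_on (cball 0 s) h" using h sub holomorphic_on_imp_continuous_on continuous_on_subset by blast
    qed (use s M in auto)
    then show ?thesis by (simp add: norm_divide pos_divide_le_eq mult.commute)
  qed
  then have "\<forall>\<^sub>F s in at_left \<rho>. cmod ((deriv ^^ k) h 0 / fact k) \<le> M / s ^ k"
    using eventually_at_left_real[OF \<rho>] by (auto elim!: eventually_mono)
  moreover have "((\<lambda>s. M / s ^ k) \<longlongrightarrow> M / \<rho> ^ k) (at_left \<rho>)"
    using \<rho> by (auto intro!: tendsto_eq_intros)
  ultimately show ?thesis by (intro tendsto_lowerbound) auto
qed

definition unity_root :: "nat \<Rightarrow> nat \<Rightarrow> complex" where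
  "unity_root N m = exp (2 * of_real pi * \<i> * of_nat m / of_nat N)"

text \<open>Averaging over roots of unity picks out the Taylor terms of degree congruent to \<open>k\<close> modulo \<open>N\<close>.
  The averages converge to a single Taylor term as \<open>N\<close> grows; since they are finite sums of rotated
  functions, holomorphy in the other variables and weighted \<open>L\<^sup>2\<close> bounds pass to the limit.\<close>

definition unity_avg :: "nat \<Rightarrow> nat \<Rightarrow> (complex \<Rightarrow> complex) \<Rightarrow> complex \<Rightarrow> complex" where
  "unity_avg N k h z = (\<Sum>m<N. h (unity_root N m * z) / unity_root N m ^ k) / of_nat N"

lemma norm_unity_root [simp]: "cmod (unity_root N m) = 1"
proof -
  have "2 * of_real pi * \<i> * of_nat m / of_nat N = \<i> * of_real (2 * pi * real m / real N)"
    by simp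
  then show ?thesis unfolding unity_root_def by (simp only: norm_exp_i_times)
qed

lemma unity_root_nz [simp]: "unity_root N m \<noteq> 0"
  by (simp add: unity_root_def)

lemma unity_root_power_swap: "unity_root N m ^ j = unity_root N j ^ m"
  unfolding unity_root_def exp_of_nat_mult[symmetric] by (simp add: mult_ac)

text \<open>The summands are the powers of a single \<open>N\<close>-th root of unity different from
  1, so the geometric sum vanishes.\<close>

lemma unity_root_orthogonal:
  assumes "N > 0" "j < N" "k < N" "j \<noteq> k"
  shows "(\<Sum>m<N. unity_root N m ^ j / unity_root N m ^ k) = 0"
proof -
  let ?z = "unity_root N j / unity_root N k"
  have "unity_root N j \<noteq> unity_root N k"
    using complex_root_unity_eq[of N j k] assms by (auto simp: unity_root_def cong_def)
  then have "?z \<noteq> 1" by simp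
  have 1: "unity_root N j ^ N = 1" for j
  proof -
    have "unity_root N j ^ N = unity_root N N ^ j" by (rule unity_root_power_swap[symmetric])
    also have "unity_root N N = 1" using assms(1) by (simp add: unity_root_def)
    finally show ?thesis by simp
  qed
  have "(\<Sum>m<N. unity_root N m ^ j / unity_root N m ^ k) = (\<Sum>m<N. ?z ^ m)"
    by (simp add: unity_root_power_swap[of N _ j] unity_root_power_swap[of N _ k] power_divide)
  also have "\<dots> = (?z ^ N - 1) / (?z - 1)" by (rule geometric_sum[OF \<open>?z \<noteq> 1\<close>])
  also have "\<dots> = 0" by (simp add: power_divide 1)
  finally show ?thesis .
qed

text \<open>In the power series, averaging multiplies the term of degree \<open>j\<close> by a
  factor \<open>a j\<close> which is 1 for \<open>j = k\<close>, 0 for the other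
  \<open>j < N\<close>, and of modulus at most 1 in every case. The error is thus a tail that starts
  at degree \<open>N\<close>, and Cauchy's estimate bounds it by a geometric series.\<close>

lemma unity_avg_approx:
  assumes h: "h holomorphic_on ball 0 \<rho>" and M: "\<And>z. z \<in> ball 0 \<rho> \<Longrightarrow> cmod (h z) \<le> M"
    and z: "cmod z < \<rho>" and N: "k < N"
  shows "cmod (unity_avg N k h z - (deriv ^^ k) h 0 / fact k * z ^ k)
      \<le> M * (cmod z / \<rho>) ^ N / (1 - cmod z / \<rho>)"
proof -
  define c where "c j = (deriv ^^ j) h 0 / fact j" for j
  define q where "q = cmod z / \<rho>"
  define a where "a j = (\<Sum>m<N. unity_root N m ^ j / unity_root N m ^ k) / of_nat N" for j
  have \<rho>: "\<rho> > 0" using z norm_ge_zero[of z] by linarith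
  have q: "0 \<le> q" "q < 1" using z \<rho> by (auto simp: q_def)
  have M0: "0 \<le> M" using order_trans[OF norm_ge_zero M[of 0]] \<rho> by simp
  have cq: "cmod (c j * z ^ j) \<le> M * q ^ j" for j
  proof -
    have "cmod (c j * z ^ j) \<le> M / \<rho> ^ j * cmod z ^ j"
      unfolding norm_mult norm_power c_def by (intro mult_right_mono norm_taylor_coeff_le h \<rho> M) auto
    then show ?thesis by (simp add: q_def power_divide)
  qed
  have "(\<lambda>j. c j * (unity_root N m * z - 0) ^ j) sums h (unity_root N m * z)" for m
    unfolding c_def by (rule holomorphic_power_series[OF h]) (use z in \<open>simp add: norm_mult\<close>)
  then have "(\<lambda>j. (\<Sum>m<N. c j * (unity_root N m * z) ^ j / unity_root N m ^ k) / of_nat N) sums unity_avg N k h z"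
    unfolding unity_avg_def by (intro sums_divide sums_sum) simp
  moreover have "(\<Sum>m<N. c j * (unity_root N m * z) ^ j / unity_root N m ^ k) / of_nat N = a j * (c j * z ^ j)" for j
    by (simp add: a_def sum_distrib_left sum_divide_distrib power_mult_distrib mult_ac)
  ultimately have s1: "(\<lambda>j. a j * (c j * z ^ j)) sums unity_avg N k h z" by simp
  have ak: "a k = 1" using N by (simp add: a_def)
  have a0: "a j = 0" if "j < N" "j \<noteq> k" for j
    using unity_root_orthogonal[of N j k] N that by (simp add: a_def)
  have a1: "cmod (a j) \<le> 1" for j
  proof -
    have "cmod (\<Sum>m<N. unity_root N m ^ j / unity_root N m ^ k) \<le> (\<Sum>m<N. 1)"
      by (rule order_trans[OF norm_sum]) (simp add: norm_divide norm_power)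
    then show ?thesis using N by (simp add: a_def norm_divide divide_simps)
  qed
  have "(\<Sum>j<N. a j * (c j * z ^ j)) = (\<Sum>j\<in>{k}. a j * (c j * z ^ j))"
    by (rule sum.mono_neutral_right) (use N a0 in auto)
  then have "(\<Sum>j<N. a j * (c j * z ^ j)) = c k * z ^ k" by (simp add: ak)
  with sums_split_initial_segment[OF s1, of N]
  have s2: "(\<lambda>j. a (j + N) * (c (j + N) * z ^ (j + N))) sums (unity_avg N k h z - c k * z ^ k)" by simp
  have geo: "(\<lambda>j. M * q ^ N * q ^ j) sums (M * q ^ N * (1 / (1 - q)))"
    by (intro sums_mult geometric_sums) (use q in simp)
  have "cmod (suminf (\<lambda>j. a (j + N) * (c (j + N) * z ^ (j + N)))) \<le> suminf (\<lambda>j. M * q ^ N * q ^ j)"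
  proof (rule norm_suminf_le)
    fix j
    have "cmod (a (j + N) * (c (j + N) * z ^ (j + N))) \<le> 1 * (M * q ^ (j + N))"
      unfolding norm_mult[of "a (j + N)"] by (intro mult_mono a1 cq) auto
    then show "cmod (a (j + N) * (c (j + N) * z ^ (j + N))) \<le> M * q ^ N * q ^ j"
      by (simp add: power_add mult_ac)
  qed (use geo sums_summable in blast)
  then show ?thesis using s2 geo by (simp add: sums_iff c_def q_def)
qed

section \<open>Iterated Taylor coefficients\<close>

definition upd :: "'n \<Rightarrow> 'a \<Rightarrow> 'a^'n \<Rightarrow> 'a^'n" where
  "upd i w z = (\<chi> j. if j = i then w else z $ j)"

lemma upd_nth [simp]: "upd i w z $ j = (if j = i then w else z $ j)"
  by (simp add: upd_def)

lemma upd_self [simp]: "upd i (z $ i) z = z" and upd_upd [simp]: "upd i w (upd i v z) = upd i w z"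
  by (simp_all add: vec_eq_iff)

lemma upd_commute: "i \<noteq> j \<Longrightarrow> upd i w (upd j v z) = upd j v (upd i w z)"
  by (simp add: vec_eq_iff)

lemma continuous_upd: "continuous_on A (upd i w)"
proof -
  have "continuous_on A (\<lambda>z. if j = i then w else z $ j)" for j
    by (cases "j = i") (auto intro!: continuous_intros)
  then show ?thesis unfolding upd_def[abs_def] by (intro continuous_on_vec_lambda) auto
qed

definition taylor_coeff :: "'n \<Rightarrow> nat \<Rightarrow> (complex^'n \<Rightarrow> complex) \<Rightarrow> complex^'n \<Rightarrow> complex" where
  "taylor_coeff i k f z = (deriv ^^ k) (\<lambda>w. f (upd i w z)) 0 / fact k"

text \<open>A fixed list of variables permits induction and spares a proof that extractions in
  different variables commute.\<close>

primrec taylor_coeffs :: "'n list \<Rightarrow> ('n \<Rightarrow> nat) \<Rightarrow> (complex^'n \<Rightarrow> complex) \<Rightarrow> complex^'n \<Rightarrow> complex" where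
  "taylor_coeffs [] a f = f"
| "taylor_coeffs (i # l) a f = taylor_coeffs l a (taylor_coeff i (a i) f)"

lemma taylor_coeff_upd [simp]: "taylor_coeff i k f (upd i w z) = taylor_coeff i k f z"
  by (simp add: taylor_coeff_def)

lemma taylor_coeffs_upd_const:
  assumes "\<And>z w. f (upd i w z) = f z"
  shows "taylor_coeffs l a f (upd i w z) = taylor_coeffs l a f z"
  using assms
proof (induction l arbitrary: f)
  case (Cons j l)
  have "taylor_coeff j (a j) f (upd i w z) = taylor_coeff j (a j) f z" for z w
  proof (cases "i = j")
    case False
    then show ?thesis unfolding taylor_coeff_def by (subst upd_commute) (auto simp: Cons.prems)
  qed simp
  then show ?case by (simp add: Cons.IH)
qed simp

lemma taylor_coeffs_upd:
  "i \<in> set l \<Longrightarrow> taylor_coeffs l a f (upd i w z) = taylor_coeffs l a f z"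
proof (induction l arbitrary: f)
  case (Cons j l)
  show ?case
  proof (cases "i = j")
    case True
    then show ?thesis by (simp add: taylor_coeffs_upd_const)
  next
    case False
    then show ?thesis using Cons by simp
  qed
qed simp

lemma taylor_coeffs_cong: "(\<And>i. i \<in> set l \<Longrightarrow> a i = b i) \<Longrightarrow> taylor_coeffs l a f = taylor_coeffs l b f"
  by (induction l arbitrary: f) auto

text \<open>In the directions of \<open>I\<close> the set \<open>R\<close> is a full polydisc of
  radius \<open>\<rho>\<close> about 0, over an arbitrary open base in the other coordinates. Only
  these directions carry a Taylor expansion that is compatible with rotations about 0.\<close>

locale Reinhardt_slices =
  fixes I :: "'n::finite set" and \<rho> :: real and R :: "(complex^'n) set"
  assumes \<rho>: "\<rho> > 0" and open_R: "open R"
    and R_bound: "z \<in> R \<Longrightarrow> i \<in> I \<Longrightarrow> cmod (z $ i) < \<rho>"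
    and R_upd: "z \<in> R \<Longrightarrow> i \<in> I \<Longrightarrow> cmod w < \<rho> \<Longrightarrow> upd i w z \<in> R"
begin

text \<open>A class of functions that is stable under taking Taylor coefficients, so that the
  iteration becomes an induction. The bound \<open>M\<close> makes the root-of-unity averages
  converge uniformly on \<open>R\<close>.\<close>

definition slice_holo :: "real \<Rightarrow> (complex^'n \<Rightarrow> complex) \<Rightarrow> bool" where
  "slice_holo M f \<longleftrightarrow> continuous_on R f \<and> (\<forall>z\<in>R. cmod (f z) \<le> M) \<and>
     (\<forall>i\<in>I. \<forall>z\<in>R. (\<lambda>w. f (upd i w z)) holomorphic_on ball 0 \<rho>)"

lemma taylor_coeff_sums:
  assumes f: "slice_holo M f" and i: "i \<in> I" and z: "z \<in> R"
  shows "(\<lambda>k. (z $ i) ^ k * taylor_coeff i k f z) sums f z"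
proof -
  have "(\<lambda>w. f (upd i w z)) holomorphic_on ball 0 \<rho>" using assms by (simp add: slice_holo_def)
  from holomorphic_power_series[OF this, of "z $ i"] show ?thesis
    using R_bound[OF z i] by (simp add: taylor_coeff_def mult.commute)
qed

lemma slice_holo_taylor_coeff:
  assumes f: "slice_holo M f" and i: "i \<in> I"
  shows "slice_holo (M / \<rho> ^ k) (taylor_coeff i k f)"
proof -
  \<comment> \<open>The averages are evaluated at the fixed point \<open>\<rho>/2\<close> instead of
    \<open>z $ i\<close>, so that the power can be divided out and the error decays like
    \<open>(1/2) ^ N\<close> uniformly in \<open>z\<close>.\<close>
  define F where "F N z = unity_avg (Suc (k + N)) k (\<lambda>w. f (upd i w z)) (of_real (\<rho>/2)) / of_real (\<rho>/2) ^ k" for N z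
  have contf: "continuous_on R f" using f by (simp add: slice_holo_def)
  have hol: "(\<lambda>w. f (upd j w z)) holomorphic_on ball 0 \<rho>" if "z \<in> R" "j \<in> I" for j z
    using f that by (simp add: slice_holo_def)
  have bd: "cmod (f (upd i w z)) \<le> M" if "z \<in> R" "w \<in> ball 0 \<rho>" for w z
    using f that R_upd[OF that(1) i, of w] by (simp add: slice_holo_def)
  have small: "cmod (unity_root N m * of_real (\<rho>/2)) < \<rho>" for N m
    using \<rho> by (simp add: norm_mult)
  have err: "cmod (F N z - taylor_coeff i k f z) \<le> (2 * M / (\<rho>/2) ^ k) * (1/2) ^ N" if z: "z \<in> R" for N z
  proof -
    have M0: "M \<ge> 0" using bd[OF z, of 0] \<rho> norm_ge_zero by (metis centre_in_ball order_trans)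
    have h: "(\<lambda>w. f (upd i w z)) holomorphic_on ball 0 \<rho>" using hol z i by blast
    have r2: "cmod (of_real (\<rho>/2)) / \<rho> = 1/2" unfolding norm_of_real using \<rho> by simp
    have "cmod (unity_avg (Suc (k+N)) k (\<lambda>w. f (upd i w z)) (of_real (\<rho>/2)) - taylor_coeff i k f z * of_real (\<rho>/2) ^ k)
      \<le> M * (cmod (of_real (\<rho>/2)) / \<rho>) ^ Suc (k+N) / (1 - cmod (of_real (\<rho>/2)) / \<rho>)"
      unfolding taylor_coeff_def
      by (rule unity_avg_approx[OF h bd[OF z]]) (use \<rho> in auto)
    also have "\<dots> = M * (1/2) ^ (k + N)" unfolding r2 by simp
    also have "\<dots> \<le> 2 * M * (1/2) ^ N"
    proof -
      have "M * (1/2) ^ (k + N) \<le> M * (1/2) ^ N" by (intro mult_left_mono power_decreasing M0) auto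
      also have "\<dots> \<le> 2 * M * (1/2) ^ N" using M0 by simp
      finally show ?thesis .
    qed
    finally have *: "cmod (unity_avg (Suc (k+N)) k (\<lambda>w. f (upd i w z)) (of_real (\<rho>/2)) - taylor_coeff i k f z * of_real (\<rho>/2) ^ k) \<le> 2 * M * (1/2) ^ N" .
    have pk: "of_real (\<rho>/2) ^ k \<noteq> (0::complex)" using \<rho> by simp
    then have "F N z - taylor_coeff i k f z = (unity_avg (Suc (k+N)) k (\<lambda>w. f (upd i w z)) (of_real (\<rho>/2)) - taylor_coeff i k f z * of_real (\<rho>/2) ^ k) / of_real (\<rho>/2) ^ k"
      unfolding F_def by (simp only: diff_divide_distrib nonzero_mult_div_cancel_right[OF pk] simp_thms)
    then have "cmod (F N z - taylor_coeff i k f z) \<le> 2 * M * (1/2) ^ N / (\<rho>/2) ^ k"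
      using * \<rho> by (simp add: norm_divide norm_power divide_right_mono)
    then show ?thesis by simp
  qed
  have lim: "uniform_limit R F (taylor_coeff i k f) sequentially"
  proof (rule uniform_limitI)
    fix e :: real assume "e > 0"
    have "(\<lambda>N. (2 * M / (\<rho>/2) ^ k) * (1/2) ^ N) \<longlonglongrightarrow> (2 * M / (\<rho>/2) ^ k) * 0"
      by (intro tendsto_mult_left LIMSEQ_power_zero) simp
    then have "\<forall>\<^sub>F N in sequentially. (2 * M / (\<rho>/2) ^ k) * (1/2) ^ N < e"
      using \<open>e > 0\<close> by (intro order_tendstoD(2)) auto
    then show "\<forall>\<^sub>F N in sequentially. \<forall>z\<in>R. dist (F N z) (taylor_coeff i k f z) < e"
      by (rule eventually_mono) (auto simp: dist_norm intro: order_le_less_trans[OF err])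
  qed
  have contF: "continuous_on R (F N)" for N
  proof -
    have "continuous_on R (\<lambda>z. f (upd i (unity_root N' m * of_real (\<rho>/2)) z))" for N' m
      by (rule continuous_on_compose2[OF contf continuous_upd]) (use R_upd[OF _ i small] in blast)
    then show ?thesis unfolding F_def unity_avg_def using \<rho> by (intro continuous_intros) (auto simp del: of_nat_Suc)
  qed
  have holF: "(\<lambda>w. F N (upd j w z)) holomorphic_on ball 0 \<rho>" if z: "z \<in> R" and j: "j \<in> I" for N z j
  proof (cases "j = i")
    case True
    then show ?thesis by (simp add: F_def)
  next
    case False
    have "(\<lambda>w. f (upd i c (upd j w z))) holomorphic_on ball 0 \<rho>" if c: "cmod c < \<rho>" for c
    proof -
      have "(\<lambda>w. f (upd j w (upd i c z))) holomorphic_on ball 0 \<rho>"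
        using R_upd[OF z i c] hol j by blast
      then show ?thesis using False by (simp add: upd_commute)
    qed
    then show ?thesis unfolding F_def unity_avg_def using small \<rho>
      by (intro holomorphic_intros) auto
  qed
  show ?thesis unfolding slice_holo_def
  proof (intro conjI ballI)
    show "continuous_on R (taylor_coeff i k f)"
      by (rule uniform_limit_theorem[OF _ lim]) (use contF in auto)
    show "cmod (taylor_coeff i k f z) \<le> M / \<rho> ^ k" if "z \<in> R" for z
      unfolding taylor_coeff_def by (rule norm_taylor_coeff_le[OF hol[OF that i] \<rho> bd[OF that]])
    fix j z assume j: "j \<in> I" and z: "z \<in> R"
    show "(\<lambda>w. taylor_coeff i k f (upd j w z)) holomorphic_on ball 0 \<rho>"
    proof (rule holomorphic_uniform_sequence[where f="\<lambda>N w. F N (upd j w z)"])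
      fix x :: complex assume "x \<in> ball 0 \<rho>"
      then obtain d where d: "d > 0" "cball x d \<subseteq> ball 0 \<rho>" by (metis open_ball open_contains_cball)
      have "uniform_limit (cball x d) (\<lambda>N w. F N (upd j w z)) (\<lambda>w. taylor_coeff i k f (upd j w z)) sequentially"
      proof (rule uniform_limitI)
        fix e :: real assume "e > 0"
        with lim have "\<forall>\<^sub>F N in sequentially. \<forall>z\<in>R. dist (F N z) (taylor_coeff i k f z) < e"
          by (rule uniform_limitD)
        then show "\<forall>\<^sub>F N in sequentially. \<forall>w\<in>cball x d. dist (F N (upd j w z)) (taylor_coeff i k f (upd j w z)) < e"
        proof (rule eventually_mono)
          fix N assume N: "\<forall>z\<in>R. dist (F N z) (taylor_coeff i k f z) < e"
          show "\<forall>w\<in>cball x d. dist (F N (upd j w z)) (taylor_coeff i k f (upd j w z)) < e"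
          proof
            fix w assume "w \<in> cball x d"
            then have "cmod w < \<rho>" using d(2) by auto
            then show "dist (F N (upd j w z)) (taylor_coeff i k f (upd j w z)) < e" using N R_upd[OF z j] by blast
          qed
        qed
      qed
      then show "\<exists>d. 0 < d \<and> cball x d \<subseteq> ball 0 \<rho> \<and> uniform_limit (cball x d) (\<lambda>N w. F N (upd j w z))
          (\<lambda>w. taylor_coeff i k f (upd j w z)) sequentially" using d by blast
    qed (use holF j z in auto)
  qed
qed

lemma slice_holo_taylor_coeffs:
  assumes "slice_holo M f" "set l \<subseteq> I" "distinct l"
  shows "slice_holo (M / (\<Prod>i\<in>set l. \<rho> ^ a i)) (taylor_coeffs l a f)"
  using assms
proof (induction l arbitrary: f M)
  case (Cons i l)
  from Cons.IH[OF slice_holo_taylor_coeff[OF Cons.prems(1), of i "a i"]] show ?case using Cons.prems by simp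
qed simp

text \<open>Summation proceeds one variable at a time; each is a geometric series of ratio
  \<open>1/2\<close> and costs a factor 2. The induction divides by \<open>cmod (z $ i) ^ k\<close>,
  hence the nonzero coordinates.\<close>

lemma norm_le_of_taylor_coeffs:
  assumes "slice_holo M f" "set l \<subseteq> I" "distinct l" and z: "z \<in> R" "\<And>i. i \<in> set l \<Longrightarrow> z $ i \<noteq> 0"
    and "\<And>a. (\<Prod>i\<in>set l. cmod (z $ i) ^ a i) * cmod (taylor_coeffs l a f z) \<le> \<Psi> * (\<Prod>i\<in>set l. (1/2) ^ a i)"
  shows "cmod (f z) \<le> 2 ^ length l * \<Psi>"
  using assms(1,2,3,5,6)
proof (induction l arbitrary: f M \<Psi>)
  case (Cons i l)
  have i: "i \<in> I" "i \<notin> set l" "z $ i \<noteq> 0" using Cons.prems by auto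
  have k: "cmod ((z $ i) ^ k * taylor_coeff i k f z) \<le> 2 ^ length l * \<Psi> * (1/2) ^ k" for k
  proof -
    have zk: "cmod (z $ i) ^ k > 0" using i by simp
    have "cmod (taylor_coeff i k f z) \<le> 2 ^ length l * (\<Psi> * (1/2) ^ k / cmod (z $ i) ^ k)"
    proof (rule Cons.IH[OF slice_holo_taylor_coeff[OF Cons.prems(1) i(1)]])
      fix a
      \<comment> \<open>The hypothesis will be used at \<open>a(i := k)\<close>; since
        \<open>i\<close> does not occur in \<open>l\<close>, the inner coefficients do not see the
        change.\<close>
      have "taylor_coeffs l (a(i := k)) (taylor_coeff i k f) = taylor_coeffs l a (taylor_coeff i k f)"
        by (rule taylor_coeffs_cong) (use i in auto)
      moreover have "(\<Prod>j\<in>set l. cmod (z $ j) ^ (a(i := k)) j) = (\<Prod>j\<in>set l. cmod (z $ j) ^ a j)"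
        "(\<Prod>j\<in>set l. (1/2) ^ (a(i := k)) j) = (\<Prod>j\<in>set l. (1/2::real) ^ a j)"
        by (auto intro!: prod.cong simp: i)
      ultimately have "cmod (z $ i) ^ k * (\<Prod>j\<in>set l. cmod (z $ j) ^ a j) * cmod (taylor_coeffs l a (taylor_coeff i k f) z)
          \<le> \<Psi> * ((1/2) ^ k * (\<Prod>j\<in>set l. (1/2) ^ a j))"
        using Cons.prems(5)[of "a(i := k)"] i by (simp del: fun_upd_apply add: fun_upd_same)
      then show "(\<Prod>j\<in>set l. cmod (z $ j) ^ a j) * cmod (taylor_coeffs l a (taylor_coeff i k f) z)
        \<le> \<Psi> * (1/2) ^ k / cmod (z $ i) ^ k * (\<Prod>j\<in>set l. (1/2) ^ a j)"
        using zk by (simp add: field_simps)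
    qed (use Cons.prems in auto)
    then show ?thesis using zk by (simp add: norm_mult norm_power field_simps)
  qed
  have geo: "(\<lambda>k. 2 ^ length l * \<Psi> * (1/2) ^ k) sums (2 ^ length l * \<Psi> * (1 / (1 - 1/2)))"
    by (intro sums_mult geometric_sums) simp
  have "cmod (suminf (\<lambda>k. (z $ i) ^ k * taylor_coeff i k f z)) \<le> suminf (\<lambda>k. 2 ^ length l * \<Psi> * (1/2) ^ k)"
    by (rule norm_suminf_le) (use k geo sums_summable in blast)+
  then show ?case using taylor_coeff_sums[OF Cons.prems(1) i(1) z(1)] geo by (simp add: sums_iff)
next
  case Nil
  then show ?case by simp
qed

lemma borel_measurable_slice_holo:
  assumes "continuous_on R f"
  shows "(\<lambda>z. ennreal ((cmod (f z))\<^sup>2) * indicator R z) \<in> borel_measurable borel"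
proof -
  have "(\<lambda>z. indicator R z *\<^sub>R f z) \<in> borel_measurable borel"
    by (rule borel_measurable_continuous_on_indicator[OF _ assms]) (use open_R in auto)
  then have "(\<lambda>z. ennreal ((cmod (indicator R z *\<^sub>R f z))\<^sup>2)) \<in> borel_measurable borel" by measurable
  moreover have "ennreal ((cmod (indicator R z *\<^sub>R f z))\<^sup>2) = ennreal ((cmod (f z))\<^sup>2) * indicator R z" for z
    by (simp split: split_indicator)
  ultimately show ?thesis by (simp only:)
qed

text \<open>Values in \<open>ennreal\<close> admit points with \<open>\<phi> = -\<infinity>\<close>.
  Vanishing off \<open>R\<close> lets the integrals run over the whole space, on which the rotations
  act.\<close>

definition torus_weight :: "(complex^'n \<Rightarrow> ennreal) \<Rightarrow> bool" where
  "torus_weight w \<longleftrightarrow> w \<in> borel_measurable borel \<and> (\<forall>z. z \<notin> R \<longrightarrow> w z = 0) \<and>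
     (\<forall>c. (\<forall>j. cmod (c j) = 1) \<longrightarrow> (\<forall>j. j \<notin> I \<longrightarrow> c j = 1) \<longrightarrow> (\<forall>z. w (dscale c z) = w z))"

text \<open>Rotations in the variable \<open>i\<close> preserve both Lebesgue measure and
  \<open>w\<close>, so by the Cauchy-Schwarz inequality averaging over them does not increase the
  weighted integral. The averages tend pointwise to the Taylor term, and Fatou's lemma passes to the
  limit.\<close>

lemma nn_integral_taylor_coeff_le:
  assumes f: "slice_holo M f" and i: "i \<in> I" and w: "torus_weight w"
  shows "(\<integral>\<^sup>+z. ennreal ((cmod ((z $ i) ^ k * taylor_coeff i k f z))\<^sup>2) * w z \<partial>lborel)
     \<le> (\<integral>\<^sup>+z. ennreal ((cmod (f z))\<^sup>2) * w z \<partial>lborel)"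
proof -
  have [measurable]: "w \<in> borel_measurable borel" and w0: "z \<notin> R \<Longrightarrow> w z = 0" for z
    using w by (auto simp: torus_weight_def)
  define D where "D N m = dscale (\<lambda>j. if j = i then unity_root N m else 1)" for N m
  have Dupd: "upd i (unity_root N m * z $ i) z = D N m z" for N m z
    by (simp add: D_def vec_eq_iff)
  have wD: "w (D N m z) = w z" for N m z
    using w i unfolding torus_weight_def D_def by (auto split: if_splits)
  have DR: "D N m z \<in> R" if "z \<in> R" for N m z
    unfolding Dupd[symmetric] using R_upd[OF that i] R_bound[OF that i] by (simp add: norm_mult)
  define G where "G n z = unity_avg (Suc (k + n)) k (\<lambda>v. f (upd i v z)) (z $ i)" for n z
  define B where "B = (\<integral>\<^sup>+z. ennreal ((cmod (f z))\<^sup>2) * w z \<partial>lborel)"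
  have contf: "continuous_on R f" using f by (simp add: slice_holo_def)
  have f_meas [measurable]: "(\<lambda>z. ennreal ((cmod (f z))\<^sup>2) * w z) \<in> borel_measurable borel"
  proof -
    have "(\<lambda>z. (ennreal ((cmod (f z))\<^sup>2) * indicator R z) * w z) \<in> borel_measurable borel"
      using borel_measurable_slice_holo[OF contf] by measurable
    moreover have "(ennreal ((cmod (f z))\<^sup>2) * indicator R z) * w z = ennreal ((cmod (f z))\<^sup>2) * w z" for z
      using w0[of z] by (simp split: split_indicator)
    ultimately show ?thesis by simp
  qed
  have contG: "continuous_on R (G n)" for n
  proof -
    have "continuous_on R (\<lambda>z. f (upd i (unity_root N m * z $ i) z))" for N m
      unfolding Dupd
      by (rule continuous_on_compose2[OF contf]) (use DR in \<open>auto simp: D_def continuous_dscale\<close>)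
    then show ?thesis unfolding G_def unity_avg_def by (intro continuous_intros) (auto simp del: of_nat_Suc)
  qed
  have Gle: "(\<integral>\<^sup>+z. ennreal ((cmod (G n z))\<^sup>2) * w z \<partial>lborel) \<le> B" for n
  proof -
    define N where "N = Suc (k + n)"
    have N: "N > 0" by (simp add: N_def)
    have "ennreal ((cmod (G n z))\<^sup>2) * w z \<le> (\<Sum>m<N. ennreal (1/N) * (ennreal ((cmod (f (D N m z)))\<^sup>2) * w (D N m z)))" for z
    proof -
      have "cmod (G n z) \<le> (\<Sum>m<N. cmod (f (D N m z))) / N"
        unfolding G_def unity_avg_def N_def[symmetric] Dupd norm_divide norm_of_nat
        by (intro divide_right_mono order_trans[OF norm_sum] sum_mono)
           (auto simp: norm_divide norm_power)
      then have "(cmod (G n z))\<^sup>2 \<le> ((\<Sum>m<N. cmod (f (D N m z))) / N)\<^sup>2" by (rule power_mono) simp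
      also have "\<dots> = (\<Sum>m<N. cmod (f (D N m z)) * 1)\<^sup>2 / (real N)\<^sup>2" by (simp add: power_divide)
      also have "\<dots> \<le> (\<Sum>m<N. (cmod (f (D N m z)))\<^sup>2) * (\<Sum>m<N. 1\<^sup>2) / (real N)\<^sup>2"
        by (intro divide_right_mono Cauchy_Schwarz_ineq_sum) auto
      also have "\<dots> = (\<Sum>m<N. 1/N * (cmod (f (D N m z)))\<^sup>2)"
        using N by (simp add: sum_divide_distrib sum_distrib_right power2_eq_square)
      finally have "ennreal ((cmod (G n z))\<^sup>2) \<le> (\<Sum>m<N. ennreal (1/N * (cmod (f (D N m z)))\<^sup>2))"
        by (subst sum_ennreal) (auto intro: ennreal_leI)
      then have "ennreal ((cmod (G n z))\<^sup>2) * w z \<le> (\<Sum>m<N. ennreal (1/N * (cmod (f (D N m z)))\<^sup>2)) * w z"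
        by (rule mult_right_mono) simp
      also have "\<dots> = (\<Sum>m<N. ennreal (1/N) * (ennreal ((cmod (f (D N m z)))\<^sup>2) * w (D N m z)))"
        unfolding sum_distrib_right wD mult.assoc[symmetric]
        by (intro sum.cong refl arg_cong2[where f="(*)"] ennreal_mult') simp
      finally show ?thesis .
    qed
    then have "(\<integral>\<^sup>+z. ennreal ((cmod (G n z))\<^sup>2) * w z \<partial>lborel) \<le>
       (\<integral>\<^sup>+z. (\<Sum>m<N. ennreal (1/N) * (ennreal ((cmod (f (D N m z)))\<^sup>2) * w (D N m z))) \<partial>lborel)"
      by (intro nn_integral_mono) auto
    also have "\<dots> = (\<Sum>m<N. ennreal (1/N) * (\<integral>\<^sup>+z. ennreal ((cmod (f (D N m z)))\<^sup>2) * w (D N m z) \<partial>lborel))"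
    proof -
      have [measurable]: "(\<lambda>z. ennreal ((cmod (f (D N m z)))\<^sup>2) * w (D N m z)) \<in> borel_measurable borel" for m
        using measurable_compose[OF borel_measurable_dscale f_meas] by (simp add: D_def)
      show ?thesis by (subst nn_integral_sum) (auto simp: nn_integral_cmult)
    qed
    also have "\<dots> = (\<Sum>m<N. ennreal (1/N) * B)"
    proof (rule sum.cong[OF refl])
      fix m
      have "(\<integral>\<^sup>+z. ennreal ((cmod (f (D N m z)))\<^sup>2) * w (D N m z) \<partial>lborel) = B"
        unfolding B_def D_def by (rule nn_integral_dscale_unit) (auto simp: f_meas)
      then show "ennreal (1/N) * (\<integral>\<^sup>+z. ennreal ((cmod (f (D N m z)))\<^sup>2) * w (D N m z) \<partial>lborel) = ennreal (1/N) * B" by simp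
    qed
    also have "\<dots> = (\<Sum>m<N. ennreal (1/N)) * B" by (rule sum_distrib_right[symmetric])
    also have "(\<Sum>m<N. ennreal (1/N)) = ennreal (\<Sum>m<N. 1/N)" by (rule sum_ennreal) simp
    also have "\<dots> * B = B" using N by simp
    finally show ?thesis .
  qed
  \<comment> \<open>The weight is moved into the measure because \<open>w\<close> may be
    \<infinity>: multiplication by \<infinity> is discontinuous at 0 in \<open>ennreal\<close>, so
    the products with \<open>w\<close> need not converge pointwise.\<close>
  define \<mu> where "\<mu> = density lborel w"
  define u where "u n z = ennreal ((cmod (G n z))\<^sup>2) * indicator R z" for n z
  have u_meas: "u n \<in> borel_measurable borel" for n
    unfolding u_def[abs_def] by (rule borel_measurable_slice_holo[OF contG])
  have lim: "(\<lambda>n. u n z) \<longlonglongrightarrow> ennreal ((cmod ((z $ i) ^ k * taylor_coeff i k f z))\<^sup>2) * indicator R z" for z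
  proof (cases "z \<in> R")
    case True
    have h: "(\<lambda>w. f (upd i w z)) holomorphic_on ball 0 \<rho>" using f True i by (simp add: slice_holo_def)
    have bd: "cmod (f (upd i v z)) \<le> M" if "v \<in> ball 0 \<rho>" for v
      using f that R_upd[OF True i, of v] by (simp add: slice_holo_def)
    define q where "q = cmod (z $ i) / \<rho>"
    have q: "0 \<le> q" "q < 1" using R_bound[OF True i] \<rho> by (auto simp: q_def)
    have nle: "cmod (G n z - (z $ i) ^ k * taylor_coeff i k f z) \<le> M * q ^ Suc (k + n) / (1 - q)" for n
      using unity_avg_approx[OF h bd R_bound[OF True i], of k "Suc (k + n)"]
      by (simp add: G_def q_def taylor_coeff_def mult.commute)
    have "(\<lambda>n. M * q ^ Suc (k + n) / (1 - q)) \<longlonglongrightarrow> M * 0 / (1 - q)"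
    proof (intro tendsto_intros)
      show "(\<lambda>n. q ^ Suc (k + n)) \<longlonglongrightarrow> 0"
        using LIMSEQ_ignore_initial_segment[OF LIMSEQ_power_zero[of q], of "Suc k"] q by (simp add: add_ac)
    qed (use q in simp)
    then have "(\<lambda>n. M * q ^ Suc (k + n) / (1 - q)) \<longlonglongrightarrow> 0" by (simp only: mult_zero_right div_0)
    with eventuallyI[of _ sequentially, OF nle] have "(\<lambda>n. G n z - (z $ i) ^ k * taylor_coeff i k f z) \<longlonglongrightarrow> 0"
      by (rule Lim_null_comparison)
    then have "(\<lambda>n. G n z) \<longlonglongrightarrow> (z $ i) ^ k * taylor_coeff i k f z" by (simp add: LIM_zero_iff)
    then show ?thesis using True unfolding u_def by (auto intro!: tendsto_ennrealI tendsto_intros)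
  qed (simp add: u_def)
  have "(\<integral>\<^sup>+z. ennreal ((cmod ((z $ i) ^ k * taylor_coeff i k f z))\<^sup>2) * w z \<partial>lborel)
      = (\<integral>\<^sup>+z. w z * (ennreal ((cmod ((z $ i) ^ k * taylor_coeff i k f z))\<^sup>2) * indicator R z) \<partial>lborel)"
    by (intro nn_integral_cong) (auto simp: w0 mult.commute split: split_indicator)
  also have "\<dots> = (\<integral>\<^sup>+z. ennreal ((cmod ((z $ i) ^ k * taylor_coeff i k f z))\<^sup>2) * indicator R z \<partial>\<mu>)"
    unfolding \<mu>_def
  proof (rule nn_integral_density[symmetric])
    show "(\<lambda>z. ennreal ((cmod ((z $ i) ^ k * taylor_coeff i k f z))\<^sup>2) * indicator R z) \<in> borel_measurable lborel"
      by (rule borel_measurable_LIMSEQ_order[where u=u, OF lim]) (simp only: measurable_lborel2 u_meas)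
  qed auto
  also have "\<dots> = (\<integral>\<^sup>+z. liminf (\<lambda>n. u n z) \<partial>\<mu>)"
    using lim_imp_Liminf[OF sequentially_bot lim] by (intro nn_integral_cong) simp
  also have "\<dots> \<le> liminf (\<lambda>n. \<integral>\<^sup>+z. u n z \<partial>\<mu>)"
    by (rule nn_integral_liminf) (use u_meas in \<open>auto simp: \<mu>_def\<close>)
  also have "\<dots> \<le> B"
  proof -
    have uB: "(\<integral>\<^sup>+z. u n z \<partial>\<mu>) \<le> B" for n
    proof -
      have "(\<integral>\<^sup>+z. u n z \<partial>\<mu>) = (\<integral>\<^sup>+z. w z * u n z \<partial>lborel)"
        unfolding \<mu>_def by (rule nn_integral_density) (use u_meas in auto)
      also have "\<dots> = (\<integral>\<^sup>+z. ennreal ((cmod (G n z))\<^sup>2) * w z \<partial>lborel)"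
        by (intro nn_integral_cong) (auto simp: u_def w0 mult.commute split: split_indicator)
      finally show ?thesis using Gle by simp
    qed
    have "liminf (\<lambda>n. \<integral>\<^sup>+z. u n z \<partial>\<mu>) \<le> limsup (\<lambda>n. \<integral>\<^sup>+z. u n z \<partial>\<mu>)"
      by (rule Liminf_le_Limsup[OF sequentially_bot])
    also have "\<dots> \<le> B" by (rule Limsup_bounded[OF eventuallyI[OF uB]])
    finally show ?thesis .
  qed
  finally show ?thesis by (simp add: B_def)
qed

lemma nn_integral_taylor_coeffs_le:
  assumes "slice_holo M f" "set l \<subseteq> I" "distinct l" "torus_weight w"
  shows "(\<integral>\<^sup>+z. ennreal ((cmod ((\<Prod>i\<in>set l. (z $ i) ^ a i) * taylor_coeffs l a f z))\<^sup>2) * w z \<partial>lborel)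
     \<le> (\<integral>\<^sup>+z. ennreal ((cmod (f z))\<^sup>2) * w z \<partial>lborel)"
  using assms
proof (induction l arbitrary: f M w)
  case (Cons i l)
  have i: "i \<in> I" "i \<notin> set l" using Cons.prems by auto
  \<comment> \<open>The squared modulus of the power of \<open>z $ i\<close> is itself invariant
    under rotations and can be absorbed into the weight while the remaining variables are
    treated.\<close>
  let ?w = "\<lambda>z. ennreal ((cmod (z $ i ^ a i))\<^sup>2) * w z"
  have [measurable]: "(\<lambda>z. z $ i) \<in> borel_measurable (borel :: (complex^'n) measure)"
    by (intro borel_measurable_continuous_onI continuous_intros)
  have w': "torus_weight ?w" using Cons.prems(4) by (auto simp: torus_weight_def norm_mult power_mult_distrib norm_power)
  have "(\<integral>\<^sup>+z. ennreal ((cmod ((\<Prod>j\<in>set (i # l). (z $ j) ^ a j) * taylor_coeffs (i # l) a f z))\<^sup>2) * w z \<partial>lborel)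
     = (\<integral>\<^sup>+z. ennreal ((cmod ((\<Prod>j\<in>set l. (z $ j) ^ a j) * taylor_coeffs l a (taylor_coeff i (a i) f) z))\<^sup>2) * ?w z \<partial>lborel)"
    using i by (intro nn_integral_cong) (simp add: norm_mult power_mult_distrib ennreal_mult' mult_ac)
  also have "\<dots> \<le> (\<integral>\<^sup>+z. ennreal ((cmod (taylor_coeff i (a i) f z))\<^sup>2) * ?w z \<partial>lborel)"
    by (rule Cons.IH[OF slice_holo_taylor_coeff[OF Cons.prems(1) i(1)] _ _ w']) (use Cons.prems in auto)
  also have "\<dots> = (\<integral>\<^sup>+z. ennreal ((cmod ((z $ i) ^ a i * taylor_coeff i (a i) f z))\<^sup>2) * w z \<partial>lborel)"
    by (intro nn_integral_cong) (simp add: norm_mult power_mult_distrib ennreal_mult' mult_ac)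
  also have "\<dots> \<le> (\<integral>\<^sup>+z. ennreal ((cmod (f z))\<^sup>2) * w z \<partial>lborel)"
    by (rule nn_integral_taylor_coeff_le[OF Cons.prems(1) i(1) Cons.prems(4)])
  finally show ?case .
qed simp

end

section \<open>Domination by finitely many monomials\<close>

lemma Dickson_finite_basis:
  fixes S :: "('n \<Rightarrow> nat) set"
  assumes "finite X"
  shows "\<exists>A\<subseteq>S. finite A \<and> (\<forall>a\<in>S. \<exists>b\<in>A. \<forall>i\<in>X. b i \<le> a i)"
  using assms
proof (induction X arbitrary: S)
  case empty
  show ?case
  proof (cases "S = {}")
    case False
    then obtain s where "s \<in> S" by auto
    then show ?thesis by (intro exI[of _ "{s}"]) auto
  qed auto
next
  case (insert x X)
  \<comment> \<open>\<open>A\<close> is a basis when the exponent at \<open>x\<close> is ignored.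
    That exponent is at most \<open>N\<close> on \<open>A\<close>, so every \<open>a\<close> with
    \<open>a x > N\<close> lies above an element of \<open>A\<close> in all of
    \<open>insert x X\<close>; the finitely many slices \<open>a x = k\<close> with
    \<open>k \<le> N\<close> get bases \<open>B k\<close> of their own.\<close>
  obtain A where A: "A \<subseteq> S" "finite A" "\<And>a. a \<in> S \<Longrightarrow> \<exists>b\<in>A. \<forall>i\<in>X. b i \<le> a i"
    using insert.IH[of S] by blast
  obtain N where N: "\<And>b. b \<in> A \<Longrightarrow> b x \<le> N"
    using finite_nat_set_iff_bounded_le[of "(\<lambda>b. b x) ` A"] A(2) by auto
  have "\<forall>k. \<exists>B. B \<subseteq> {a\<in>S. a x = k} \<and> finite B \<and> (\<forall>a\<in>{a\<in>S. a x = k}. \<exists>b\<in>B. \<forall>i\<in>X. b i \<le> a i)"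
    using insert.IH by blast
  from choice[OF this] obtain B where B0: "\<forall>k. B k \<subseteq> {a\<in>S. a x = k} \<and> finite (B k) \<and>
      (\<forall>a\<in>{a\<in>S. a x = k}. \<exists>b\<in>B k. \<forall>i\<in>X. b i \<le> a i)" by blast
  then have B: "\<And>k. B k \<subseteq> {a\<in>S. a x = k}" "\<And>k. finite (B k)"
    "\<And>k a. a \<in> S \<Longrightarrow> a x = k \<Longrightarrow> \<exists>b\<in>B k. \<forall>i\<in>X. b i \<le> a i"
    by simp_all
  show ?case
  proof (intro exI[of _ "A \<union> (\<Union>k\<in>{..N}. B k)"] conjI ballI)
    show "A \<union> (\<Union>k\<in>{..N}. B k) \<subseteq> S" using A(1) B(1) by blast
    show "finite (A \<union> (\<Union>k\<in>{..N}. B k))" using A B by auto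
    fix a assume a: "a \<in> S"
    show "\<exists>b\<in>A \<union> (\<Union>k\<in>{..N}. B k). \<forall>i\<in>insert x X. b i \<le> a i"
    proof (cases "a x \<le> N")
      case True
      obtain b where b: "b \<in> B (a x)" "\<forall>i\<in>X. b i \<le> a i" using B(3)[OF a refl] by auto
      then have "b x = a x" using B(1) by auto
      then show ?thesis using b True by (intro bexI[of _ b]) auto
    next
      case False
      obtain b where b: "b \<in> A" "\<forall>i\<in>X. b i \<le> a i" using A(3)[OF a] by auto
      then have "b x \<le> a x" using N[of b] False by simp
      then show ?thesis using b by (intro bexI[of _ b]) auto
    qed
  qed
qed

lemma taylor_coeffs_eq_off:
  fixes z z' :: "complex^'n"
  assumes eq: "\<And>j. j \<notin> set l \<Longrightarrow> z $ j = z' $ j"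
  shows "taylor_coeffs l a f z = taylor_coeffs l a f z'"
proof -
  have "taylor_coeffs l a f (\<chi> j. if j \<in> K then z $ j else z' $ j) = taylor_coeffs l a f z'"
    if "finite K" "K \<subseteq> set l" for K
    using that
  proof (induction K)
    case (insert i K)
    have "(\<chi> j. if j \<in> insert i K then z $ j else z' $ j) = upd i (z $ i) (\<chi> j. if j \<in> K then z $ j else z' $ j)"
      by (simp add: vec_eq_iff)
    then show ?case using insert by (simp add: taylor_coeffs_upd)
  qed (simp add: vec_nth_inverse)
  from this[of "set l"] have "taylor_coeffs l a f (\<chi> j. if j \<in> set l then z $ j else z' $ j) = taylor_coeffs l a f z'" by simp
  moreover have "(\<chi> j. if j \<in> set l then z $ j else z' $ j) = z" using eq by (simp add: vec_eq_iff)
  ultimately show ?thesis by simp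
qed

text \<open>\<open>A\<close> is a Dickson basis of the exponents whose coefficient is nonzero
  somewhere on \<open>R\<close>. If \<open>b \<le> a\<close> on \<open>I\<close> and all moduli are
  at most \<open>\<rho> / 2\<close>, the Cauchy bound for the term of exponent \<open>a\<close>
  splits into a multiple of the monomial of \<open>b\<close> and factors \<open>(1/2) ^ a i\<close>,
  which make the sum over all \<open>a\<close> converge.\<close>

lemma (in Reinhardt_slices) slice_holo_growth:
  assumes f: "slice_holo M f" and l: "set l = I" "distinct l" and M: "M \<ge> 0"
  obtains A C where "finite A" "C \<ge> 0" "\<And>a. a \<in> A \<Longrightarrow> \<exists>p\<in>R. taylor_coeffs l a f p \<noteq> 0"
    "\<And>z. z \<in> R \<Longrightarrow> \<forall>i\<in>I. z $ i \<noteq> 0 \<and> cmod (z $ i) \<le> \<rho> / 2 \<Longrightarrow>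
      cmod (f z) \<le> C * (\<Sum>a\<in>A. \<Prod>i\<in>I. cmod (z $ i) ^ a i)"
proof -
  define S where "S = {a. \<exists>p\<in>R. taylor_coeffs l a f p \<noteq> 0}"
  obtain A where A: "A \<subseteq> S" "finite A" "\<And>a. a \<in> S \<Longrightarrow> \<exists>b\<in>A. \<forall>i\<in>I. b i \<le> a i"
    using Dickson_finite_basis[of I S] by auto
  define c where "c b = M * (\<Prod>i\<in>I. (2 / \<rho>) ^ b i)" for b :: "'n \<Rightarrow> nat"
  have c0: "c b \<ge> 0" for b using M \<rho> by (auto simp: c_def intro!: mult_nonneg_nonneg prod_nonneg)
  define C where "C = 2 ^ length l * (\<Sum>b\<in>A. c b)"
  show thesis
  proof (rule that[of A C])
    show "C \<ge> 0" unfolding C_def by (intro mult_nonneg_nonneg sum_nonneg c0) auto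
    fix z assume z: "z \<in> R" and "\<forall>i\<in>I. z $ i \<noteq> 0 \<and> cmod (z $ i) \<le> \<rho> / 2"
    then have zi: "z $ i \<noteq> 0 \<and> cmod (z $ i) \<le> \<rho> / 2" if "i \<in> I" for i using that by blast
    define \<Psi> where "\<Psi> = (\<Sum>b\<in>A. c b * (\<Prod>i\<in>I. cmod (z $ i) ^ b i))"
    have \<Psi>0: "\<Psi> \<ge> 0" unfolding \<Psi>_def by (intro sum_nonneg mult_nonneg_nonneg prod_nonneg c0) auto
    have "cmod (f z) \<le> 2 ^ length l * \<Psi>"
    proof (rule norm_le_of_taylor_coeffs[OF f _ l(2) z])
      fix a
      show "(\<Prod>i\<in>set l. cmod (z $ i) ^ a i) * cmod (taylor_coeffs l a f z) \<le> \<Psi> * (\<Prod>i\<in>set l. (1 / 2) ^ a i)"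
      proof (cases "a \<in> S")
        case False
        then show ?thesis using z \<Psi>0 by (auto simp: S_def intro!: mult_nonneg_nonneg prod_nonneg)
      next
        case True
        then obtain b where b: "b \<in> A" "\<And>i. i \<in> I \<Longrightarrow> b i \<le> a i" using A(3) by blast
        have "cmod (taylor_coeffs l a f z) \<le> M / (\<Prod>i\<in>I. \<rho> ^ a i)"
          using slice_holo_taylor_coeffs[OF f _ l(2), of a] l z by (simp add: slice_holo_def)
        then have "(\<Prod>i\<in>I. cmod (z $ i) ^ a i) * cmod (taylor_coeffs l a f z)
           \<le> (\<Prod>i\<in>I. cmod (z $ i) ^ a i) * (M / (\<Prod>i\<in>I. \<rho> ^ a i))"
          by (intro mult_left_mono prod_nonneg) auto
        also have "\<dots> = M * (\<Prod>i\<in>I. (cmod (z $ i) / \<rho>) ^ a i)"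
          by (simp add: power_divide prod_dividef)
        also have "\<dots> \<le> M * (\<Prod>i\<in>I. (2 / \<rho>) ^ b i * cmod (z $ i) ^ b i * (1/2) ^ a i)"
        proof (intro mult_left_mono prod_mono M conjI)
          fix i assume i: "i \<in> I"
          define q where "q = cmod (z $ i) / \<rho>"
          have q: "0 \<le> q" "q \<le> 1/2" using zi[OF i] \<rho> by (auto simp: q_def divide_simps)
          obtain k where k: "a i = b i + k" using b(2)[OF i] le_Suc_ex by blast
          have "q ^ a i \<le> q ^ b i * (1/2) ^ k"
            unfolding k power_add using q by (intro mult_left_mono power_mono) auto
          also have "\<dots> = (2 / \<rho>) ^ b i * cmod (z $ i) ^ b i * (1/2) ^ a i"
            unfolding k power_add q_def by (simp add: power_divide)
          finally show "(cmod (z $ i) / \<rho>) ^ a i \<le> (2 / \<rho>) ^ b i * cmod (z $ i) ^ b i * (1/2) ^ a i"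
            by (simp add: q_def)
          show "0 \<le> (cmod (z $ i) / \<rho>) ^ a i" using \<rho> by simp
        qed
        also have "\<dots> = c b * (\<Prod>i\<in>I. cmod (z $ i) ^ b i) * (\<Prod>i\<in>I. (1/2) ^ a i)"
          by (simp add: c_def prod.distrib mult.assoc)
        also have "\<dots> \<le> \<Psi> * (\<Prod>i\<in>I. (1/2) ^ a i)"
        proof (rule mult_right_mono)
          show "c b * (\<Prod>i\<in>I. cmod (z $ i) ^ b i) \<le> \<Psi>" unfolding \<Psi>_def
            by (rule member_le_sum[OF b(1)]) (auto intro!: mult_nonneg_nonneg prod_nonneg c0 A)
        qed (auto intro: prod_nonneg)
        finally show ?thesis using l by simp
      qed
    qed (use zi l in auto)
    also have "2 ^ length l * \<Psi> \<le> C * (\<Sum>a\<in>A. \<Prod>i\<in>I. cmod (z $ i) ^ a i)"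
    proof -
      have "\<Psi> \<le> (\<Sum>b\<in>A. (\<Sum>b\<in>A. c b) * (\<Prod>i\<in>I. cmod (z $ i) ^ b i))" unfolding \<Psi>_def
        by (intro sum_mono mult_right_mono member_le_sum prod_nonneg c0 A) auto
      then show ?thesis by (simp add: C_def sum_distrib_left[symmetric] mult.assoc)
    qed
    finally show "cmod (f z) \<le> C * (\<Sum>a\<in>A. \<Prod>i\<in>I. cmod (z $ i) ^ a i)" .
  qed (use A in \<open>auto simp: S_def\<close>)
qed

subsection \<open>Linear growth of integrable convex weights\<close>

lemma exp_ereal_neg2_ge: "x \<le> ereal A \<Longrightarrow> ennreal (exp (- 2 * A)) \<le> exp_ereal (- 2 * x)"
  by (cases x) (auto simp: exp_ereal_def ennreal_leI)

text \<open>\<open>H\<close> is \<open>\<phi>\<close> minus a linear form of slopes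
  \<open>a i + 1\<close>. Translating a block \<open>A0\<close> by the fraction \<open>s\<close> of
  the displacement from \<open>\<xi>\<close> to \<open>y\<close> and using convexity gives a piece
  whose mass is at least a constant times \<open>exp (- 2 * ((1 - s) * C0 + s * H))\<close>. One
  such piece bounds \<open>H\<close> from below; many disjoint ones force \<open>H > C0 + 1\<close>
  as soon as one coordinate is deep enough; convexity along a segment turns this into linear growth.
  Integrability is assumed only over \<open>W\<close>, with the other coordinates near
  \<open>p\<close>, while \<open>y\<close> may take any values of them within
  \<open>\<delta>\<close> of \<open>\<xi>\<close>.\<close>

lemma toric_coercive:
  fixes \<xi> :: "real^'n" and p :: "complex^'n" and a :: "'n \<Rightarrow> nat"
  assumes tor: "toric_psh_on_polydisk r \<phi>" and \<eta>: "\<eta> > 0" and \<delta>: "\<delta> > 0"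
    and dom: "\<And>t i. (\<And>i. i \<in> I \<Longrightarrow> t $ i \<le> \<xi> $ i) \<Longrightarrow> (\<And>j. j \<notin> I \<Longrightarrow> \<bar>t $ j - \<xi> $ j\<bar> < 3 * \<delta>) \<Longrightarrow> exp (t $ i) < r"
    and C0: "\<And>t. (\<And>i. i \<in> I \<Longrightarrow> t $ i \<le> \<xi> $ i) \<Longrightarrow> (\<And>j. j \<notin> I \<Longrightarrow> \<bar>t $ j - \<xi> $ j\<bar> < 3 * \<delta>) \<Longrightarrow> \<phi> (cexp t) \<le> ereal C0"
    and W: "W = {z. (\<forall>i\<in>I. cmod (z $ i) < exp (\<xi> $ i)) \<and> (\<forall>j. j \<notin> I \<longrightarrow> cmod (z $ j - p $ j) < \<eta>)}"
    and WJ: "\<And>z j. z \<in> W \<Longrightarrow> j \<notin> I \<Longrightarrow> z $ j \<noteq> 0 \<and> \<bar>ln (cmod (z $ j)) - \<xi> $ j\<bar> < \<delta>"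
    and F: "F = (\<lambda>z. ennreal ((\<Prod>i\<in>I. cmod (z $ i) ^ a i)\<^sup>2) * exp_ereal (- 2 * \<phi> z) * indicator W z)"
    and F_meas: "F \<in> borel_measurable borel" and F_fin: "(\<integral>\<^sup>+z. F z \<partial>lborel) < \<infinity>"
  shows "\<exists>c>0. \<exists>K. \<forall>y. (\<forall>i\<in>I. y $ i < \<xi> $ i) \<longrightarrow> (\<forall>j. j \<notin> I \<longrightarrow> \<bar>y $ j - \<xi> $ j\<bar> < \<delta>) \<longrightarrow>
     ereal ((\<Sum>i\<in>I. (real (a i) + 1) * (y $ i - \<xi> $ i)) + c * (\<Sum>i\<in>I. \<xi> $ i - y $ i) - K) \<le> \<phi> (cexp y)"
proof -
  note [measurable] = F_meas
  \<comment> \<open>A part of \<open>W\<close> of logarithmic width 1 in each direction of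
    \<open>I\<close>, so that translates by different whole numbers are disjoint.\<close>
  define A0 where "A0 = {z :: complex^'n. (\<forall>i\<in>I. exp (\<xi> $ i - 1) < cmod (z $ i) \<and> cmod (z $ i) < exp (\<xi> $ i)) \<and> (\<forall>j. j \<notin> I \<longrightarrow> cmod (z $ j - p $ j) < \<eta>)}"
  define Y where "Y y \<longleftrightarrow> (\<forall>i\<in>I. y $ i < \<xi> $ i) \<and> (\<forall>j. j \<notin> I \<longrightarrow> \<bar>y $ j - \<xi> $ j\<bar> < \<delta>)" for y :: "real^'n"
  have A0_alt: "A0 = (\<Inter>i\<in>I. {z. exp (\<xi> $ i - 1) < cmod (z $ i)} \<inter> {z. cmod (z $ i) < exp (\<xi> $ i)}) \<inter> (\<Inter>j\<in>-I. {z. cmod (z $ j - p $ j) < \<eta>})"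
    by (auto simp: A0_def)
  have opA0: "open A0" unfolding A0_alt
    by (intro open_Int open_INT ballI finite_Int open_Collect_less continuous_intros) auto
  then have [measurable]: "A0 \<in> sets borel" by simp
  have A0W: "A0 \<subseteq> W" by (auto simp: A0_def W)
  define k0 where "k0 = (\<Prod>i\<in>I. exp (\<xi> $ i - 1) ^ a i)\<^sup>2"
  have k0: "k0 > 0" unfolding k0_def by (auto intro!: zero_less_power prod_pos)
  have "emeasure lborel A0 \<noteq> 0"
  proof -
    have "(\<chi> i. if i \<in> I then of_real (exp (\<xi> $ i - 1/2)) else p $ i) \<in> A0"
      using \<eta> by (auto simp: A0_def)
    then have "\<not> negligible A0" using opA0 open_not_negligible by blast
    then show ?thesis using \<open>A0 \<in> sets borel\<close>
      by (simp add: negligible_iff_null_sets null_sets_completion_iff null_sets_def)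
  qed
  then obtain m0 where m0: "m0 > 0" "ennreal m0 \<le> emeasure lborel A0"
    by (cases "emeasure lborel A0")
       (metis ennreal_0 ennreal_leI less_eq_real_def order_refl, metis top_greatest zero_less_one)
  define k1 where "k1 = k0 * m0"
  have k1: "k1 > 0" using k0 m0 by (simp add: k1_def)
  obtain K2 where K2: "(\<integral>\<^sup>+z. F z \<partial>lborel) = ennreal K2" "K2 \<ge> 0"
    using F_fin by (cases "\<integral>\<^sup>+z. F z \<partial>lborel") auto
  define \<tau> where "\<tau> y = (\<chi> i. if i \<in> I then y $ i - \<xi> $ i else 0)" for y :: "real^'n"
  \<comment> \<open>A real \<open>A\<close> above \<open>\<phi> (cexp y)\<close> stands in for this
    value, which is not yet known to be finite. In the slope, \<open>a i\<close> comes from the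
    monomial and 1 from the Jacobian of the scaling.\<close>
  define H where "H y A = A - (\<Sum>i\<in>I. (real (a i) + 1) * (y $ i - \<xi> $ i))" for y :: "real^'n" and A :: real
  define P where "P y s = {z. dscale (\<lambda>j. of_real (exp (- (s * \<tau> y $ j)))) z \<in> A0}" for y s
  have [measurable]: "P y s \<in> sets borel" for y s
  proof -
    have "P y s = dscale (\<lambda>j. of_real (exp (- (s * \<tau> y $ j)))) -` A0" by (auto simp: P_def)
    then show ?thesis using open_vimage[OF opA0 continuous_dscale] by simp
  qed
  \<comment> \<open>The point \<open>ln \<bar>w\<bar> + s \<tau>\<close> is a convex combination of \<open>y\<close> and a point \<open>u\<close> where the weight is at most \<open>C0\<close>.\<close>
  have piece: "ennreal (k1 * exp (- 2 * ((1 - s) * C0 + s * H y A))) \<le> (\<integral>\<^sup>+z. F z * indicator (P y s) z \<partial>lborel)"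
    if y: "Y y" and A: "\<phi> (cexp y) \<le> ereal A" and s: "0 \<le> s" "s \<le> 1/2" for y A s
  proof -
    let ?e = "\<lambda>j. exp (s * \<tau> y $ j)"
    let ?T = "dscale (\<lambda>j. of_real (?e j)) :: complex^'n \<Rightarrow> complex^'n"
    define E where "E = exp (- 2 * (s * A + (1 - s) * C0))"
    define Q where "Q = (\<Prod>i\<in>I. ?e i ^ a i)\<^sup>2"
    have inv: "dscale (\<lambda>j. of_real (exp (- (s * \<tau> y $ j)))) (?T w) = w" for w :: "complex^'n"
      by (simp add: vec_eq_iff exp_minus flip: of_real_mult mult.assoc)
    have PT: "?T w \<in> P y s \<longleftrightarrow> w \<in> A0" for w unfolding P_def mem_Collect_eq inv ..
    have nT: "cmod (?T w $ j) = ?e j * cmod (w $ j)" for w j by (simp add: norm_mult)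
    have low: "ennreal (Q * k0 * E) * indicator A0 w \<le> F (?T w) * indicator (P y s) (?T w)" for w
    proof (cases "w \<in> A0")
      case True
      have e1: "?e i \<le> 1" if "i \<in> I" for i
      proof -
        have "\<tau> y $ i \<le> 0" using y that by (auto simp: \<tau>_def Y_def)
        then show ?thesis using s by (simp add: mult_nonneg_nonpos)
      qed
      have eJ: "?e j = 1" if "j \<notin> I" for j using that by (simp add: \<tau>_def)
      have TW: "?T w \<in> W" unfolding W mem_Collect_eq
      proof (intro conjI ballI allI impI)
        fix i assume i: "i \<in> I"
        have "cmod (?T w $ i) \<le> cmod (w $ i)" unfolding nT using e1[OF i] by (simp add: mult_left_le_one_le)
        also have "\<dots> < exp (\<xi> $ i)" using True i by (auto simp: A0_def)
        finally show "cmod (?T w $ i) < exp (\<xi> $ i)" .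
      next
        fix j assume j: "j \<notin> I"
        show "cmod (?T w $ j - p $ j) < \<eta>" using True j by (simp add: A0_def eJ)
      qed
      define v where "v = (\<chi> i. ln (cmod (w $ i)))"
      have wnz: "w $ i \<noteq> 0" for i
      proof (cases "i \<in> I")
        case True
        then have "exp (\<xi> $ i - 1) < cmod (w $ i)" using \<open>w \<in> A0\<close> by (auto simp: A0_def)
        then show ?thesis by (metis exp_ge_zero norm_zero not_le)
      qed (use WJ A0W \<open>w \<in> A0\<close> in blast)
      have vI: "v $ i < \<xi> $ i" if "i \<in> I" for i
      proof -
        have "cmod (w $ i) < exp (\<xi> $ i)" using True that by (auto simp: A0_def)
        then have "ln (cmod (w $ i)) < ln (exp (\<xi> $ i))" using wnz by (subst ln_less_cancel_iff) auto
        then show ?thesis by (simp add: v_def)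
      qed
      have vJ: "\<bar>v $ j - \<xi> $ j\<bar> < \<delta>" if "j \<notin> I" for j using WJ[of w j] A0W True that by (auto simp: v_def)
      have logT: "(\<chi> i. ln (cmod (?T w $ i))) = v + s *\<^sub>R \<tau> y"
        unfolding nT using wnz by (simp add: vec_eq_iff v_def ln_mult)
      \<comment> \<open>Since \<open>s \<le> 1/2\<close>, the coordinates of \<open>u\<close>
        outside \<open>I\<close> differ from those of \<open>\<xi>\<close> by less than
        \<open>(\<delta> + \<delta>/2) / (1/2) = 3 * \<delta>\<close>, which explains the margin. In
        the directions of \<open>I\<close> the coordinates of \<open>y\<close> cancel.\<close>
      define u where "u = (1 / (1 - s)) *\<^sub>R (v + s *\<^sub>R \<tau> y - s *\<^sub>R y)"
      have s1: "1 - s > 0" using s by simp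
      have u: "v + s *\<^sub>R \<tau> y = (1 - s) *\<^sub>R u + s *\<^sub>R y" using s1 by (simp add: u_def)
      have ucomp: "(1 - s) * u $ j = v $ j + s * \<tau> y $ j - s * y $ j" for j
        using arg_cong[OF u, of "\<lambda>x. x $ j"] by simp
      have uI: "u $ i \<le> \<xi> $ i" if "i \<in> I" for i
      proof -
        have "(1 - s) * u $ i = v $ i - s * \<xi> $ i" using that ucomp[of i] by (simp add: \<tau>_def algebra_simps)
        also have "\<dots> \<le> (1 - s) * \<xi> $ i" using vI[OF that] by (simp add: algebra_simps)
        finally show ?thesis using s1 by simp
      qed
      have uJ: "\<bar>u $ j - \<xi> $ j\<bar> < 3 * \<delta>" if "j \<notin> I" for j
      proof -
        have "(1 - s) * (u $ j - \<xi> $ j) = (v $ j - \<xi> $ j) - s * (y $ j - \<xi> $ j)"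
          using that ucomp[of j] by (simp add: \<tau>_def algebra_simps)
        then have "(1 - s) * \<bar>u $ j - \<xi> $ j\<bar> = \<bar>(v $ j - \<xi> $ j) - s * (y $ j - \<xi> $ j)\<bar>"
          using s1 by (metis abs_mult abs_of_pos)
        also have "\<dots> \<le> \<bar>v $ j - \<xi> $ j\<bar> + s * \<bar>y $ j - \<xi> $ j\<bar>"
          using s by (intro order_trans[OF abs_triangle_ineq4]) (simp add: abs_mult)
        also have "\<dots> < \<delta> + (1/2) * \<delta>"
          using vJ[OF that] y that s by (intro add_less_le_mono mult_mono) (auto simp: Y_def less_imp_le)
        finally have *: "(1 - s) * \<bar>u $ j - \<xi> $ j\<bar> < (3/2) * \<delta>" by simp
        have "(1/2) * \<bar>u $ j - \<xi> $ j\<bar> \<le> (1 - s) * \<bar>u $ j - \<xi> $ j\<bar>" using s by (intro mult_right_mono) auto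
        then have "(1/2) * \<bar>u $ j - \<xi> $ j\<bar> < (3/2) * \<delta>" using * by (rule order_le_less_trans)
        then show ?thesis by simp
      qed
      have yI: "y $ i \<le> \<xi> $ i" if "i \<in> I" for i using y that by (auto simp: Y_def less_imp_le)
      have yJ: "\<bar>y $ j - \<xi> $ j\<bar> < 3 * \<delta>" if "j \<notin> I" for j using y that \<delta> by (auto simp: Y_def) 
      have domw: "exp ((v + s *\<^sub>R \<tau> y) $ i) < r" for i
      proof -
        have "\<tau> y $ i \<le> 0" "i \<notin> I \<Longrightarrow> \<tau> y $ i = 0" for i using yI by (auto simp: \<tau>_def)
        then have *: "s * \<tau> y $ i \<le> 0" "i \<notin> I \<Longrightarrow> s * \<tau> y $ i = 0" for i using s by (auto simp: mult_nonneg_nonpos)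
        show ?thesis
        proof (rule dom)
          show "(v + s *\<^sub>R \<tau> y) $ i \<le> \<xi> $ i" if "i \<in> I" for i using vI[OF that] *(1)[of i] by simp
          show "\<bar>(v + s *\<^sub>R \<tau> y) $ j - \<xi> $ j\<bar> < 3 * \<delta>" if "j \<notin> I" for j
          proof -
            have eq: "(v + s *\<^sub>R \<tau> y) $ j = v $ j" using *(2)[OF that] by auto
            show ?thesis unfolding eq using vJ[OF that] \<delta> by linarith
          qed
        qed
      qed
      have Tnz: "?T w $ i \<noteq> 0" for i using wnz by simp
      have "cmod (?T w $ i) < r" for i
      proof -
        have "cmod (?T w $ i) = exp (ln (cmod (?T w $ i)))" using Tnz[of i] by (simp del: dscale_nth)
        also have "ln (cmod (?T w $ i)) = (v + s *\<^sub>R \<tau> y) $ i" by (metis logT vec_lambda_beta)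
        finally show ?thesis using domw by simp
      qed
      then have "\<phi> (?T w) = \<phi> (cexp (v + s *\<^sub>R \<tau> y))"
        unfolding logT[symmetric] by (intro toric_eq_cexp[OF tor] Tnz) (simp add: polydisk_def del: dscale_nth)
      also have "\<dots> \<le> ereal ((1 - s) * C0 + s * A)"
        unfolding u by (rule toric_log_convex[OF tor dom dom C0 A]) (use uI uJ yI yJ s in auto)
      finally have "ennreal (exp (- 2 * ((1 - s) * C0 + s * A))) \<le> exp_ereal (- 2 * \<phi> (?T w))"
        by (rule exp_ereal_neg2_ge)
      then have 1: "ennreal E \<le> exp_ereal (- 2 * \<phi> (?T w))" by (simp add: E_def add.commute)
      have "(\<Prod>i\<in>I. exp (\<xi> $ i - 1) ^ a i) \<le> (\<Prod>i\<in>I. cmod (w $ i) ^ a i)"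
      proof (intro prod_mono conjI power_mono)
        fix i assume "i \<in> I"
        then show "exp (\<xi> $ i - 1) \<le> cmod (w $ i)" using True by (simp add: A0_def less_imp_le)
      qed auto
      then have "k0 \<le> (\<Prod>i\<in>I. cmod (w $ i) ^ a i)\<^sup>2" unfolding k0_def
        by (rule power_mono) (auto intro: prod_nonneg)
      then have "Q * k0 \<le> Q * (\<Prod>i\<in>I. cmod (w $ i) ^ a i)\<^sup>2" by (intro mult_left_mono) (auto simp: Q_def)
      also have "\<dots> = (\<Prod>i\<in>I. cmod (?T w $ i) ^ a i)\<^sup>2"
        unfolding nT Q_def by (simp add: power_mult_distrib prod.distrib)
      finally have 2: "Q * k0 \<le> (\<Prod>i\<in>I. cmod (?T w $ i) ^ a i)\<^sup>2" .
      have "ennreal (Q * k0 * E) = ennreal (Q * k0) * ennreal E"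
        by (rule ennreal_mult') (use k0 in \<open>simp add: Q_def\<close>)
      also have "\<dots> \<le> ennreal ((\<Prod>i\<in>I. cmod (?T w $ i) ^ a i)\<^sup>2) * exp_ereal (- 2 * \<phi> (?T w))"
        by (intro mult_mono ennreal_leI 1 2) auto
      finally show ?thesis using TW True PT[of w] unfolding F by (simp del: dscale_nth)
    qed simp
    have sum\<tau>: "(\<Prod>j\<in>UNIV. (?e j)\<^sup>2) = exp (2 * s * (\<Sum>i\<in>I. y $ i - \<xi> $ i))"
    proof -
      have "(\<Prod>j\<in>UNIV. (?e j)\<^sup>2) = exp (\<Sum>j\<in>UNIV. 2 * (s * \<tau> y $ j))"
        by (simp add: exp_sum exp_double)
      also have "(\<Sum>j\<in>UNIV. 2 * (s * \<tau> y $ j)) = (\<Sum>j\<in>I. 2 * (s * (y $ j - \<xi> $ j)))"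
        by (rule sum.mono_neutral_cong_right) (auto simp: \<tau>_def)
      finally show ?thesis by (simp add: sum_distrib_left mult.assoc)
    qed
    have Qe: "Q = exp (2 * s * (\<Sum>i\<in>I. real (a i) * (y $ i - \<xi> $ i)))"
    proof -
      have "(\<Prod>i\<in>I. ?e i ^ a i) = (\<Prod>i\<in>I. exp (s * (real (a i) * (y $ i - \<xi> $ i))))"
        by (intro prod.cong refl) (simp add: \<tau>_def exp_of_nat_mult[symmetric] mult_ac)
      also have "\<dots> = exp (s * (\<Sum>i\<in>I. real (a i) * (y $ i - \<xi> $ i)))"
        by (simp add: exp_sum sum_distrib_left)
      finally show ?thesis unfolding Q_def by (simp add: exp_double mult.assoc)
    qed
    \<comment> \<open>The Jacobian contributes \<open>S1\<close> and the monomial \<open>S2\<close>;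
      together they turn \<open>A\<close> into \<open>H y A\<close> in the exponent.\<close>
    have "k1 * exp (- 2 * ((1 - s) * C0 + s * H y A)) = (\<Prod>j\<in>UNIV. (?e j)\<^sup>2) * (Q * k0 * E * m0)"
    proof -
      define S1 where "S1 = (\<Sum>i\<in>I. y $ i - \<xi> $ i)"
      define S2 where "S2 = (\<Sum>i\<in>I. real (a i) * (y $ i - \<xi> $ i))"
      have "(\<Sum>i\<in>I. (real (a i) + 1) * (y $ i - \<xi> $ i)) = S2 + S1"
        by (simp add: S1_def S2_def distrib_right sum.distrib)
      then show ?thesis
        unfolding sum\<tau> Qe E_def H_def k1_def S1_def[symmetric] S2_def[symmetric]
        by (simp add: algebra_simps flip: exp_add)
    qed
    then have "ennreal (k1 * exp (- 2 * ((1 - s) * C0 + s * H y A)))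
       = ennreal (\<Prod>j\<in>UNIV. (?e j)\<^sup>2) * (ennreal (Q * k0 * E) * ennreal m0)"
      using k0 m0 by (simp add: ennreal_mult' E_def Q_def prod_nonneg flip: ennreal_mult')
    also have "\<dots> \<le> ennreal (\<Prod>j\<in>UNIV. (?e j)\<^sup>2) * (ennreal (Q * k0 * E) * emeasure lborel A0)"
      by (intro mult_left_mono m0) auto
    also have "ennreal (Q * k0 * E) * emeasure lborel A0 = (\<integral>\<^sup>+w. ennreal (Q * k0 * E) * indicator A0 w \<partial>lborel)"
      by (simp add: nn_integral_cmult_indicator)
    also have "\<dots> \<le> (\<integral>\<^sup>+w. F (?T w) * indicator (P y s) (?T w) \<partial>lborel)"
      by (intro nn_integral_mono low)
    also have "ennreal (\<Prod>j\<in>UNIV. (?e j)\<^sup>2) * \<dots> = (\<integral>\<^sup>+z. F z * indicator (P y s) z \<partial>lborel)"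
      by (rule nn_integral_dscale_real[symmetric]) auto
    finally show ?thesis by (simp add: mult_left_mono)
  qed
  \<comment> \<open>The single piece with \<open>s = 1/2\<close> suffices; \<open>K2 + 1\<close> in
    place of \<open>K2\<close> keeps the argument of the logarithm positive.\<close>
  have low: "- (C0 + ln ((K2 + 1) / k1)) \<le> H y A" if y: "Y y" and A: "\<phi> (cexp y) \<le> ereal A" for y A
  proof -
    have "ennreal (k1 * exp (- 2 * ((1 - 1/2) * C0 + 1/2 * H y A))) \<le> (\<integral>\<^sup>+z. F z * indicator (P y (1/2)) z \<partial>lborel)"
      by (rule piece[OF y A]) auto
    also have "\<dots> \<le> (\<integral>\<^sup>+z. F z \<partial>lborel)" by (intro nn_integral_mono) (auto simp: indicator_def)
    finally have "k1 * exp (- (C0 + H y A)) \<le> K2 + 1" using K2 by (simp add: ennreal_le_iff)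
    then have "exp (- (C0 + H y A)) \<le> (K2 + 1) / k1" using k1 by (simp add: field_simps)
    then have "- (C0 + H y A) \<le> ln ((K2 + 1) / k1)" using k1 K2 by (subst ln_ge_iff) auto
    then show ?thesis by simp
  qed
  \<comment> \<open>From this depth \<open>L\<close> on, \<open>L / 2\<close> pieces of mass
    \<open>k1 * exp (- 2 * C0 - 2)\<close> would exceed the total mass \<open>K2\<close>.\<close>
  define \<Lambda> where "\<Lambda> = 2 * K2 * exp (2 * C0 + 2) / k1 + 1"
  have \<Lambda>: "\<Lambda> > 0" using K2 k1 by (simp add: \<Lambda>_def add_nonneg_pos)
  \<comment> \<open>If the bound failed, about \<open>(\<xi>\<^sub>i - y\<^sub>i) / 2\<close> disjoint pieces would each carry a fixed amount of mass.\<close>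
  have far: "C0 + 1 < H y A" if y: "Y y" and A: "\<phi> (cexp y) \<le> ereal A" and i: "i \<in> I" "\<xi> $ i - y $ i \<ge> \<Lambda>" for y A i
  proof (rule ccontr)
    assume "\<not> C0 + 1 < H y A"
    then have HA: "H y A \<le> C0 + 1" by simp
    define L where "L = \<xi> $ i - y $ i"
    have L: "L > 0" using i \<Lambda> by (simp add: L_def)
    define N where "N = nat \<lfloor>L / 2\<rfloor> + 1"
    have N: "real N \<ge> L / 2" unfolding N_def using L by linarith
    \<comment> \<open>The translation in direction \<open>i\<close> then has length exactly
      \<open>k\<close>, and \<open>k < N\<close> amounts to \<open>k \<le> L / 2\<close>, that is,
      to the admissible range \<open>sk k \<le> 1/2\<close>.\<close>
    define sk where "sk k = real k / L" for k
    have sk: "0 \<le> sk k" "sk k \<le> 1/2" if "k < N" for k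
    proof -
      have "real k \<le> L / 2" using that L unfolding N_def by linarith
      then show "0 \<le> sk k" "sk k \<le> 1/2" using L by (auto simp: sk_def field_simps)
    qed
    have each: "ennreal (k1 * exp (- 2 * C0 - 2)) \<le> (\<integral>\<^sup>+z. F z * indicator (P y (sk k)) z \<partial>lborel)" if k: "k < N" for k
    proof -
      have "sk k * (H y A - C0) \<le> 1"
      proof (cases "H y A - C0 \<ge> 0")
        case True
        then have "sk k * (H y A - C0) \<le> (1/2) * 1" using sk[OF k] HA by (intro mult_mono) auto
        then show ?thesis by simp
      next
        case False
        then have "sk k * (H y A - C0) \<le> 0" using sk[OF k] by (simp add: mult_nonneg_nonpos)
        then show ?thesis by simp
      qed
      then have "- 2 * C0 - 2 \<le> - 2 * ((1 - sk k) * C0 + sk k * H y A)" by (simp add: algebra_simps)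
      then have "k1 * exp (- 2 * C0 - 2) \<le> k1 * exp (- 2 * ((1 - sk k) * C0 + sk k * H y A))" using k1 by simp
      then show ?thesis using piece[OF y A sk[OF k]] by (meson ennreal_leI order_trans)
    qed
    have disj: "k = k'" if "z \<in> P y (sk k)" "z \<in> P y (sk k')" for z k k'
    proof -
      have *: "\<xi> $ i - 1 < real k + ln (cmod (z $ i)) \<and> real k + ln (cmod (z $ i)) < \<xi> $ i" if "z \<in> P y (sk k)" for k
      proof -
        have "- (sk k * \<tau> y $ i) = real k" using L i by (simp add: sk_def \<tau>_def L_def field_simps)
        then have *: "exp (\<xi> $ i - 1) < exp (real k) * cmod (z $ i)" "exp (real k) * cmod (z $ i) < exp (\<xi> $ i)"
          using that i by (auto simp: P_def A0_def norm_mult)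
        then have "z $ i \<noteq> 0" by (metis exp_ge_zero mult_zero_right norm_zero not_le)
        then have "exp (real k) * cmod (z $ i) = exp (real k + ln (cmod (z $ i)))" by (simp add: exp_add)
        then show ?thesis using * by simp
      qed
      from *[OF that(1)] *[OF that(2)] show ?thesis by linarith
    qed
    have "ennreal (real N * (k1 * exp (- 2 * C0 - 2))) = (\<Sum>k<N. ennreal (k1 * exp (- 2 * C0 - 2)))"
      using k1 by (subst sum_ennreal) auto
    also have "\<dots> \<le> (\<Sum>k<N. \<integral>\<^sup>+z. F z * indicator (P y (sk k)) z \<partial>lborel)"
      by (intro sum_mono each) auto
    also have "\<dots> = (\<integral>\<^sup>+z. (\<Sum>k<N. F z * indicator (P y (sk k)) z) \<partial>lborel)"
      by (rule nn_integral_sum[symmetric]) auto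
    also have "\<dots> \<le> (\<integral>\<^sup>+z. F z \<partial>lborel)"
    proof (rule nn_integral_mono)
      fix z
      have "(\<Sum>k<N. indicator (P y (sk k)) z :: ennreal) \<le> 1"
      proof (cases "\<exists>k<N. z \<in> P y (sk k)")
        case True
        then obtain k where k: "k < N" "z \<in> P y (sk k)" by auto
        then have "(\<Sum>k<N. indicator (P y (sk k)) z :: ennreal) = (\<Sum>k'\<in>{k}. indicator (P y (sk k')) z)"
          by (intro sum.mono_neutral_right) (auto simp: indicator_def dest: disj)
        also have "\<dots> = indicator (P y (sk k)) z" by (subst sum.insert) (simp_all del: sum.insert)
        also have "\<dots> \<le> 1" using k(2) by (simp only: indicator_simps(1) order_refl)
        finally show ?thesis .
      next
        case False
        then have "(\<Sum>k<N. indicator (P y (sk k)) z :: ennreal) = 0" by (intro sum.neutral) (auto simp: indicator_def)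
        then show ?thesis by simp
      qed
      then have "F z * (\<Sum>k<N. indicator (P y (sk k)) z) \<le> F z * 1" by (intro mult_left_mono) auto
      then show "(\<Sum>k<N. F z * indicator (P y (sk k)) z) \<le> F z" by (simp add: sum_distrib_left)
    qed
    finally have NK: "real N * (k1 * exp (- 2 * C0 - 2)) \<le> K2" using K2 by (simp add: ennreal_le_iff)
    have "L / 2 * (k1 * exp (- 2 * C0 - 2)) \<le> real N * (k1 * exp (- 2 * C0 - 2))"
      using N k1 by (intro mult_right_mono) auto
    then have "L / 2 * (k1 * exp (- 2 * C0 - 2)) \<le> K2" using NK by linarith
    then have "L / 2 * (k1 * exp (- 2 * C0 - 2)) * exp (2 * C0 + 2) \<le> K2 * exp (2 * C0 + 2)"
      by (rule mult_right_mono) simp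
    moreover have "L / 2 * (k1 * exp (- 2 * C0 - 2)) * exp (2 * C0 + 2) = L / 2 * k1"
    proof -
      have "exp (- 2 * C0 - 2) * exp (2 * C0 + 2) = (1::real)" by (simp add: mult_exp_exp)
      then show ?thesis by (metis mult.assoc mult.right_neutral)
    qed
    ultimately have "L / 2 * k1 \<le> K2 * exp (2 * C0 + 2)" by (simp only:)
    then have "L \<le> 2 * K2 * exp (2 * C0 + 2) / k1" using k1 by (simp add: field_simps)
    then show False using i(2) by (simp add: L_def \<Lambda>_def)
  qed
  \<comment> \<open>The last entry serves the points of depth below \<open>\<Lambda>\<close>, where
    the growth term is at most 1 and \<open>low\<close> applies; \<open>1 - C0\<close> serves the
    deeper ones, where growth is counted from the level \<open>C0\<close>.\<close>
  define C' where "C' = max 1 (max (1 - C0) (1 + C0 + ln ((K2 + 1) / k1)))"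
  have lin: "(\<xi> $ i - y $ i) / \<Lambda> - C' \<le> H y A" if y: "Y y" and A: "\<phi> (cexp y) \<le> ereal A" and i: "i \<in> I" for y A i
  proof (cases "\<xi> $ i - y $ i \<ge> \<Lambda>")
    case False
    then have "(\<xi> $ i - y $ i) / \<Lambda> \<le> 1" using \<Lambda> by (simp add: field_simps)
    then show ?thesis using low[OF y A] by (simp add: C'_def)
  next
    case True
    define \<sigma> where "\<sigma> = (\<xi> $ i - y $ i) / \<Lambda>"
    have \<sigma>: "\<sigma> \<ge> 1" using True \<Lambda> by (simp add: \<sigma>_def)
    \<comment> \<open>\<open>b\<close> has the coordinates of \<open>\<xi>\<close> in
      \<open>I\<close>, so \<open>\<phi>\<close> is at most \<open>C0\<close> there. Between
      \<open>b\<close> and \<open>y\<close>, the point \<open>y'\<close> has depth exactly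
      \<open>\<Lambda>\<close> in direction \<open>i\<close>. The excess of \<open>H\<close> over
      \<open>C0\<close> scales by \<open>1/\<sigma>\<close> from \<open>y\<close> to
      \<open>y'\<close>, so the excess of more than 1 at \<open>y'\<close> becomes one of more than
      \<open>\<sigma>\<close> at \<open>y\<close>.\<close>
    define b where "b = (\<chi> j. if j \<in> I then \<xi> $ j else y $ j)"
    define y' where "y' = (1 - 1/\<sigma>) *\<^sub>R b + (1/\<sigma>) *\<^sub>R y"
    define A' where "A' = (1 - 1/\<sigma>) * C0 + (1/\<sigma>) * A"
    have y'I: "y' $ j - \<xi> $ j = (y $ j - \<xi> $ j) / \<sigma>" if "j \<in> I" for j
      using that \<sigma> by (simp add: y'_def b_def field_simps)
    have y'J: "y' $ j = y $ j" if "j \<notin> I" for j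
      using that by (simp add: y'_def b_def algebra_simps)
    have Y': "Y y'" unfolding Y_def
    proof (intro conjI ballI allI impI)
      fix j assume j: "j \<in> I"
      have "(y $ j - \<xi> $ j) / \<sigma> < 0" using y j \<sigma> by (auto simp: Y_def divide_less_0_iff)
      then show "y' $ j < \<xi> $ j" using y'I[OF j] by simp
    next
      fix j assume "j \<notin> I" then show "\<bar>y' $ j - \<xi> $ j\<bar> < \<delta>" using y y'J by (auto simp: Y_def)
    qed
    have yI: "y $ i \<le> \<xi> $ i" if "i \<in> I" for i using y that by (auto simp: Y_def less_imp_le)
    have yJ: "\<bar>y $ j - \<xi> $ j\<bar> < 3 * \<delta>" if "j \<notin> I" for j using y that \<delta> by (auto simp: Y_def)
    have bI: "b $ i \<le> \<xi> $ i" if "i \<in> I" for i using that by (simp add: b_def)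
    have bJ: "\<bar>b $ j - \<xi> $ j\<bar> < 3 * \<delta>" if "j \<notin> I" for j using yJ that by (simp add: b_def)
    have "\<phi> (cexp y') \<le> ereal A'" unfolding y'_def A'_def
      by (rule toric_log_convex[OF tor dom dom C0 A]) (use bI bJ yI yJ \<sigma> in auto)
    moreover have "\<xi> $ i - y' $ i \<ge> \<Lambda>"
    proof -
      have "\<xi> $ i - y' $ i = (\<xi> $ i - y $ i) / \<sigma>" using y'I[OF i] by (simp add: minus_divide_left algebra_simps)
      also have "\<dots> = \<Lambda>" using \<sigma> \<Lambda> by (auto simp: \<sigma>_def field_simps)
      finally show ?thesis by simp
    qed
    ultimately have "C0 + 1 < H y' A'" using far[OF Y' _ i] by blast
    also have "H y' A' = C0 + (H y A - C0) / \<sigma>"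
    proof -
      have "(\<Sum>i\<in>I. (real (a i) + 1) * (y' $ i - \<xi> $ i)) = (\<Sum>i\<in>I. (real (a i) + 1) * (y $ i - \<xi> $ i)) / \<sigma>"
        unfolding sum_divide_distrib by (intro sum.cong refl) (simp add: y'I)
      then show ?thesis using \<sigma> by (simp add: H_def A'_def field_simps)
    qed
    finally have "\<sigma> < H y A - C0" using \<sigma> by (simp add: field_simps)
    then show ?thesis using \<sigma> by (simp add: \<sigma>_def[symmetric] C'_def)
  qed
  \<comment> \<open>The bounds \<open>lin\<close> are added over \<open>I\<close> together with one
    use of \<open>low\<close>, which makes \<open>card I + 1\<close> inequalities and also covers an
    empty \<open>I\<close>.\<close>
  define c where "c = 1 / (\<Lambda> * (real (card I) + 1))"
  have c0: "c > 0" using \<Lambda> by (simp add: c_def add_nonneg_pos)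
  have main: "c * (\<Sum>i\<in>I. \<xi> $ i - y $ i) - C' \<le> H y A" if y: "Y y" and A: "\<phi> (cexp y) \<le> ereal A" for y A
  proof -
    have "(\<Sum>i\<in>I. (\<xi> $ i - y $ i) / \<Lambda> - C') \<le> (\<Sum>i\<in>I. H y A)" by (intro sum_mono lin[OF y A])
    then have "(\<Sum>i\<in>I. \<xi> $ i - y $ i) / \<Lambda> - real (card I) * C' \<le> real (card I) * H y A"
      by (subst (asm) sum_subtractf) (simp add: sum_divide_distrib)
    moreover have "- C' \<le> H y A" using low[OF y A] by (simp add: C'_def)
    ultimately have "(\<Sum>i\<in>I. \<xi> $ i - y $ i) / \<Lambda> \<le> (real (card I) + 1) * (H y A + C')" by (simp add: algebra_simps)
    then have "(\<Sum>i\<in>I. \<xi> $ i - y $ i) / \<Lambda> / (real (card I) + 1) \<le> H y A + C'"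
      by (subst pos_divide_le_eq) (auto simp: mult.commute)
    moreover have "c * (\<Sum>i\<in>I. \<xi> $ i - y $ i) = (\<Sum>i\<in>I. \<xi> $ i - y $ i) / \<Lambda> / (real (card I) + 1)"
      by (simp add: c_def)
    ultimately show ?thesis by linarith
  qed
  show ?thesis
  proof (rule exI[of _ c], rule conjI[OF c0], rule exI[of _ C'], intro allI impI)
    fix y :: "real^'n" assume "\<forall>i\<in>I. y $ i < \<xi> $ i" "\<forall>j. j \<notin> I \<longrightarrow> \<bar>y $ j - \<xi> $ j\<bar> < \<delta>"
    then have y: "Y y" by (auto simp: Y_def)
    let ?x = "(\<Sum>i\<in>I. (real (a i) + 1) * (y $ i - \<xi> $ i)) + c * (\<Sum>i\<in>I. \<xi> $ i - y $ i) - C'"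
    show "ereal ?x \<le> \<phi> (cexp y)"
    proof (rule ccontr)
      assume "\<not> ereal ?x \<le> \<phi> (cexp y)"
      then have "\<phi> (cexp y) < ereal ?x" by (simp only: not_le)
      from ereal_dense2[OF this] obtain A where A: "\<phi> (cexp y) < ereal A" "ereal A < ereal ?x" by blast
      have "c * (\<Sum>i\<in>I. \<xi> $ i - y $ i) - C' \<le> H y A" using main[OF y] A(1) by (simp only: less_imp_le)
      then show False using A(2) unfolding H_def by simp
    qed
  qed
qed

section \<open>From linear growth to integrability\<close>

lemma AE_lborel_inner_Basis_nz:
  "AE x in (lborel :: 'a::euclidean_space measure). \<forall>b\<in>Basis. x \<bullet> b \<noteq> 0"
proof (rule AE_finite_allI)
  fix b :: 'a assume b: "b \<in> Basis"
  have "negligible {x. x \<bullet> b = 0}" by (rule negligible_standard_hyperplane[OF b])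
  moreover have "closed {x. x \<bullet> b = 0}" by (intro closed_Collect_eq continuous_intros)
  ultimately have "{x. x \<bullet> b = 0} \<in> null_sets lborel"
    by (simp add: negligible_iff_null_sets null_sets_completion_iff)
  from AE_not_in[OF this] show "AE x in lborel. x \<bullet> b \<noteq> 0" by simp
qed simp

lemma exp_ereal_neg2_scaled_le:
  assumes "ereal m \<le> x" "e \<ge> 0"
  shows "exp_ereal (- 2 * (ereal (1 + e) * x)) \<le> ennreal (exp (- 2 * ((1 + e) * m)))"
proof (cases x)
  case (real y)
  then have "(1 + e) * m \<le> (1 + e) * y" using assms by (intro mult_left_mono) auto
  then show ?thesis using real by (simp add: exp_ereal_def ennreal_leI mult.assoc)
qed (use assms in \<open>auto simp: exp_ereal_def\<close>)

lemma ennreal_prod_mono: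
  fixes f g :: "'a \<Rightarrow> ennreal"
  assumes "\<And>i. i \<in> A \<Longrightarrow> f i \<le> g i"
  shows "prod f A \<le> prod g A"
  using assms by (induction A rule: infinite_finite_induct) (auto intro!: mult_mono)

lemma ennreal_prod_less_top:
  fixes f :: "'a \<Rightarrow> ennreal"
  assumes "\<And>i. i \<in> A \<Longrightarrow> f i < \<infinity>"
  shows "prod f A < \<infinity>"
  using assms by (induction A rule: infinite_finite_induct) (auto simp: ennreal_mult_less_top)

text \<open>The exponent \<open>c / 2 - 1\<close> is at most 0, so
  \<open>|Re z| |Im z| \<le> |z|^2\<close> is reversed by taking powers. A power of the modulus is
  thereby split into real coordinates, and a product of one-dimensional integrals replaces polar
  coordinates.\<close>

lemma norm_powr_le_Re_Im:
  assumes "Re z \<noteq> 0" "Im z \<noteq> 0" "c \<le> 2"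
  shows "cmod z powr (c - 2) \<le> \<bar>Re z\<bar> powr (c / 2 - 1) * \<bar>Im z\<bar> powr (c / 2 - 1)"
proof -
  have z: "cmod z > 0" using assms by auto
  have "\<bar>Re z\<bar> * \<bar>Im z\<bar> \<le> cmod z * cmod z"
    by (intro mult_mono abs_Re_le_cmod abs_Im_le_cmod) auto
  then have "(cmod z * cmod z) powr (c / 2 - 1) \<le> (\<bar>Re z\<bar> * \<bar>Im z\<bar>) powr (c / 2 - 1)"
    using assms by (intro powr_mono2') auto
  moreover have "(cmod z * cmod z) powr (c / 2 - 1) = cmod z powr (c - 2)"
    using z by (simp add: powr_mult powr_add[symmetric])
  ultimately show ?thesis by (simp add: powr_mult)
qed

text \<open>For \<epsilon> = 0 the lower bound makes the integrand at most a constant times powers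
  of the moduli with exponent \<open>2 * c - 2 > -2\<close>. A small \<epsilon> costs at most
  \<open>2 * \<epsilon> * (a i + 1)\<close> in the exponent, and what remains is integrable
  coordinate by coordinate.\<close>

lemma nn_integral_finite_of_coercive:
  fixes \<xi> :: "real^'n" and a :: "'n \<Rightarrow> nat" and \<phi> :: "complex^'n \<Rightarrow> ereal"
  assumes c: "c > 0" and \<xi>: "\<And>i. i \<in> I \<Longrightarrow> \<xi> $ i \<le> 0"
    and RI: "\<And>z i. z \<in> R \<Longrightarrow> i \<in> I \<Longrightarrow> cmod (z $ i) < exp (\<xi> $ i)"
    and RB: "\<And>z i. z \<in> R \<Longrightarrow> cmod (z $ i) \<le> B"
    and low: "\<And>z. z \<in> R \<Longrightarrow> \<forall>i. z $ i \<noteq> 0 \<Longrightarrow>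
      ereal ((\<Sum>i\<in>I. (real (a i) + 1) * (ln (cmod (z $ i)) - \<xi> $ i)) + c * (\<Sum>i\<in>I. \<xi> $ i - ln (cmod (z $ i))) - K) \<le> \<phi> z"
  shows "\<exists>\<epsilon>0>0. \<forall>\<epsilon>. 0 < \<epsilon> \<longrightarrow> \<epsilon> \<le> \<epsilon>0 \<longrightarrow>
    (\<integral>\<^sup>+z. ennreal ((\<Prod>i\<in>I. cmod (z $ i) ^ a i)\<^sup>2) * exp_ereal (- 2 * (ereal (1 + \<epsilon>) * \<phi> z)) * indicator R z \<partial>lborel) < \<infinity>"
proof -
  \<comment> \<open>The cap at 1 keeps the exponent \<open>c1/2 - 1\<close> of the real factors
    nonpositive, as \<open>norm_powr_le_Re_Im\<close> requires.\<close>
  define c1 where "c1 = min c 1"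
  have c1: "0 < c1" "c1 \<le> 1" "c1 \<le> c" using c by (auto simp: c1_def)
  \<comment> \<open>\<open>S\<close> exceeds every \<open>a i + 1\<close>, so
    \<open>\<epsilon> \<le> c1 / (2 * S)\<close> limits the loss to \<open>c1\<close>; the gain is
    at least \<open>2 * c1\<close>, and the exponent stays at least \<open>c1 - 2\<close>.\<close>
  define S where "S = 1 + (\<Sum>i\<in>I. real (a i) + 1)"
  have S0: "S > 0" unfolding S_def by (intro add_pos_nonneg sum_nonneg) auto
  have S: "real (a i) + 1 \<le> S" if "i \<in> I" for i
    using member_le_sum[OF that, of "\<lambda>i. real (a i) + 1"] by (simp add: S_def)
  show ?thesis
  proof (intro exI[of _ "c1 / (2 * S)"] conjI allI impI)
    show "c1 / (2 * S) > 0" using c1 S0 by simp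
    fix \<epsilon> :: real assume \<epsilon>: "0 < \<epsilon>" "\<epsilon> \<le> c1 / (2 * S)"
    define C where "C = 2 * (1 + \<epsilon>) * K + (\<Sum>i\<in>I. 2 * real (a i) * \<xi> $ i - (c1 - 2) * \<xi> $ i)"
    define idx :: "complex^'n \<Rightarrow> 'n" where "idx b = (SOME j. b $ j \<noteq> 0)" for b
    have idx: "idx (axis j u) = j" if "u \<noteq> 0" for j u
      unfolding idx_def by (rule some_equality) (use that in \<open>auto simp: axis_def split: if_splits\<close>)
    \<comment> \<open>One factor per real coordinate. On \<open>R\<close> the moduli indexed by
      \<open>I\<close> are below \<open>exp (\<xi> $ i) \<le> 1\<close>, which places their real and
      imaginary parts in \<open>{-1..1}\<close>; the other coordinates only need a bounded
      range.\<close>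
    define f where "f b t = (if idx b \<in> I then ennreal (\<bar>t\<bar> powr (c1/2 - 1)) * indicator {-1..1} t else indicator {-B..B} t)"
      for b :: "complex^'n" and t :: real
    have fmeas: "f b \<in> borel_measurable borel" for b unfolding f_def[abs_def] by measurable
    have prodf: "(\<Prod>b\<in>Basis. f b (z \<bullet> b)) = (\<Prod>j\<in>UNIV. f (axis j 1) (Re (z $ j)) * f (axis j \<i>) (Im (z $ j)))" for z
      by (simp add: prod_Basis_complex_vec inner_axis inner_complex_def)
    have le: "ennreal ((\<Prod>i\<in>I. cmod (z $ i) ^ a i)\<^sup>2) * exp_ereal (- 2 * (ereal (1 + \<epsilon>) * \<phi> z)) * indicator R z
      \<le> ennreal (exp C) * (\<Prod>b\<in>Basis. f b (z \<bullet> b))" if nz: "\<forall>b\<in>Basis. z \<bullet> b \<noteq> 0" for z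
    proof (cases "z \<in> R")
      case True
      have ReIm: "Re (z $ j) \<noteq> 0" "Im (z $ j) \<noteq> 0" for j
      proof -
        have "axis j 1 \<in> (Basis :: (complex^'n) set)" "axis j \<i> \<in> (Basis :: (complex^'n) set)"
          by (auto simp: Basis_vec_def Basis_complex_def)
        then have "z \<bullet> axis j 1 \<noteq> 0" "z \<bullet> axis j \<i> \<noteq> 0" using nz by blast+
        then show "Re (z $ j) \<noteq> 0" "Im (z $ j) \<noteq> 0" by (simp_all add: inner_axis inner_complex_def)
      qed
      then have znz: "z $ j \<noteq> 0" for j by (metis zero_complex.simps(1))
      define L where "L i = ln (cmod (z $ i))" for i
      have eL: "exp (L i) = cmod (z $ i)" for i using znz by (simp add: L_def)
      define m where "m = (\<Sum>i\<in>I. (real (a i) + 1) * (L i - \<xi> $ i)) + c * (\<Sum>i\<in>I. \<xi> $ i - L i) - K"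
      have \<tau>: "L i - \<xi> $ i \<le> 0" if "i \<in> I" for i
      proof -
        have "exp (L i) < exp (\<xi> $ i)" unfolding eL by (rule RI[OF True that])
        then show ?thesis by simp
      qed
      have m: "ereal m \<le> \<phi> z" unfolding m_def L_def by (rule low[OF True allI[OF znz]])
      have trm: "2 * real (a i) * L i - 2 * (1 + \<epsilon>) * ((real (a i) + 1) * (L i - \<xi> $ i) + c * (\<xi> $ i - L i))
         \<le> (2 * real (a i) * \<xi> $ i - (c1 - 2) * \<xi> $ i) + (c1 - 2) * L i" if i: "i \<in> I" for i
      proof -
        have "\<epsilon> * (real (a i) + 1) \<le> c1 / (2 * S) * S" using \<epsilon> S[OF i] S0 by (intro mult_mono) auto
        also have "\<dots> = c1 / 2" using S0 by simp
        finally have "2 * \<epsilon> * (real (a i) + 1) \<le> c1" by simp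
        moreover have "\<epsilon> * c \<ge> 0" using \<epsilon> c by simp
        ultimately have "c1 - 2 \<le> 2 * real (a i) - 2 * (1 + \<epsilon>) * (real (a i) + 1 - c)"
          using c1 by (simp add: algebra_simps)
        then have "(2 * real (a i) - 2 * (1 + \<epsilon>) * (real (a i) + 1 - c)) * (L i - \<xi> $ i) \<le> (c1 - 2) * (L i - \<xi> $ i)"
          using \<tau>[OF i] by (rule mult_right_mono_neg)
        then show ?thesis by (simp add: algebra_simps)
      qed
      have "(\<Sum>i\<in>I. 2 * real (a i) * L i) - 2 * ((1 + \<epsilon>) * m) =
        (\<Sum>i\<in>I. 2 * real (a i) * L i - 2 * (1 + \<epsilon>) * ((real (a i) + 1) * (L i - \<xi> $ i) + c * (\<xi> $ i - L i))) + 2 * (1 + \<epsilon>) * K"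
      proof -
        define S3 where "S3 = (\<Sum>i\<in>I. (real (a i) + 1) * (L i - \<xi> $ i) + c * (\<xi> $ i - L i))"
        have m3: "m = S3 - K" unfolding m_def S3_def sum.distrib sum_distrib_left ..
        show ?thesis unfolding sum_subtractf sum_distrib_left[symmetric] S3_def[symmetric] m3
          by (simp add: algebra_simps)
      qed
      also have "\<dots> \<le> (\<Sum>i\<in>I. (2 * real (a i) * \<xi> $ i - (c1 - 2) * \<xi> $ i) + (c1 - 2) * L i) + 2 * (1 + \<epsilon>) * K"
        by (intro add_right_mono sum_mono trm)
      also have "\<dots> = C + (\<Sum>i\<in>I. (c1 - 2) * L i)" unfolding sum.distrib C_def by simp
      finally have expo: "(\<Sum>i\<in>I. 2 * real (a i) * L i) - 2 * ((1 + \<epsilon>) * m) \<le> C + (\<Sum>i\<in>I. (c1 - 2) * L i)" .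
      have "(\<Prod>i\<in>I. cmod (z $ i) ^ a i)\<^sup>2 = (\<Prod>i\<in>I. exp (2 * real (a i) * L i))"
        unfolding prod_power_distrib
        by (intro prod.cong refl) (simp add: eL[symmetric] exp_of_nat_mult[symmetric] exp_double[symmetric] mult.assoc)
      then have P: "(\<Prod>i\<in>I. cmod (z $ i) ^ a i)\<^sup>2 = exp (\<Sum>i\<in>I. 2 * real (a i) * L i)" by (simp add: exp_sum)
      have "ennreal ((\<Prod>i\<in>I. cmod (z $ i) ^ a i)\<^sup>2) * exp_ereal (- 2 * (ereal (1 + \<epsilon>) * \<phi> z))
        \<le> ennreal (exp (\<Sum>i\<in>I. 2 * real (a i) * L i)) * ennreal (exp (- 2 * ((1 + \<epsilon>) * m)))"
        unfolding P using m \<epsilon> by (intro mult_left_mono exp_ereal_neg2_scaled_le) auto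
      also have "\<dots> = ennreal (exp ((\<Sum>i\<in>I. 2 * real (a i) * L i) - 2 * ((1 + \<epsilon>) * m)))"
        by (simp add: ennreal_mult'[symmetric] mult_exp_exp)
      also have "\<dots> \<le> ennreal (exp (C + (\<Sum>i\<in>I. (c1 - 2) * L i)))" using expo by (intro ennreal_leI) simp
      also have "\<dots> = ennreal (exp C) * ennreal (\<Prod>i\<in>I. cmod (z $ i) powr (c1 - 2))"
        by (simp add: exp_add exp_sum ennreal_mult' powr_def L_def znz)
      also have "ennreal (\<Prod>i\<in>I. cmod (z $ i) powr (c1 - 2)) \<le> (\<Prod>b\<in>Basis. f b (z \<bullet> b))"
      proof -
        have "ennreal (\<Prod>i\<in>I. cmod (z $ i) powr (c1 - 2)) = (\<Prod>i\<in>I. ennreal (cmod (z $ i) powr (c1 - 2)))"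
          by (rule prod_ennreal[symmetric]) auto
        also have "\<dots> = (\<Prod>j\<in>UNIV. if j \<in> I then ennreal (cmod (z $ j) powr (c1 - 2)) else 1)"
          by (rule prod.mono_neutral_cong_left) auto
        also have "\<dots> \<le> (\<Prod>j\<in>UNIV. f (axis j 1) (Re (z $ j)) * f (axis j \<i>) (Im (z $ j)))"
        proof (rule ennreal_prod_mono)
          fix j
          have R1: "\<bar>Re (z $ j)\<bar> \<le> cmod (z $ j)" "\<bar>Im (z $ j)\<bar> \<le> cmod (z $ j)"
            by (rule abs_Re_le_cmod abs_Im_le_cmod)+
          show "(if j \<in> I then ennreal (cmod (z $ j) powr (c1 - 2)) else 1)
            \<le> f (axis j 1) (Re (z $ j)) * f (axis j \<i>) (Im (z $ j))"
          proof (cases "j \<in> I")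
            case jI: True
            have "cmod (z $ j) < exp (\<xi> $ j)" by (rule RI[OF True jI])
            also have "\<dots> \<le> 1" using \<xi>[OF jI] by simp
            finally have "cmod (z $ j) < 1" .
            then have in1: "Re (z $ j) \<in> {-1..1}" "Im (z $ j) \<in> {-1..1}" using R1 by auto
            have "ennreal (cmod (z $ j) powr (c1 - 2)) \<le> ennreal (\<bar>Re (z $ j)\<bar> powr (c1/2 - 1) * \<bar>Im (z $ j)\<bar> powr (c1/2 - 1))"
              by (intro ennreal_leI norm_powr_le_Re_Im ReIm) (use c1 in auto)
            also have "\<dots> = ennreal (\<bar>Re (z $ j)\<bar> powr (c1/2 - 1)) * ennreal (\<bar>Im (z $ j)\<bar> powr (c1/2 - 1))"
              by (rule ennreal_mult') simp
            also have "\<dots> = f (axis j 1) (Re (z $ j)) * f (axis j \<i>) (Im (z $ j))"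
              using in1 jI by (simp add: f_def idx del: atLeastAtMost_iff)
            finally show ?thesis using jI by simp
          next
            case False
            have "Re (z $ j) \<in> {-B..B}" "Im (z $ j) \<in> {-B..B}" using R1 RB[OF True, of j] by auto
            then show ?thesis using False by (simp add: f_def idx del: atLeastAtMost_iff)
          qed
        qed
        finally show ?thesis unfolding prodf .
      qed
      finally show ?thesis using True by (simp add: mult_left_mono)
    qed simp
    have "(\<integral>\<^sup>+z. ennreal ((\<Prod>i\<in>I. cmod (z $ i) ^ a i)\<^sup>2) * exp_ereal (- 2 * (ereal (1 + \<epsilon>) * \<phi> z)) * indicator R z \<partial>lborel)
      \<le> (\<integral>\<^sup>+z. ennreal (exp C) * (\<Prod>b\<in>Basis. f b (z \<bullet> b)) \<partial>lborel)"
      by (rule nn_integral_mono_AE[OF AE_mp[OF AE_lborel_inner_Basis_nz AE_I2[OF impI[OF le]]]])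
    also have "\<dots> = ennreal (exp C) * (\<integral>\<^sup>+z. (\<Prod>b\<in>Basis. f b (z \<bullet> b)) \<partial>lborel)"
    proof (rule nn_integral_cmult)
      have "(\<lambda>z. f b (z \<bullet> b)) \<in> borel_measurable borel" for b
        by (rule measurable_compose[OF _ fmeas]) measurable
      then show "(\<lambda>z. \<Prod>b\<in>Basis. f b (z \<bullet> b)) \<in> borel_measurable lborel"
        by simp
    qed
    also have "(\<integral>\<^sup>+z. (\<Prod>b\<in>Basis. f b (z \<bullet> b)) \<partial>lborel) = (\<Prod>b\<in>Basis. \<integral>\<^sup>+t. f b t \<partial>lborel)"
      by (rule nn_integral_lborel_prod) (auto simp: fmeas)
    also have "ennreal (exp C) * \<dots> < \<infinity>"
    proof -
      have "(\<integral>\<^sup>+t. f b t \<partial>lborel) < \<infinity>" for b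
      proof (cases "idx b \<in> I")
        case True
        then show ?thesis using nn_integral_powr_finite[of "c1/2"] c1 by (simp add: f_def)
      next
        case False
        have "emeasure lborel {-B..B} < \<infinity>" by (cases "-B \<le> B") auto
        then show ?thesis using False by (simp add: f_def)
      qed
      then have "(\<Prod>b\<in>(Basis :: (complex^'n) set). \<integral>\<^sup>+t. f b t \<partial>lborel) < \<infinity>"
        by (intro ennreal_prod_less_top)
      then show ?thesis by (simp add: ennreal_mult_less_top)
    qed
    finally show "(\<integral>\<^sup>+z. ennreal ((\<Prod>i\<in>I. cmod (z $ i) ^ a i)\<^sup>2) * exp_ereal (- 2 * (ereal (1 + \<epsilon>) * \<phi> z)) * indicator R z \<partial>lborel) < \<infinity>" .
  qed
qed

subsection \<open>Strong openness\<close>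

lemma borel_measurable_exp_ereal [measurable]: "exp_ereal \<in> borel_measurable borel"
  unfolding exp_ereal_def[abs_def] by measurable

lemma borel_measurable_weighted:
  assumes tor: "toric_psh_on_polydisk r \<phi>" and V: "open V" "V \<subseteq> polydisk r" and f: "continuous_on V f"
  shows "(\<lambda>z. ennreal ((cmod (f z))\<^sup>2) * exp_ereal (- 2 * (ereal e * \<phi> z)) * indicator V z) \<in> borel_measurable borel"
proof -
  have Vs: "V \<in> sets borel" using V by simp
  have [measurable]: "\<phi> \<in> borel_measurable (restrict_space borel V)"
  proof (rule borel_measurableI_less)
    fix y
    have "{z \<in> space (restrict_space borel V). \<phi> z < y} = {z \<in> polydisk r. \<phi> z < y} \<inter> V"
      using V by (auto simp: space_restrict_space)
    then show "{z \<in> space (restrict_space borel V). \<phi> z < y} \<in> sets (restrict_space borel V)"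
      using Vs toric_usc(1)[OF tor, of y] by (auto simp: sets_restrict_space_iff)
  qed
  have [measurable]: "f \<in> borel_measurable (restrict_space borel V)"
    using f by (rule borel_measurable_continuous_on_restrict)
  have "(\<lambda>z. ennreal ((cmod (f z))\<^sup>2) * exp_ereal (- 2 * (ereal e * \<phi> z))) \<in> borel_measurable (restrict_space borel V)"
    by measurable
  then show ?thesis using Vs by (subst (asm) borel_measurable_restrict_space_iff_ennreal) auto
qed

lemma weighted_L2_on_iff:
  assumes tor: "toric_psh_on_polydisk r \<phi>" and V: "open V" "V \<subseteq> polydisk r" and f: "continuous_on V f"
  shows "weighted_L2_on V (\<lambda>z. ereal e * \<phi> z) f \<longleftrightarrow>
    (\<integral>\<^sup>+z. ennreal ((cmod (f z))\<^sup>2) * exp_ereal (- 2 * (ereal e * \<phi> z)) * indicator V z \<partial>lborel) < \<infinity>"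
proof -
  let ?g = "\<lambda>z. ennreal ((cmod (f z))\<^sup>2) * exp_ereal (- 2 * (ereal e * \<phi> z))"
  have "(\<lambda>z. ?g z * indicator V z) \<in> borel_measurable lborel"
    using borel_measurable_weighted[OF assms] by simp
  then have "(\<lambda>z. ?g z * indicator V z) \<in> borel_measurable lebesgue" by (rule measurable_completion)
  then have "?g \<in> borel_measurable (lebesgue_on V)"
    using V by (subst borel_measurable_restrict_space_iff_ennreal) auto
  moreover have "(\<integral>\<^sup>+z. ?g z \<partial>lebesgue_on V) = (\<integral>\<^sup>+z. ?g z * indicator V z \<partial>lborel)"
    using V by (subst nn_integral_restrict_space) (auto simp: nn_integral_completion)
  ultimately show ?thesis by (simp add: weighted_L2_on_def)
qed

lemma continuous_on_holomorphic_vec: "holomorphic_vec_on f U \<Longrightarrow> V \<subseteq> U \<Longrightarrow> continuous_on V f"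
  unfolding holomorphic_vec_on_def
  by (meson continuous_at_imp_continuous_on has_derivative_continuous subsetD)

lemma holomorphic_vec_on_subset: "holomorphic_vec_on f U \<Longrightarrow> open V \<Longrightarrow> V \<subseteq> U \<Longrightarrow> holomorphic_vec_on f V"
  by (auto simp: holomorphic_vec_on_def)

lemma holomorphic_on_slice:
  assumes f: "holomorphic_vec_on f U" and sub: "\<And>w. w \<in> S \<Longrightarrow> upd i w z \<in> U" and S: "open S"
  shows "(\<lambda>w. f (upd i w z)) holomorphic_on S"
  unfolding holomorphic_on_open[OF S]
proof (intro ballI)
  fix w assume "w \<in> S"
  then obtain f' where f': "(f has_derivative f') (at (upd i w z))" "Vector_Spaces.linear (*s) (*) f'"
    using f sub unfolding holomorphic_vec_on_def by blast
  have "((\<lambda>w. upd i w z) has_derivative (\<lambda>h. axis i h)) (at w)"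
  proof -
    have "linear (axis i :: complex \<Rightarrow> complex^'a)"
      by (rule linearI) (auto simp: vec_eq_iff axis_def)
    then have "((\<lambda>w. upd i 0 z + axis i w) has_derivative (\<lambda>h. axis i h)) (at w)"
      by (auto intro!: derivative_eq_intros bounded_linear_imp_has_derivative simp: linear_conv_bounded_linear)
    moreover have "upd i 0 z + axis i w = upd i w z" for w by (simp add: vec_eq_iff axis_def)
    ultimately show ?thesis by simp
  qed
  from has_derivative_compose[OF this f'(1)]
  have d: "((\<lambda>w. f (upd i w z)) has_derivative (\<lambda>h. f' (axis i h))) (at w)" .
  have "f' (axis i h) = f' (axis i 1) * h" for h
  proof -
    have "axis i h = h *s axis i (1::complex)" by (simp add: vec_eq_iff axis_def)
    then show ?thesis using f'(2) by (simp add: Vector_Spaces.linear_iff mult.commute)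
  qed
  then have "(\<lambda>h. f' (axis i h)) = (*) (f' (axis i 1))" by (rule ext)
  then have "((\<lambda>w. f (upd i w z)) has_field_derivative f' (axis i 1)) (at w)"
    using d by (simp only: has_field_derivative_def)
  then show "\<exists>f'. ((\<lambda>w. f (upd i w z)) has_field_derivative f') (at w)" ..
qed

lemma open_contains_cube:
  fixes x :: "complex^'n"
  assumes "open S" "x \<in> S"
  shows "\<exists>e>0. \<forall>z. (\<forall>i. cmod (z $ i - x $ i) < e) \<longrightarrow> z \<in> S"
proof -
  obtain d where d: "d > 0" "ball x d \<subseteq> S" using assms open_contains_ball by blast
  define e where "e = d / real (CARD('n))"
  have "z \<in> S" if "\<forall>i. cmod (z $ i - x $ i) < e" for z
  proof -
    have "norm (z - x) \<le> (\<Sum>i\<in>UNIV. cmod ((z - x) $ i))" unfolding norm_vec_def by (rule L2_set_le_sum) auto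
    also have "\<dots> < (\<Sum>i\<in>(UNIV::'n set). e)" using that by (intro sum_strict_mono) auto
    also have "\<dots> = d" by (simp add: e_def)
    finally have "z \<in> ball x d" by (simp add: dist_norm norm_minus_commute)
    then show ?thesis using d by auto
  qed
  moreover have "e > 0" using d by (simp add: e_def)
  ultimately show ?thesis by blast
qed

text \<open>Shrinking preserves each property, so the minimum of separately chosen values serves all
  indices; this is used both for radii and for \<epsilon>.\<close>

lemma finite_uniform_pos:
  fixes P :: "'i \<Rightarrow> real \<Rightarrow> bool"
  assumes "finite X" "\<And>j. j \<in> X \<Longrightarrow> \<exists>d>0. P j d" "\<And>j d d'. P j d \<Longrightarrow> 0 < d' \<Longrightarrow> d' \<le> d \<Longrightarrow> P j d'"
  shows "\<exists>d>0. \<forall>j\<in>X. P j d"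
  using assms(1,2)
proof (induction X)
  case (insert j X)
  then obtain d1 d2 where "d1 > 0" "P j d1" "d2 > 0" "\<forall>j\<in>X. P j d2" by (metis insertI1 insertI2)
  then show ?case using assms(3)[of _ d1 "min d1 d2"] assms(3)[of _ d2 "min d1 d2"]
    by (intro exI[of _ "min d1 d2"]) auto
qed (auto intro: exI[of _ 1])

lemma weighted_L2_on_strong_openness:
  fixes \<phi> :: "complex^'n \<Rightarrow> ereal"
  assumes tor: "toric_psh_on_polydisk r \<phi>" and x: "x \<in> U" and U: "open U" "U \<subseteq> polydisk r"
    and f: "holomorphic_vec_on f U" and L2: "weighted_L2_on U \<phi> f"
  obtains \<epsilon> V where "\<epsilon> > 0" "open V" "x \<in> V" "V \<subseteq> U" "weighted_L2_on V (\<lambda>z. ereal (1 + \<epsilon>) * \<phi> z) f"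
proof -
  define I where "I = {i. x $ i = 0}"
  have "\<phi> x < \<infinity>" using toric_usc(2)[OF tor] x U by blast
  then obtain C0 where C0: "\<phi> x < ereal C0" using ereal_dense2 by blast
  define M where "M = cmod (f x) + 1"
  have M: "M \<ge> 0" by (simp add: M_def)
  define S where "S = {z \<in> polydisk r. \<phi> z < ereal C0} \<inter> (U \<inter> f -` ball 0 M)"
  have "open S" unfolding S_def
    by (intro open_Int toric_usc(1)[OF tor] continuous_open_preimage[OF continuous_on_holomorphic_vec[OF f order_refl]] U) auto
  moreover have "x \<in> S" using x U C0 by (auto simp: S_def M_def)
  ultimately obtain e0 where e0: "e0 > 0" "\<forall>z. (\<forall>i. cmod (z $ i - x $ i) < e0) \<longrightarrow> z \<in> S"
    using open_contains_cube by blast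
  define e where "e = min e0 1"
  have e: "0 < e" "e \<le> 1" and eS: "\<And>z. (\<And>i. cmod (z $ i - x $ i) < e) \<Longrightarrow> z \<in> S"
    using e0 by (auto simp: e_def)
  \<comment> \<open>Half of \<open>e\<close>, so that points with modulus exactly
    \<open>\<rho>\<close> in a direction of \<open>I\<close> still belong to the good neighbourhood;
    \<open>e \<le> 1\<close> makes \<open>ln \<rho>\<close> negative, as the final integration
    needs.\<close>
  define \<rho> where "\<rho> = e / 2"
  have rho: "\<rho> > 0" "\<rho> < e" using e by (auto simp: \<rho>_def)
  define \<xi> :: "real^'n" where "\<xi> = (\<chi> i. if i \<in> I then ln \<rho> else ln (cmod (x $ i)))"
  have \<xi>I: "exp (\<xi> $ i) = \<rho>" if "i \<in> I" for i using that rho by (simp add: \<xi>_def)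
  have \<xi>J: "exp (\<xi> $ i) = cmod (x $ i)" "x $ i \<noteq> 0" if "i \<notin> I" for i using that by (auto simp: \<xi>_def I_def)
  have "\<exists>d>0. \<forall>j\<in>-I. \<forall>t. \<bar>t - \<xi> $ j\<bar> < 3 * d \<longrightarrow> \<bar>exp t - exp (\<xi> $ j)\<bar> < e"
  proof (rule finite_uniform_pos)
    fix j
    have "isCont exp (\<xi> $ j)" by simp
    then obtain d where "d > 0" "\<forall>t. dist t (\<xi> $ j) < d \<longrightarrow> dist (exp t) (exp (\<xi> $ j)) < e"
      using e(1) unfolding continuous_at_eps_delta by blast
    then show "\<exists>d>0. \<forall>t. \<bar>t - \<xi> $ j\<bar> < 3 * d \<longrightarrow> \<bar>exp t - exp (\<xi> $ j)\<bar> < e"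
      by (intro exI[of _ "d/3"]) (auto simp: dist_real_def)
  next
    fix j d d' assume "\<forall>t. \<bar>t - \<xi> $ j\<bar> < 3 * d \<longrightarrow> \<bar>exp t - exp (\<xi> $ j)\<bar> < e" "d' \<le> (d::real)"
    then show "\<forall>t. \<bar>t - \<xi> $ j\<bar> < 3 * d' \<longrightarrow> \<bar>exp t - exp (\<xi> $ j)\<bar> < e" by (meson mult_left_mono order_less_le_trans zero_le_numeral)
  qed simp
  then obtain \<delta> where \<delta>: "\<delta> > 0" "\<And>j t. j \<notin> I \<Longrightarrow> \<bar>t - \<xi> $ j\<bar> < 3 * \<delta> \<Longrightarrow> \<bar>exp t - exp (\<xi> $ j)\<bar> < e" by auto
  have "\<exists>d>0. \<forall>j\<in>-I. \<forall>w. cmod (w - x $ j) < d \<longrightarrow> w \<noteq> 0 \<and> \<bar>ln (cmod w) - \<xi> $ j\<bar> < \<delta>"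
  proof (rule finite_uniform_pos)
    fix j assume j: "j \<in> - I"
    then have xj: "x $ j \<noteq> 0" by (simp add: I_def)
    then have "isCont (\<lambda>w. ln (cmod w)) (x $ j)" by (intro continuous_intros) auto
    then obtain d where d: "d > 0" "\<forall>w. dist w (x $ j) < d \<longrightarrow> dist (ln (cmod w)) (ln (cmod (x $ j))) < \<delta>"
      using \<delta>(1) unfolding continuous_at_eps_delta by blast
    show "\<exists>d>0. \<forall>w. cmod (w - x $ j) < d \<longrightarrow> w \<noteq> 0 \<and> \<bar>ln (cmod w) - \<xi> $ j\<bar> < \<delta>"
    proof (intro exI[of _ "min d (cmod (x $ j))"] conjI allI impI)
      show "0 < min d (cmod (x $ j))" using d xj by simp
      fix w assume w: "cmod (w - x $ j) < min d (cmod (x $ j))"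
      show "w \<noteq> 0" using w by auto
      show "\<bar>ln (cmod w) - \<xi> $ j\<bar> < \<delta>" using w d j by (simp add: \<xi>_def dist_norm)
    qed
  next
    fix j and d d' :: real
    assume H: "\<forall>w. cmod (w - x $ j) < d \<longrightarrow> w \<noteq> 0 \<and> \<bar>ln (cmod w) - \<xi> $ j\<bar> < \<delta>" and "d' \<le> d"
    then show "\<forall>w. cmod (w - x $ j) < d' \<longrightarrow> w \<noteq> 0 \<and> \<bar>ln (cmod w) - \<xi> $ j\<bar> < \<delta>"
      using order_less_le_trans by blast
  qed simp
  then obtain d0 where d0: "d0 > 0" "\<And>j w. j \<notin> I \<Longrightarrow> cmod (w - x $ j) < d0 \<Longrightarrow> w \<noteq> 0 \<and> \<bar>ln (cmod w) - \<xi> $ j\<bar> < \<delta>" by auto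
  define dJ where "dJ = min d0 e"
  have dJ: "dJ > 0" "dJ \<le> e" using d0 e by (auto simp: dJ_def)
  have dJ0: "w \<noteq> 0 \<and> \<bar>ln (cmod w) - \<xi> $ j\<bar> < \<delta>" if "j \<notin> I" "cmod (w - x $ j) < dJ" for j w
    using d0(2)[OF that(1)] that(2) by (simp add: dJ_def)
  have domC0: "exp (t $ i) < r" "\<phi> (cexp t) \<le> ereal C0"
    if tI: "\<And>i. i \<in> I \<Longrightarrow> t $ i \<le> \<xi> $ i" and tJ: "\<And>j. j \<notin> I \<Longrightarrow> \<bar>t $ j - \<xi> $ j\<bar> < 3 * \<delta>" for t i
  proof -
    \<comment> \<open>\<open>S\<close> is a neighbourhood of \<open>x\<close>, not of its torus
      orbit. Hence \<open>t\<close> is realised by a point with the phases of \<open>x\<close> in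
      the nonzero coordinates, and toric invariance moves the bound to
      \<open>cexp t\<close>.\<close>
    define z :: "complex^'n" where "z = (\<chi> i. if i \<in> I then of_real (exp (t $ i)) else of_real (exp (t $ i)) * sgn (x $ i))"
    have nz: "cmod (z $ i) = exp (t $ i)" for i using \<xi>J(2)[of i] by (simp add: z_def norm_mult norm_sgn)
    have "z \<in> S"
    proof (rule eS)
      fix i show "cmod (z $ i - x $ i) < e"
      proof (cases "i \<in> I")
        case True
        then have "x $ i = 0" by (simp add: I_def)
        then have "cmod (z $ i - x $ i) = exp (t $ i)" using nz by simp
        also have "\<dots> \<le> exp (\<xi> $ i)" using tI[OF True] by simp
        finally show ?thesis using \<xi>I[OF True] rho by simp
      next
        case False
        have "x $ i = of_real (exp (\<xi> $ i)) * sgn (x $ i)" unfolding \<xi>J(1)[OF False] by (simp add: sgn_eq)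
        then have "z $ i - x $ i = of_real (exp (t $ i) - exp (\<xi> $ i)) * sgn (x $ i)"
          using False by (simp add: z_def algebra_simps)
        then have "cmod (z $ i - x $ i) = \<bar>exp (t $ i) - exp (\<xi> $ i)\<bar>"
          using \<xi>J(2)[OF False] by (simp add: norm_mult norm_sgn del: of_real_diff)
        then show ?thesis using \<delta>(2)[OF False tJ[OF False]] by simp
      qed
    qed
    then have zp: "z \<in> polydisk r" and zC: "\<phi> z < ereal C0" by (auto simp: S_def)
    have "z $ i \<noteq> 0" for i using nz[of i] by (metis exp_not_eq_zero norm_zero)
    then have "\<phi> z = \<phi> (cexp (\<chi> i. ln (cmod (z $ i))))" by (rule toric_eq_cexp[OF tor zp])
    also have "(\<chi> i. ln (cmod (z $ i))) = t" by (simp add: nz vec_eq_iff)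
    finally show "\<phi> (cexp t) \<le> ereal C0" using zC by simp
    show "exp (t $ i) < r" using zp nz by (metis mem_Collect_eq polydisk_def)
  qed
  define R where "R = {z :: complex^'n. (\<forall>i\<in>I. cmod (z $ i) < \<rho>) \<and> (\<forall>j. j \<notin> I \<longrightarrow> cmod (z $ j - x $ j) < dJ)}"
  \<comment> \<open>Domination by monomials is available only up to half the radius, so the final
    neighbourhood is \<open>R'\<close>.\<close>
  define R' where "R' = {z :: complex^'n. (\<forall>i\<in>I. cmod (z $ i) < \<rho> / 2) \<and> (\<forall>j. j \<notin> I \<longrightarrow> cmod (z $ j - x $ j) < dJ)}"
  have opR: "open {z :: complex^'n. (\<forall>i\<in>I. cmod (z $ i) < s) \<and> (\<forall>j. j \<notin> I \<longrightarrow> cmod (z $ j - x $ j) < dJ)}" for s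
  proof -
    have "{z :: complex^'n. (\<forall>i\<in>I. cmod (z $ i) < s) \<and> (\<forall>j. j \<notin> I \<longrightarrow> cmod (z $ j - x $ j) < dJ)}
      = (\<Inter>i\<in>I. {z. cmod (z $ i) < s}) \<inter> (\<Inter>j\<in>-I. {z. cmod (z $ j - x $ j) < dJ})" by auto
    also have "open \<dots>" by (intro open_Int open_INT ballI open_Collect_less continuous_intros) auto
    finally show ?thesis .
  qed
  have openR: "open R" "open R'" unfolding R_def R'_def by (rule opR)+
  have R'R: "R' \<subseteq> R" using rho by (fastforce simp: R_def R'_def)
  have RS: "R \<subseteq> S"
  proof
    fix z assume z: "z \<in> R"
    show "z \<in> S"
    proof (rule eS)
      fix i show "cmod (z $ i - x $ i) < e"
      proof (cases "i \<in> I")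
        case True
        then have "cmod (z $ i) < \<rho>" "x $ i = 0" using z by (auto simp: R_def I_def)
        then show ?thesis using rho by simp
      next
        case False
        then have "cmod (z $ i - x $ i) < dJ" using z by (auto simp: R_def)
        then show ?thesis using dJ by simp
      qed
    qed
  qed
  have RU: "R \<subseteq> U" and Rp: "R \<subseteq> polydisk r" and RM: "\<And>z. z \<in> R \<Longrightarrow> cmod (f z) < M"
    using RS by (auto simp: S_def)
  have xR': "x \<in> R'" using rho dJ by (auto simp: R'_def I_def)
  interpret Reinhardt_slices I \<rho> R
    by unfold_locales (use rho openR in \<open>auto simp: R_def\<close>)
  have contf: "continuous_on R f" by (rule continuous_on_holomorphic_vec[OF f RU])
  have sl: "slice_holo M f" unfolding slice_holo_def
  proof (intro conjI ballI contf)
    show "cmod (f z) \<le> M" if "z \<in> R" for z using RM[OF that] by simp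
    show "(\<lambda>w. f (upd i w z)) holomorphic_on ball 0 \<rho>" if "i \<in> I" "z \<in> R" for i z
      by (rule holomorphic_on_slice[OF f]) (use R_upd[OF that(2,1)] RU in auto)
  qed
  define w where "w z = exp_ereal (- 2 * \<phi> z) * indicator R z" for z
  have weight: "torus_weight w" unfolding torus_weight_def
  proof (intro conjI allI impI)
    have "(\<lambda>z. ennreal ((cmod (1::complex))\<^sup>2) * exp_ereal (- 2 * (ereal 1 * \<phi> z)) * indicator R z) \<in> borel_measurable borel"
      by (rule borel_measurable_weighted[OF tor openR(1) Rp]) simp
    then show "w \<in> borel_measurable borel" unfolding w_def[abs_def] by (simp flip: one_ereal_def)
    show "w z = 0" if "z \<notin> R" for z using that by (simp add: w_def)
    fix c z assume c: "\<forall>j. cmod (c j) = 1" "\<forall>j. j \<notin> I \<longrightarrow> c j = 1"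
    have DR: "dscale c z \<in> R \<longleftrightarrow> z \<in> R" using c by (auto simp: R_def norm_mult)
    show "w (dscale c z) = w z"
    proof (cases "z \<in> R")
      case True
      have "cis (Arg (c j)) = c j" for j using rcis_cmod_Arg[of "c j"] c(1) by (simp add: rcis_def)
      then have "dscale c z = (\<chi> i. cis ((\<chi> j. Arg (c j)) $ i) * z $ i)" by (simp add: dscale_def)
      moreover have "\<phi> (\<chi> i. cis ((\<chi> j. Arg (c j)) $ i) * z $ i) = \<phi> z"
        using tor True Rp unfolding toric_psh_on_polydisk_def by blast
      ultimately have "\<phi> (dscale c z) = \<phi> z" by (simp only:)
      then show ?thesis using True DR by (simp add: w_def)
    qed (use DR in \<open>simp add: w_def\<close>)
  qed
  have fw: "(\<integral>\<^sup>+z. ennreal ((cmod (f z))\<^sup>2) * w z \<partial>lborel) < \<infinity>"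
  proof -
    have "weighted_L2_on U (\<lambda>z. ereal 1 * \<phi> z) f" using L2 by (simp flip: one_ereal_def)
    then have "(\<integral>\<^sup>+z. ennreal ((cmod (f z))\<^sup>2) * exp_ereal (- 2 * (ereal 1 * \<phi> z)) * indicator U z \<partial>lborel) < \<infinity>"
      by (subst (asm) weighted_L2_on_iff[OF tor U continuous_on_holomorphic_vec[OF f order_refl]])
    moreover have "(\<integral>\<^sup>+z. ennreal ((cmod (f z))\<^sup>2) * w z \<partial>lborel)
      \<le> (\<integral>\<^sup>+z. ennreal ((cmod (f z))\<^sup>2) * exp_ereal (- 2 * (ereal 1 * \<phi> z)) * indicator U z \<partial>lborel)"
      using RU by (intro nn_integral_mono) (auto simp: w_def simp flip: one_ereal_def split: split_indicator)
    ultimately show ?thesis by (rule order_le_less_trans[rotated])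
  qed
  obtain l where l: "set l = I" "distinct l" using finite_distinct_list[of I] by auto
  obtain A C where A: "finite A" "C \<ge> 0" "\<And>a. a \<in> A \<Longrightarrow> \<exists>p\<in>R. taylor_coeffs l a f p \<noteq> 0"
    "\<And>z. z \<in> R \<Longrightarrow> \<forall>i\<in>I. z $ i \<noteq> 0 \<and> cmod (z $ i) \<le> \<rho> / 2 \<Longrightarrow>
      cmod (f z) \<le> C * (\<Sum>a\<in>A. \<Prod>i\<in>I. cmod (z $ i) ^ a i)"
    by (rule slice_holo_growth[OF sl l M]) (rule that)
  have mono_ex: "\<exists>\<epsilon>0>0. \<forall>\<epsilon>. 0 < \<epsilon> \<longrightarrow> \<epsilon> \<le> \<epsilon>0 \<longrightarrow>
    (\<integral>\<^sup>+z. ennreal ((\<Prod>i\<in>I. cmod (z $ i) ^ a i)\<^sup>2) * exp_ereal (- 2 * (ereal (1 + \<epsilon>) * \<phi> z)) * indicator R' z \<partial>lborel) < \<infinity>"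
    if a: "a \<in> A" for a
  proof -
    define g where "g = taylor_coeffs l a f"
    obtain p where p: "p \<in> R" "g p \<noteq> 0" using A(3)[OF a] by (auto simp: g_def)
    have contg: "continuous_on R g"
      using slice_holo_taylor_coeffs[OF sl _ l(2), of a] l by (simp add: slice_holo_def g_def)
    have "open (R \<inter> g -` (- cball 0 (cmod (g p) / 2)))"
      by (rule continuous_open_preimage[OF contg openR(1)]) auto
    moreover have "p \<in> R \<inter> g -` (- cball 0 (cmod (g p) / 2))" using p by auto
    ultimately obtain \<eta> where \<eta>: "\<eta> > 0" "\<forall>z. (\<forall>i. cmod (z $ i - p $ i) < \<eta>) \<longrightarrow> z \<in> R \<inter> g -` (- cball 0 (cmod (g p) / 2))"
      using open_contains_cube by blast
    define W where "W = {z :: complex^'n. (\<forall>i\<in>I. cmod (z $ i) < exp (\<xi> $ i)) \<and> (\<forall>j. j \<notin> I \<longrightarrow> cmod (z $ j - p $ j) < \<eta>)}"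
    have W: "z \<in> R \<and> cmod (g z) > cmod (g p) / 2" if z: "z \<in> W" for z
    proof -
      \<comment> \<open>\<open>g\<close> does not depend on the coordinates in \<open>I\<close>.
        Replacing them by those of \<open>p\<close> shows that the lower bound for \<open>g\<close>
        near \<open>p\<close> holds over the full discs of radius \<open>\<rho>\<close>.\<close>
      define z' where "z' = (\<chi> i. if i \<in> I then p $ i else z $ i)"
      have "z' \<in> R \<inter> g -` (- cball 0 (cmod (g p) / 2))"
        by (rule \<eta>(2)[rule_format]) (use z \<eta>(1) in \<open>auto simp: z'_def W_def\<close>)
      then have z': "z' \<in> R" "cmod (g z') > cmod (g p) / 2" by auto
      have "g z = g z'" unfolding g_def by (rule taylor_coeffs_eq_off) (simp add: z'_def l)
      moreover have "z \<in> R" using z z'(1) \<xi>I by (auto simp: R_def W_def z'_def)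
      ultimately show ?thesis using z' by simp
    qed
    have opW: "open W"
    proof -
      have "W = (\<Inter>i\<in>I. {z. cmod (z $ i) < exp (\<xi> $ i)}) \<inter> (\<Inter>j\<in>-I. {z. cmod (z $ j - p $ j) < \<eta>})" by (auto simp: W_def)
      also have "open \<dots>" by (intro open_Int open_INT ballI open_Collect_less continuous_intros) auto
      finally show ?thesis .
    qed
    define F where "F = (\<lambda>z. ennreal ((\<Prod>i\<in>I. cmod (z $ i) ^ a i)\<^sup>2) * exp_ereal (- 2 * \<phi> z) * indicator W z)"
    have F_meas: "F \<in> borel_measurable borel"
    proof -
      have "(\<lambda>z. ennreal ((cmod (of_real (\<Prod>i\<in>I. cmod (z $ i) ^ a i)))\<^sup>2) * exp_ereal (- 2 * (ereal 1 * \<phi> z)) * indicator W z) \<in> borel_measurable borel"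
        by (rule borel_measurable_weighted[OF tor opW]) (use W Rp in \<open>auto intro!: continuous_intros\<close>)
      then show ?thesis unfolding F_def norm_of_real power2_abs by (simp flip: one_ereal_def)
    qed
    have F_fin: "(\<integral>\<^sup>+z. F z \<partial>lborel) < \<infinity>"
    proof -
      \<comment> \<open>On \<open>W\<close> the squared modulus of the coefficient exceeds
        \<open>1 / ?k\<close>, so the bare monomial is controlled by the Taylor term.\<close>
      let ?k = "4 / (cmod (g p))\<^sup>2"
      let ?G = "\<lambda>z. ennreal ((cmod ((\<Prod>i\<in>set l. (z $ i) ^ a i) * taylor_coeffs l a f z))\<^sup>2) * w z"
      have "F z \<le> ennreal ?k * ?G z" for z
      proof (cases "z \<in> W")
        case True
        define q where "q = (\<Prod>i\<in>I. cmod (z $ i) ^ a i)\<^sup>2"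
        have "(cmod (g p) / 2)\<^sup>2 \<le> (cmod (g z))\<^sup>2" using W[OF True] by (intro power_mono) auto
        then have "1 \<le> ?k * (cmod (g z))\<^sup>2" using p(2) by (simp add: field_simps power_divide)
        then have "q * 1 \<le> q * (?k * (cmod (g z))\<^sup>2)" by (intro mult_left_mono) (auto simp: q_def)
        also have "\<dots> = ?k * (cmod ((\<Prod>i\<in>set l. (z $ i) ^ a i) * taylor_coeffs l a f z))\<^sup>2"
          unfolding q_def g_def l by (simp add: norm_mult power_mult_distrib prod_norm[symmetric] norm_power)
        finally have "ennreal q \<le> ennreal (?k * (cmod ((\<Prod>i\<in>set l. (z $ i) ^ a i) * taylor_coeffs l a f z))\<^sup>2)"
          by (intro ennreal_leI) simp
        also have "\<dots> = ennreal ?k * ennreal ((cmod ((\<Prod>i\<in>set l. (z $ i) ^ a i) * taylor_coeffs l a f z))\<^sup>2)"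
          by (rule ennreal_mult') simp
        finally have "ennreal q * exp_ereal (- 2 * \<phi> z) \<le> ennreal ?k * ennreal ((cmod ((\<Prod>i\<in>set l. (z $ i) ^ a i) * taylor_coeffs l a f z))\<^sup>2) * exp_ereal (- 2 * \<phi> z)"
          by (rule mult_right_mono) simp
        moreover have "w z = exp_ereal (- 2 * \<phi> z)" using W[OF True] by (simp add: w_def)
        ultimately show ?thesis using True by (simp only: F_def q_def indicator_simps mult_1_right mult.assoc)
      qed (simp add: F_def)
      then have "(\<integral>\<^sup>+z. F z \<partial>lborel) \<le> (\<integral>\<^sup>+z. ennreal ?k * ?G z \<partial>lborel)" by (intro nn_integral_mono)
      also have "\<dots> = ennreal ?k * (\<integral>\<^sup>+z. ?G z \<partial>lborel)"
      proof (rule nn_integral_cmult)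
        have "continuous_on R (\<lambda>z. (\<Prod>i\<in>set l. (z $ i) ^ a i) * taylor_coeffs l a f z)"
          using contg unfolding g_def by (intro continuous_intros)
        from borel_measurable_weighted[OF tor openR(1) Rp this, of 1]
        show "?G \<in> borel_measurable lborel" by (simp add: w_def mult.assoc flip: one_ereal_def)
      qed
      also have "\<dots> \<le> ennreal ?k * (\<integral>\<^sup>+z. ennreal ((cmod (f z))\<^sup>2) * w z \<partial>lborel)"
        by (intro mult_left_mono nn_integral_taylor_coeffs_le[OF sl _ l(2) weight]) (use l in auto)
      also have "\<dots> < \<infinity>" using fw by (simp add: ennreal_mult_less_top)
      finally show ?thesis .
    qed
    have WJ: "z $ j \<noteq> 0 \<and> \<bar>ln (cmod (z $ j)) - \<xi> $ j\<bar> < \<delta>" if "z \<in> W" "j \<notin> I" for z j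
      using W[OF that(1)] that(2) by (intro dJ0) (auto simp: R_def)
    \<comment> \<open>The dependence on \<open>p\<close> ends here: the growth bound holds at the
      logarithms of all points of \<open>R'\<close> with nonzero coordinates.\<close>
    have "\<exists>c>0. \<exists>K. \<forall>y. (\<forall>i\<in>I. y $ i < \<xi> $ i) \<longrightarrow> (\<forall>j. j \<notin> I \<longrightarrow> \<bar>y $ j - \<xi> $ j\<bar> < \<delta>) \<longrightarrow>
     ereal ((\<Sum>i\<in>I. (real (a i) + 1) * (y $ i - \<xi> $ i)) + c * (\<Sum>i\<in>I. \<xi> $ i - y $ i) - K) \<le> \<phi> (cexp y)"
      by (rule toric_coercive[OF tor \<eta>(1) \<delta>(1) _ _ W_def _ F_def F_meas F_fin]; (rule domC0 WJ)?)
    then obtain c K where c: "c > 0" and K: "\<And>y. \<forall>i\<in>I. y $ i < \<xi> $ i \<Longrightarrow> \<forall>j. j \<notin> I \<longrightarrow> \<bar>y $ j - \<xi> $ j\<bar> < \<delta> \<Longrightarrow>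
     ereal ((\<Sum>i\<in>I. (real (a i) + 1) * (y $ i - \<xi> $ i)) + c * (\<Sum>i\<in>I. \<xi> $ i - y $ i) - K) \<le> \<phi> (cexp y)"
      by blast
    have \<xi>0: "\<xi> $ i \<le> 0" if "i \<in> I" for i using that e rho by (simp add: \<xi>_def \<rho>_def)
    have R'I: "cmod (z $ i) < exp (\<xi> $ i)" if "z \<in> R'" "i \<in> I" for z i
      using that R'R \<xi>I[OF that(2)] by (auto simp: R_def)
    have R'B: "cmod (z $ i) \<le> norm x + 1" if "z \<in> R'" for z i
    proof -
      have "z \<in> R" using that R'R by auto
      have "cmod (z $ i - x $ i) \<le> 1"
      proof (cases "i \<in> I")
        case True
        then have "cmod (z $ i) < \<rho>" "x $ i = 0" using \<open>z \<in> R\<close> by (auto simp: R_def I_def)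
        then have "cmod (z $ i - x $ i) < \<rho>" by simp
        then show ?thesis using rho e by linarith
      next
        case False
        then have "cmod (z $ i - x $ i) < dJ" using \<open>z \<in> R\<close> by (auto simp: R_def)
        then show ?thesis using dJ e by simp
      qed
      moreover have "cmod (z $ i) \<le> cmod (z $ i - x $ i) + cmod (x $ i)" by (metis diff_add_cancel norm_triangle_ineq)
      moreover have "cmod (x $ i) \<le> norm x" by (rule Finite_Cartesian_Product.norm_nth_le)
      ultimately show ?thesis by linarith
    qed
    have low: "ereal ((\<Sum>i\<in>I. (real (a i) + 1) * (ln (cmod (z $ i)) - \<xi> $ i)) + c * (\<Sum>i\<in>I. \<xi> $ i - ln (cmod (z $ i))) - K) \<le> \<phi> z"
      if z: "z \<in> R'" "\<forall>i. z $ i \<noteq> 0" for z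
    proof -
      define y where "y = (\<chi> i. ln (cmod (z $ i)))"
      have zR: "z \<in> R" using z R'R by auto
      have "\<phi> z = \<phi> (cexp y)" unfolding y_def by (rule toric_eq_cexp[OF tor _ z(2)[rule_format]]) (use zR Rp in auto)
      moreover have "ereal ((\<Sum>i\<in>I. (real (a i) + 1) * (y $ i - \<xi> $ i)) + c * (\<Sum>i\<in>I. \<xi> $ i - y $ i) - K) \<le> \<phi> (cexp y)"
      proof (rule K; intro ballI allI impI)
        fix i assume i: "i \<in> I"
        have "ln (cmod (z $ i)) < ln (exp (\<xi> $ i))" using R'I[OF z(1) i] z(2)[rule_format, of i] by (subst ln_less_cancel_iff) auto
        then show "y $ i < \<xi> $ i" by (simp add: y_def)
      next
        fix j assume "j \<notin> I"
        then show "\<bar>y $ j - \<xi> $ j\<bar> < \<delta>" using dJ0[of j "z $ j"] zR by (simp add: y_def R_def)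
      qed
      ultimately show ?thesis by (simp add: y_def)
    qed
    show ?thesis
      by (rule nn_integral_finite_of_coercive[OF c, where \<xi>=\<xi> and B="norm x + 1" and K=K]) (fact \<xi>0 R'I R'B low)+
  qed
  \<comment> \<open>Integrability for every smaller exponent is part of the statement, so that a
    minimum over the finite set \<open>A\<close> is admissible.\<close>
  have "\<exists>\<epsilon>>0. \<forall>a\<in>A. \<forall>\<epsilon>'. 0 < \<epsilon>' \<longrightarrow> \<epsilon>' \<le> \<epsilon> \<longrightarrow>
    (\<integral>\<^sup>+z. ennreal ((\<Prod>i\<in>I. cmod (z $ i) ^ a i)\<^sup>2) * exp_ereal (- 2 * (ereal (1 + \<epsilon>') * \<phi> z)) * indicator R' z \<partial>lborel) < \<infinity>"
    by (rule finite_uniform_pos[OF A(1) mono_ex]) (auto intro: order_trans)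
  then obtain \<epsilon> where \<epsilon>: "\<epsilon> > 0" and fin: "\<And>a. a \<in> A \<Longrightarrow>
    (\<integral>\<^sup>+z. ennreal ((\<Prod>i\<in>I. cmod (z $ i) ^ a i)\<^sup>2) * exp_ereal (- 2 * (ereal (1 + \<epsilon>) * \<phi> z)) * indicator R' z \<partial>lborel) < \<infinity>"
    by blast
  have R'p: "R' \<subseteq> polydisk r" and R'U: "R' \<subseteq> U" using R'R Rp RU by auto
  let ?e = "\<lambda>z. exp_ereal (- 2 * (ereal (1 + \<epsilon>) * \<phi> z))"
  let ?m = "\<lambda>a z. \<Prod>i\<in>I. cmod (z $ i) ^ a i"
  have ptw: "ennreal ((cmod (f z))\<^sup>2) * ?e z * indicator R' z \<le>
      (\<Sum>a\<in>A. ennreal (C\<^sup>2 * card A) * (ennreal ((?m a z)\<^sup>2) * ?e z * indicator R' z))"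
    if nz: "\<forall>b\<in>Basis. z \<bullet> b \<noteq> 0" for z
  proof (cases "z \<in> R'")
    case True
    have znz: "z $ j \<noteq> 0" for j
    proof -
      have "axis j 1 \<in> (Basis :: (complex^'n) set)" by (auto simp: Basis_vec_def Basis_complex_def)
      then have "z \<bullet> axis j 1 \<noteq> 0" using nz by blast
      then show ?thesis by (auto simp: inner_axis)
    qed
    have "cmod (f z) \<le> C * (\<Sum>a\<in>A. ?m a z)"
      by (rule A(4)) (use True R'R znz in \<open>auto simp: R'_def less_imp_le\<close>)
    then have "(cmod (f z))\<^sup>2 \<le> (C * (\<Sum>a\<in>A. ?m a z))\<^sup>2" by (rule power_mono) simp
    also have "\<dots> = C\<^sup>2 * (\<Sum>a\<in>A. 1 * ?m a z)\<^sup>2" by (simp add: power_mult_distrib)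
    also have "\<dots> \<le> C\<^sup>2 * ((\<Sum>a\<in>A. 1\<^sup>2) * (\<Sum>a\<in>A. (?m a z)\<^sup>2))"
      by (intro mult_left_mono Cauchy_Schwarz_ineq_sum) auto
    also have "\<dots> = (\<Sum>a\<in>A. (C\<^sup>2 * card A) * (?m a z)\<^sup>2)" by (simp add: sum_distrib_left mult.assoc)
    finally have "ennreal ((cmod (f z))\<^sup>2) \<le> (\<Sum>a\<in>A. ennreal ((C\<^sup>2 * card A) * (?m a z)\<^sup>2))"
      by (subst sum_ennreal) (auto intro: ennreal_leI)
    also have "\<dots> = (\<Sum>a\<in>A. ennreal (C\<^sup>2 * card A) * ennreal ((?m a z)\<^sup>2))"
      by (intro sum.cong refl ennreal_mult') auto
    finally have "ennreal ((cmod (f z))\<^sup>2) * ?e z \<le> (\<Sum>a\<in>A. ennreal (C\<^sup>2 * card A) * ennreal ((?m a z)\<^sup>2)) * ?e z"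
      by (rule mult_right_mono) simp
    then show ?thesis using True by (simp only: indicator_simps mult_1_right sum_distrib_right mult.assoc)
  qed simp
  have meas: "(\<lambda>z. ennreal ((?m a z)\<^sup>2) * ?e z * indicator R' z) \<in> borel_measurable borel" for a
  proof -
    have "(\<lambda>z. ennreal ((cmod (of_real (?m a z)))\<^sup>2) * ?e z * indicator R' z) \<in> borel_measurable borel"
      by (rule borel_measurable_weighted[OF tor openR(2) R'p]) (intro continuous_intros)
    then show ?thesis unfolding norm_of_real power2_abs .
  qed
  have "(\<integral>\<^sup>+z. ennreal ((cmod (f z))\<^sup>2) * ?e z * indicator R' z \<partial>lborel)
    \<le> (\<integral>\<^sup>+z. (\<Sum>a\<in>A. ennreal (C\<^sup>2 * card A) * (ennreal ((?m a z)\<^sup>2) * ?e z * indicator R' z)) \<partial>lborel)"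
    by (rule nn_integral_mono_AE[OF AE_mp[OF AE_lborel_inner_Basis_nz AE_I2[OF impI[OF ptw]]]])
  also have "\<dots> = (\<Sum>a\<in>A. ennreal (C\<^sup>2 * card A) * (\<integral>\<^sup>+z. ennreal ((?m a z)\<^sup>2) * ?e z * indicator R' z \<partial>lborel))"
    by (subst nn_integral_sum) (use meas in \<open>auto simp: nn_integral_cmult\<close>)
  also have "\<dots> < \<infinity>" using fin by (simp add: A(1) ennreal_mult_less_top)
  finally have "weighted_L2_on R' (\<lambda>z. ereal (1 + \<epsilon>) * \<phi> z) f"
    by (subst weighted_L2_on_iff[OF tor openR(2) R'p continuous_on_holomorphic_vec[OF f R'U]])
  then show thesis using that[OF \<epsilon> openR(2) xR' R'U] by blast
qed

text \<open>Where \<open>\<phi> < C0\<close>, the weight \<open>exp (- 2 \<phi>)\<close> is at most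
  \<open>exp (2 \<epsilon> C0)\<close> times the weight of \<open>(1 + \<epsilon>) \<phi>\<close>.
  Large positive values of \<open>\<phi>\<close> are the reason for shrinking
  \<open>U\<close>.\<close>

lemma weighted_L2_on_decrease:
  fixes \<phi> :: "complex^'n \<Rightarrow> ereal"
  assumes tor: "toric_psh_on_polydisk r \<phi>" and x: "x \<in> U" and U: "open U" "U \<subseteq> polydisk r" and \<epsilon>: "\<epsilon> > 0"
    and f: "holomorphic_vec_on f U" and L2: "weighted_L2_on U (\<lambda>z. ereal (1 + \<epsilon>) * \<phi> z) f"
  obtains V where "open V" "x \<in> V" "V \<subseteq> U" "weighted_L2_on V \<phi> f"
proof -
  have "\<phi> x < \<infinity>" using toric_usc(2)[OF tor] x U by blast
  then obtain C0 where C0: "\<phi> x < ereal C0" using ereal_dense2 by blast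
  define V where "V = U \<inter> {z \<in> polydisk r. \<phi> z < ereal C0}"
  have V: "open V" "x \<in> V" "V \<subseteq> U" "V \<subseteq> polydisk r"
    using U x C0 toric_usc(1)[OF tor] by (auto simp: V_def)
  have cont: "continuous_on U f" "continuous_on V f" using continuous_on_holomorphic_vec[OF f] V by auto
  let ?C = "ennreal (exp (2 * \<epsilon> * C0))"
  let ?g = "\<lambda>z. ennreal ((cmod (f z))\<^sup>2) * exp_ereal (- 2 * (ereal (1 + \<epsilon>) * \<phi> z)) * indicator U z"
  have "exp_ereal (- 2 * (ereal 1 * \<phi> z)) \<le> ?C * exp_ereal (- 2 * (ereal (1 + \<epsilon>) * \<phi> z))" if "z \<in> V" for z
  proof (cases "\<phi> z")
    case (real t)
    then have "t \<le> C0" using that by (simp add: V_def)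
    then have "\<epsilon> * t \<le> \<epsilon> * C0" using \<epsilon> by simp
    then have "exp (- 2 * t) \<le> exp (2 * \<epsilon> * C0) * exp (- 2 * ((1 + \<epsilon>) * t))"
      unfolding mult_exp_exp by (simp add: algebra_simps)
    then have "ennreal (exp (- 2 * t)) \<le> ?C * ennreal (exp (- 2 * ((1 + \<epsilon>) * t)))"
      by (subst ennreal_mult'[symmetric]) (auto intro: ennreal_leI)
    then show ?thesis using real by (simp add: exp_ereal_def)
  next
    case PInf then show ?thesis using that by (simp add: V_def)
  next
    case MInf then show ?thesis using \<epsilon> by (simp add: exp_ereal_def ennreal_mult_top)
  qed
  then have le: "ennreal ((cmod (f z))\<^sup>2) * exp_ereal (- 2 * (ereal 1 * \<phi> z)) * indicator V z \<le> ?C * ?g z" for z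
    using V(3) mult_left_mono[of "exp_ereal (- 2 * (ereal 1 * \<phi> z))" "?C * exp_ereal (- 2 * (ereal (1 + \<epsilon>) * \<phi> z))" "ennreal ((cmod (f z))\<^sup>2)"]
    by (cases "z \<in> V") (auto simp: mult_ac)
  have "(\<integral>\<^sup>+z. ennreal ((cmod (f z))\<^sup>2) * exp_ereal (- 2 * (ereal 1 * \<phi> z)) * indicator V z \<partial>lborel)
     \<le> (\<integral>\<^sup>+z. ?C * ?g z \<partial>lborel)" by (intro nn_integral_mono le)
  also have "\<dots> = ?C * (\<integral>\<^sup>+z. ?g z \<partial>lborel)"
    by (rule nn_integral_cmult) (use borel_measurable_weighted[OF tor U cont(1)] in simp)
  also have "\<dots> < \<infinity>"
    using L2 by (subst (asm) weighted_L2_on_iff[OF tor U cont(1)]) (simp add: ennreal_mult_less_top)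
  finally have "weighted_L2_on V (\<lambda>z. ereal 1 * \<phi> z) f"
    by (subst weighted_L2_on_iff[OF tor V(1,4) cont(2)])
  then show thesis using that[OF V(1-3)] by (simp flip: one_ereal_def)
qed

theorem corollary1p15:
  fixes \<phi> :: "complex^'n \<Rightarrow> ereal" and r :: real
  assumes "r > 0"
    and "toric_psh_on_polydisk r \<phi>"
  shows "multiplier_ideal_sheaf_plus (polydisk r) \<phi> = multiplier_ideal_sheaf (polydisk r) \<phi>"
proof -
  have sub: "multiplier_ideal (polydisk r) (\<lambda>z. ereal (1 + \<epsilon>) * \<phi> z) x \<subseteq> multiplier_ideal (polydisk r) \<phi> x"
    if eps: "\<epsilon> > 0" for x \<epsilon>
  proof
    fix G assume "G \<in> multiplier_ideal (polydisk r) (\<lambda>z. ereal (1 + \<epsilon>) * \<phi> z) x"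
    then obtain f U where G: "G = germ x f" and U: "open U" "x \<in> U" "U \<subseteq> polydisk r" "holomorphic_vec_on f U"
      "weighted_L2_on U (\<lambda>z. ereal (1 + \<epsilon>) * \<phi> z) f" unfolding multiplier_ideal_def by blast
    obtain V where V: "open V" "x \<in> V" "V \<subseteq> U" "weighted_L2_on V \<phi> f"
      by (rule weighted_L2_on_decrease[OF assms(2) U(2,1,3) eps U(4,5)])
    then show "G \<in> multiplier_ideal (polydisk r) \<phi> x"
      unfolding multiplier_ideal_def G using U holomorphic_vec_on_subset[OF U(4) V(1,3)] by blast
  qed
  \<comment> \<open>Here \<epsilon> depends on the point and on the germ, which is all that
    membership in a union of etale spaces demands.\<close>
  have ex: "\<exists>\<epsilon>>0. G \<in> multiplier_ideal (polydisk r) (\<lambda>z. ereal (1 + \<epsilon>) * \<phi> z) x"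
    if G0: "G \<in> multiplier_ideal (polydisk r) \<phi> x" for x G
  proof -
    obtain f U where G: "G = germ x f" and U: "open U" "x \<in> U" "U \<subseteq> polydisk r" "holomorphic_vec_on f U"
      "weighted_L2_on U \<phi> f" using G0 unfolding multiplier_ideal_def by blast
    obtain \<epsilon> V where V: "\<epsilon> > 0" "open V" "x \<in> V" "V \<subseteq> U" "weighted_L2_on V (\<lambda>z. ereal (1 + \<epsilon>) * \<phi> z) f"
      by (rule weighted_L2_on_strong_openness[OF assms(2) U(2,1,3,4,5)])
    then show ?thesis
      unfolding multiplier_ideal_def G using U holomorphic_vec_on_subset[OF U(4) V(2,4)] by blast
  qed
  show ?thesis
    unfolding multiplier_ideal_sheaf_plus_def multiplier_ideal_sheaf_def
  proof (intro subset_antisym subsetI)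
    fix y
    assume "y \<in> (\<Union>\<epsilon>\<in>{0<..}. SIGMA x:polydisk r. multiplier_ideal (polydisk r) (\<lambda>z. ereal (1 + \<epsilon>) * \<phi> z) x)"
    then obtain \<epsilon> x G where "\<epsilon> > 0" "y = (x, G)" "x \<in> polydisk r"
      "G \<in> multiplier_ideal (polydisk r) (\<lambda>z. ereal (1 + \<epsilon>) * \<phi> z) x" by blast
    then show "y \<in> (SIGMA x:polydisk r. multiplier_ideal (polydisk r) \<phi> x)" using sub[of \<epsilon> x] by blast
  next
    fix y assume "y \<in> (SIGMA x:polydisk r. multiplier_ideal (polydisk r) \<phi> x)"
    then obtain x G where y: "y = (x, G)" "x \<in> polydisk r" "G \<in> multiplier_ideal (polydisk r) \<phi> x" by blast
    obtain \<epsilon> where "\<epsilon> > 0" "G \<in> multiplier_ideal (polydisk r) (\<lambda>z. ereal (1 + \<epsilon>) * \<phi> z) x"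
      using ex[OF y(3)] by blast
    then show "y \<in> (\<Union>\<epsilon>\<in>{0<..}. SIGMA x:polydisk r. multiplier_ideal (polydisk r) (\<lambda>z. ereal (1 + \<epsilon>) * \<phi> z) x)"
      using y by blast
  qed
qed

end
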